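(* Let $G$ be a Cohen--Macaulay chordal graph, let $F_1,\ldots,F_m$ be the maximal cliques of $G$ which admit a free vertex, let $w_i$ be a free vertex contained in $F_i$ for each $i$, and let $S=\Bbbk[V(G)]$. Then the Hilbert series of $H^m_{\mathfrak{m}}(S/I(G))$ is $$F(H^m_{\mathfrak{m}}(S/I(G)),t)=\sum_\ell\dim_\Bbbk[H^m_{\mathfrak{m}}(S/I(G))]_\ell\,t^\ell=\sum_i\ \sum_{C\in\mathrm{Min}(G)}\binom{|(V(G)\setminus\{w_1,\ldots,w_m\})\setminus C|}{i}\left(\frac{t^{-1}}{1-t^{-1}}\right)^{m-i}.$$
   Context: Graphs are finite simple graphs; $\Bbbk$ is an arbitrary field. The edge ideal $I(G)\subseteq\Bbbk[V(G)]$ is generated by the products $uv$ with $\{u,v\}\in E(G)$; $G$ is Cohen--Macaulay if $\Bbbk[V(G)]/I(G)$ is Cohen--Macaulay. A clique is a vertex set inducing a complete subgraph; a free vertex is a vertex belonging to exactly one maximal clique. $\mathrm{Min}(G)$ is the set of inclusion-minimal vertex covers of $G$. $\mathfrak{m}$ is the homogeneous maximal ideal of $S$ (standard grading); the right-hand side is read as a power series in $t^{-1}$. *)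

theory Defs
  imports
    "HOL-Algebra.Algebra"
    "HOL-Library.Extended_Nat"
    "HOL-Library.Poly_Mapping"
    "HOL-Computational_Algebra.Formal_Laurent_Series"
    "Jordan_Normal_Form.VS_Connect"
begin

hide_const (open) Multiset.mult Polynomial.smult Wellorder_Constructions.zero

section \<open>Graphs\<close>

text \<open>A graph is given by its vertex set \<open>V\<close> and its set \<open>E\<close> of edges, which are two-element
  subsets of \<open>V\<close>.\<close>

definition simple_graph :: "'v set \<Rightarrow> 'v set set \<Rightarrow> bool" where
  "simple_graph V E \<longleftrightarrow> finite V \<and> (\<forall>e\<in>E. e \<subseteq> V \<and> card e = 2)"

definition chordal :: "'v set \<Rightarrow> 'v set set \<Rightarrow> bool" where
  "chordal V E \<longleftrightarrow>
    (\<forall>c. distinct c \<and> set c \<subseteq> V \<and> length c \<ge> 4 \<and>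
         (\<forall>i<length c. {c ! i, c ! (Suc i mod length c)} \<in> E) \<longrightarrow>
       (\<exists>i<length c. \<exists>j<length c. {c ! i, c ! j} \<in> E \<and>
          j \<noteq> Suc i mod length c \<and> i \<noteq> Suc j mod length c))"

definition clique :: "'v set \<Rightarrow> 'v set set \<Rightarrow> 'v set \<Rightarrow> bool" where
  "clique V E C \<longleftrightarrow> C \<subseteq> V \<and> (\<forall>u\<in>C. \<forall>v\<in>C. u \<noteq> v \<longrightarrow> {u, v} \<in> E)"

definition maximal_clique :: "'v set \<Rightarrow> 'v set set \<Rightarrow> 'v set \<Rightarrow> bool" where
  "maximal_clique V E C \<longleftrightarrow> clique V E C \<and> (\<forall>D. clique V E D \<and> C \<subseteq> D \<longrightarrow> D = C)"

definition free_vertex :: "'v set \<Rightarrow> 'v set set \<Rightarrow> 'v \<Rightarrow> bool" where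
  "free_vertex V E v \<longleftrightarrow> v \<in> V \<and> (\<exists>!C. maximal_clique V E C \<and> v \<in> C)"

definition vertex_cover :: "'v set \<Rightarrow> 'v set set \<Rightarrow> 'v set \<Rightarrow> bool" where
  "vertex_cover V E C \<longleftrightarrow> C \<subseteq> V \<and> (\<forall>e\<in>E. e \<inter> C \<noteq> {})"

definition Min_covers :: "'v set \<Rightarrow> 'v set set \<Rightarrow> 'v set set" where
  "Min_covers V E =
    {C. vertex_cover V E C \<and> (\<forall>D. vertex_cover V E D \<and> D \<subseteq> C \<longrightarrow> D = C)}"


section \<open>Cohen--Macaulay rings\<close>

definition regular_sequence :: "('a, 'b) ring_scheme \<Rightarrow> 'a list \<Rightarrow> bool" where
  "regular_sequence R xs \<longleftrightarrow>
    set xs \<subseteq> carrier R \<and>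
    (\<forall>i<length xs. \<forall>a\<in>carrier R.
       xs ! i \<otimes>\<^bsub>R\<^esub> a \<in> genideal R (set (take i xs)) \<longrightarrow> a \<in> genideal R (set (take i xs))) \<and>
    genideal R (set xs) \<noteq> carrier R"

definition ideal_depth :: "('a, 'b) ring_scheme \<Rightarrow> 'a set \<Rightarrow> enat" where
  "ideal_depth R P = (SUP xs\<in>{xs. regular_sequence R xs \<and> set xs \<subseteq> P}. enat (length xs))"

definition prime_height :: "('a, 'b) ring_scheme \<Rightarrow> 'a set \<Rightarrow> enat" where
  "prime_height R P =
    (SUP n\<in>{n. \<exists>Q. (\<forall>i\<le>n. primeideal (Q i) R) \<and> (\<forall>i<n. Q i \<subset> Q (Suc i)) \<and> Q n = P}. enat n)"

text \<open>For a maximal ideal \<open>P\<close> of a Noetherian ring, the two numbers compared below are the depth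
  and the Krull dimension of the localization at \<open>P\<close>; this form of the definition (Eisenbud,
  Commutative Algebra, Section 18.2) avoids constructing that local ring.\<close>

definition Cohen_Macaulay_ring :: "('a, 'b) ring_scheme \<Rightarrow> bool" where
  "Cohen_Macaulay_ring R \<longleftrightarrow>
    cring R \<and> noetherian_ring R \<and> (\<forall>P. maximalideal P R \<longrightarrow> ideal_depth R P = prime_height R P)"


section \<open>Modules: quotients, localizations, Cech cohomology\<close>

text \<open>The library's module records extend ring records; the fields \<open>mult\<close> and \<open>one\<close>
  are irrelevant for a module.\<close>

definition self_module :: "('a, 'b) ring_scheme \<Rightarrow> ('a, 'a) module" where
  "self_module R =
    \<lparr>carrier = carrier R, mult = mult R, one = one R, zero = zero R, add = add R,
     smult = mult R\<rparr>"

definition quotient_module :: "('r, 'm, 'c) module_scheme \<Rightarrow> 'm set \<Rightarrow> ('r, 'm set) module" where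
  "quotient_module M N =
    \<lparr>carrier = a_rcosets\<^bsub>M\<^esub> N, mult = undefined, one = undefined, zero = N,
     add = set_add M,
     smult = (\<lambda>r P. \<Union>a\<in>P. N +>\<^bsub>M\<^esub> (r \<odot>\<^bsub>M\<^esub> a))\<rparr>"

text \<open>\<open>fraction R M s a k\<close> is the fraction \<open>a / s^k\<close> in the localization of \<open>M\<close> at the powers
  of \<open>s\<close>, as an equivalence class of pairs.\<close>

definition fraction ::
  "('r, 'b) ring_scheme \<Rightarrow> ('r, 'm, 'c) module_scheme \<Rightarrow> 'r \<Rightarrow> 'm \<Rightarrow> nat \<Rightarrow> ('m \<times> nat) set" where
  "fraction R M s a k =
    {(b, l). b \<in> carrier M \<and>
       (\<exists>j::nat. (s [^]\<^bsub>R\<^esub> (j + l)) \<odot>\<^bsub>M\<^esub> a = (s [^]\<^bsub>R\<^esub> (j + k)) \<odot>\<^bsub>M\<^esub> b)}"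

definition localization ::
  "('r, 'b) ring_scheme \<Rightarrow> ('r, 'm, 'c) module_scheme \<Rightarrow> 'r \<Rightarrow> ('r, ('m \<times> nat) set) module" where
  "localization R M s =
    \<lparr>carrier = {fraction R M s a k | a k. a \<in> carrier M},
     mult = undefined, one = undefined,
     zero = fraction R M s \<zero>\<^bsub>M\<^esub> 0,
     add = (\<lambda>P Q. \<Union>(a, k)\<in>P. \<Union>(b, l)\<in>Q.
       fraction R M s ((s [^]\<^bsub>R\<^esub> l) \<odot>\<^bsub>M\<^esub> a \<oplus>\<^bsub>M\<^esub> (s [^]\<^bsub>R\<^esub> k) \<odot>\<^bsub>M\<^esub> b) (k + l)),
     smult = (\<lambda>r P. \<Union>(a, k)\<in>P. fraction R M s (r \<odot>\<^bsub>M\<^esub> a) k)\<rparr>"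

text \<open>If \<open>u = s t\<close>, then \<open>localization_map R M t u\<close> is the canonical map from the localization
  at \<open>s\<close> to the localization at \<open>u\<close>, sending \<open>a / s^k\<close> to \<open>t^k a / u^k\<close>.\<close>

definition localization_map ::
  "('r, 'b) ring_scheme \<Rightarrow> ('r, 'm, 'c) module_scheme \<Rightarrow> 'r \<Rightarrow> 'r \<Rightarrow>
     ('m \<times> nat) set \<Rightarrow> ('m \<times> nat) set" where
  "localization_map R M t u P = (\<Union>(a, k)\<in>P. fraction R M u ((t [^]\<^bsub>R\<^esub> k) \<odot>\<^bsub>M\<^esub> a) k)"

text \<open>The Cech complex of \<open>M\<close> with respect to a family \<open>x\<close> of ring elements with finite,
  totally ordered index set \<open>V\<close>; the order only serves to fix the signs of the differential.\<close>

definition cech_localization ::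
  "('r, 'b) ring_scheme \<Rightarrow> ('r, 'm, 'c) module_scheme \<Rightarrow> ('i \<Rightarrow> 'r) \<Rightarrow> 'i set \<Rightarrow>
     ('r, ('m \<times> nat) set) module" where
  "cech_localization R M x A = localization R M (finprod R x A)"

definition cech_cochains ::
  "('r, 'b) ring_scheme \<Rightarrow> ('r, 'm, 'c) module_scheme \<Rightarrow> ('i \<Rightarrow> 'r) \<Rightarrow> 'i set \<Rightarrow> nat \<Rightarrow>
     ('r, 'i set \<Rightarrow> ('m \<times> nat) set) module" where
  "cech_cochains R M x V p =
    (let I = {A. A \<subseteq> V \<and> card A = p}; L = cech_localization R M x in
     \<lparr>carrier = (\<Pi>\<^sub>E A\<in>I. carrier (L A)), mult = undefined, one = undefined,
      zero = (\<lambda>A\<in>I. zero (L A)),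
      add = (\<lambda>c d. \<lambda>A\<in>I. add (L A) (c A) (d A)),
      smult = (\<lambda>r c. \<lambda>A\<in>I. module.smult (L A) r (c A))\<rparr>)"

definition cech_differential ::
  "('r, 'b) ring_scheme \<Rightarrow> ('r, 'm, 'c) module_scheme \<Rightarrow> ('i::linorder \<Rightarrow> 'r) \<Rightarrow> 'i set \<Rightarrow> nat \<Rightarrow>
     ('i set \<Rightarrow> ('m \<times> nat) set) \<Rightarrow> ('i set \<Rightarrow> ('m \<times> nat) set)" where
  "cech_differential R M x V p c =
    (\<lambda>B\<in>{B. B \<subseteq> V \<and> card B = Suc p}.
       finsum (cech_localization R M x B)
         (\<lambda>v. ((\<ominus>\<^bsub>R\<^esub> \<one>\<^bsub>R\<^esub>) [^]\<^bsub>R\<^esub> card {u\<in>B. u < v}) \<odot>\<^bsub>cech_localization R M x B\<^esub>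
                localization_map R M (x v) (finprod R x B) (c (B - {v})))
         B)"

definition cech_cocycles ::
  "('r, 'b) ring_scheme \<Rightarrow> ('r, 'm, 'c) module_scheme \<Rightarrow> ('i::linorder \<Rightarrow> 'r) \<Rightarrow> 'i set \<Rightarrow> nat \<Rightarrow>
     ('i set \<Rightarrow> ('m \<times> nat) set) set" where
  "cech_cocycles R M x V p =
    {c \<in> carrier (cech_cochains R M x V p).
       cech_differential R M x V p c = zero (cech_cochains R M x V (Suc p))}"

definition cech_coboundaries ::
  "('r, 'b) ring_scheme \<Rightarrow> ('r, 'm, 'c) module_scheme \<Rightarrow> ('i::linorder \<Rightarrow> 'r) \<Rightarrow> 'i set \<Rightarrow> nat \<Rightarrow>
     ('i set \<Rightarrow> ('m \<times> nat) set) set" where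
  "cech_coboundaries R M x V p =
    (case p of
       0 \<Rightarrow> {zero (cech_cochains R M x V 0)}
     | Suc q \<Rightarrow> cech_differential R M x V q ` carrier (cech_cochains R M x V q))"

text \<open>Local cohomology of \<open>M\<close> with support in the ideal of \<open>R\<close> generated by the family \<open>x\<close>,
  defined as the cohomology of the Cech complex; for Noetherian \<open>R\<close> this agrees with the right
  derived functors of the torsion functor.\<close>

definition local_cohomology ::
  "('r, 'b) ring_scheme \<Rightarrow> ('r, 'm, 'c) module_scheme \<Rightarrow> ('i::linorder \<Rightarrow> 'r) \<Rightarrow> 'i set \<Rightarrow> nat \<Rightarrow>
     ('r, ('i set \<Rightarrow> ('m \<times> nat) set) set) module" where
  "local_cohomology R M x V p =
    quotient_module
      ((cech_cochains R M x V p)\<lparr>carrier := cech_cocycles R M x V p\<rparr>)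
      (cech_coboundaries R M x V p)"

text \<open>Let \<open>R\<close> be graded, let \<open>M\<close> be a graded module with homogeneous components \<open>gr l\<close>, and let
  all \<open>x v\<close> be homogeneous of degree 1. Then the fraction \<open>a / (\<Prod>v\<in>A. x v)^k\<close> has degree \<open>l\<close>
  if \<open>a\<close> has degree \<open>l + k |A|\<close>. The component of degree \<open>l\<close> of local cohomology consists of the
  classes of cocycles all of whose entries have degree \<open>l\<close>.\<close>

definition cech_localization_component ::
  "('r, 'b) ring_scheme \<Rightarrow> ('r, 'm, 'c) module_scheme \<Rightarrow> (int \<Rightarrow> 'm set) \<Rightarrow> ('i \<Rightarrow> 'r) \<Rightarrow> 'i set \<Rightarrow>
     int \<Rightarrow> ('m \<times> nat) set set" where
  "cech_localization_component R M gr x A l =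
    {fraction R M (finprod R x A) a k | a k. a \<in> gr (l + int k * int (card A))}"

definition local_cohomology_component ::
  "('r, 'b) ring_scheme \<Rightarrow> ('r, 'm, 'c) module_scheme \<Rightarrow> (int \<Rightarrow> 'm set) \<Rightarrow>
     ('i::linorder \<Rightarrow> 'r) \<Rightarrow> 'i set \<Rightarrow> nat \<Rightarrow> int \<Rightarrow> ('i set \<Rightarrow> ('m \<times> nat) set) set set" where
  "local_cohomology_component R M gr x V p l =
    {cech_coboundaries R M x V p +>\<^bsub>cech_cochains R M x V p\<^esub> c | c.
       c \<in> cech_cocycles R M x V p \<and>
       (\<forall>A. A \<subseteq> V \<and> card A = p \<longrightarrow> c A \<in> cech_localization_component R M gr x A l)}"


section \<open>Polynomial rings and edge ideals\<close>

text \<open>Monomials are exponent vectors of finite support.\<close>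

type_synonym ('v, 'k) mpoly = "('v \<Rightarrow>\<^sub>0 nat) \<Rightarrow>\<^sub>0 'k"

definition variable :: "'v \<Rightarrow> ('v, 'k::field) mpoly" where
  "variable v = Poly_Mapping.single (Poly_Mapping.single v 1) 1"

definition scalar :: "'k \<Rightarrow> ('v, 'k::field) mpoly" where
  "scalar c = Poly_Mapping.single 0 c"

definition mpoly_ring :: "'v set \<Rightarrow> ('v, 'k::field) mpoly ring" where
  "mpoly_ring V =
    \<lparr>carrier = {f. \<forall>a\<in>Poly_Mapping.keys f. Poly_Mapping.keys a \<subseteq> V},
     mult = (*), one = 1, zero = 0, add = (+)\<rparr>"

definition monomial_degree :: "('v \<Rightarrow>\<^sub>0 nat) \<Rightarrow> nat" where
  "monomial_degree a = (\<Sum>v\<in>Poly_Mapping.keys a. Poly_Mapping.lookup a v)"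

definition mpoly_component :: "'v set \<Rightarrow> int \<Rightarrow> ('v, 'k::field) mpoly set" where
  "mpoly_component V l =
    {f \<in> carrier (mpoly_ring V). \<forall>a\<in>Poly_Mapping.keys f. int (monomial_degree a) = l}"

definition edge_ideal :: "'v set \<Rightarrow> 'v set set \<Rightarrow> ('v, 'k::field) mpoly set" where
  "edge_ideal V E = genideal (mpoly_ring V) {variable u * variable v | u v. {u, v} \<in> E}"

definition Cohen_Macaulay_graph :: "'k::field itself \<Rightarrow> 'v set \<Rightarrow> 'v set set \<Rightarrow> bool" where
  "Cohen_Macaulay_graph _ V E \<longleftrightarrow>
    Cohen_Macaulay_ring ((mpoly_ring V :: ('v, 'k) mpoly ring) Quot edge_ideal V E)"

definition edge_ring_module ::
  "'v set \<Rightarrow> 'v set set \<Rightarrow> (('v, 'k::field) mpoly, ('v, 'k) mpoly set) module" where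
  "edge_ring_module V E = quotient_module (self_module (mpoly_ring V)) (edge_ideal V E)"

definition edge_ring_component ::
  "'v set \<Rightarrow> 'v set set \<Rightarrow> int \<Rightarrow> ('v, 'k::field) mpoly set set" where
  "edge_ring_component V E l =
    (\<lambda>f. edge_ideal V E +>\<^bsub>mpoly_ring V\<^esub> f) ` mpoly_component V l"

text \<open>The vector space over \<open>'k\<close> formed by the degree \<open>l\<close> part of the \<open>p\<close>-th local cohomology of
  the quotient of \<open>mpoly_ring V\<close> by the edge ideal, supported in the homogeneous maximal ideal
  (which is generated by the variables).\<close>

definition edge_local_cohomology ::
  "'v::linorder set \<Rightarrow> 'v set set \<Rightarrow> nat \<Rightarrow> int \<Rightarrow>
     ('k::field, ('v set \<Rightarrow> (('v, 'k) mpoly set \<times> nat) set) set) module" where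
  "edge_local_cohomology V E p l =
    (let H = local_cohomology (mpoly_ring V) (edge_ring_module V E) variable V p in
     \<lparr>carrier = local_cohomology_component (mpoly_ring V) (edge_ring_module V E)
                  (edge_ring_component V E) variable V p l,
      mult = undefined, one = undefined, zero = zero H, add = add H,
      smult = (\<lambda>c. module.smult H (scalar c))\<rparr>)"

text \<open>The Hilbert series is an expression in \<open>t\<inverse>\<close>, which is represented by the indeterminate
  \<open>fls_X\<close>; hence its coefficient of \<open>t^l\<close> is the coefficient of \<open>fls_X\<close> to the power \<open>- l\<close>.\<close>

definition has_Hilbert_series ::
  "(int \<Rightarrow> ('k::field, 'm, 'c) module_scheme) \<Rightarrow> rat fls \<Rightarrow> bool" where
  "has_Hilbert_series H f \<longleftrightarrow>
    (\<forall>l. vectorspace class_ring (H l) \<and> vectorspace.fin_dim class_ring (H l) \<and>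
         of_nat (vectorspace.dim class_ring (H l)) = fls_nth f (- l))"

end

theory Submission imports Defs begin

text \<open>Write \<open>W\<close> for the set of the chosen free vertices and call a set of vertices stable if it
  contains no edge; the minimal vertex covers are the complements of the maximal stable sets. The
  theorem is proved for all graphs with a partition of the vertices into cliques \<open>F 1, \<dots>, F m\<close> such
  that all neighbours of \<open>w i\<close> lie in \<open>F i\<close> (locale \<open>simplex_partition\<close>); two facts have to be
  combined for this.

  A Cohen--Macaulay chordal graph has such a partition. The Cohen--Macaulay condition is used at the
  origin only. There the height is at least the size of any stable set, by a chain of primes
  generated by variables, and the depth is at most the size of any maximal stable set \<open>T\<close>: if \<open>u\<close>
  is the product of the variables in \<open>T\<close>, the annihilator of \<open>u\<close> is generated by the other
  variables, so more than \<open>card T\<close> elements \<open>f i\<close> satisfy a polynomial relation on \<open>u\<close>. Regular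
  sequences are quasi-regular (\<open>regular_imp_quasi_regular\<close>), which forces \<open>u\<close> into all powers of the
  ideal generated by the \<open>f i\<close>; for elements without constant term its degree forbids this. Hence
  all maximal stable sets have the same size (\<open>Cohen_Macaulay_imp_well_covered\<close>), and in a chordal
  graph with this property the maximal cliques with a free vertex form a partition
  (\<open>simplices_disjoint\<close>, \<open>simplices_cover\<close>).

  For a graph with such a partition the local cohomology can be computed by hand. The Cech complex
  is graded by the exponents of Laurent monomials, and it vanishes above degree \<open>m\<close>, because a stable
  set has at most one vertex in each clique; so the \<open>m\<close>-th cohomology is a cokernel. In a multidegree
  with a positive exponent it is zero. In a multidegree with support \<open>\<sigma>\<close> and nonpositive exponents
  the cochains are the functions on the maximal stable sets that contain \<open>\<sigma>\<close>, and modulo coboundaries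
  a vertex \<open>w i\<close> outside \<open>\<sigma>\<close> can be exchanged for the other vertices of its clique. The maximal
  stable sets \<open>G\<close> with \<open>\<sigma> \<subseteq> G\<close> that meet \<open>W\<close> in \<open>\<sigma>\<close> only therefore span the cohomology. They form a
  basis: exchanging vertices of \<open>G\<close> outside \<open>\<sigma>\<close> for those in \<open>W\<close> gives the boundary of a cross
  polytope, and the pairings with these cycles separate the classes
  (\<open>coboundary_iff_pairing_zero\<close>).

  It remains to count. With \<open>y\<close> for \<open>1 / (t - 1)\<close>, a fixed maximal stable set \<open>G\<close>
  contributes a factor \<open>y\<close> for each vertex in \<open>W\<close>, whose exponent must be negative, and a factor
  \<open>1 + y\<close> for each other vertex. Expanding the powers of \<open>1 + y\<close> by the binomial theorem gives the
  formula.\<close>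


section \<open>Chordal graphs\<close>

definition stable_set :: "'v set \<Rightarrow> 'v set set \<Rightarrow> 'v set \<Rightarrow> bool" where
  "stable_set V E T \<longleftrightarrow> T \<subseteq> V \<and> (\<forall>x\<in>T. \<forall>y\<in>T. {x, y} \<notin> E)"

definition maximal_stable :: "'v set \<Rightarrow> 'v set set \<Rightarrow> 'v set \<Rightarrow> bool" where
  "maximal_stable V E T \<longleftrightarrow>
     stable_set V E T \<and> (\<forall>Y. stable_set V E Y \<and> T \<subseteq> Y \<longrightarrow> Y = T)"

locale finite_simple_graph =
  fixes V :: "'v set" and E :: "'v set set"
  assumes simple: "simple_graph V E"
begin

lemma finite_vertices: "finite V"
  using simple unfolding simple_graph_def by blast

lemma edge_vertices:
  assumes "{x, y} \<in> E"
  shows "x \<in> V" "y \<in> V" "x \<noteq> y"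
  using simple assms unfolding simple_graph_def by fastforce+

lemma no_loop: "{x, x} \<notin> E" "{x} \<notin> E"
  using edge_vertices(3)[of x x] by auto

lemma edge_cases:
  assumes "e \<in> E"
  obtains x y where "e = {x, y}" "x \<noteq> y" "x \<in> V" "y \<in> V"
  using simple assms unfolding simple_graph_def card_2_iff by (metis insert_subset)

lemma exists_maximal_above:
  assumes "P T" "\<And>Y. P Y \<Longrightarrow> Y \<subseteq> V"
  obtains Y where "P Y" "T \<subseteq> Y" "\<And>Z. P Z \<Longrightarrow> Y \<subseteq> Z \<Longrightarrow> Z = Y"
proof -
  have "finite {Y. P Y \<and> T \<subseteq> Y}"
    by (rule finite_subset[of _ "Pow V"]) (use assms(2) finite_vertices in auto)
  moreover have "T \<in> {Y. P Y \<and> T \<subseteq> Y}" using assms(1) by simp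
  ultimately have "\<exists>Y\<in>{Y. P Y \<and> T \<subseteq> Y}. T \<subseteq> Y \<and> (\<forall>Z\<in>{Y. P Y \<and> T \<subseteq> Y}. Y \<subseteq> Z \<longrightarrow> Y = Z)"
    by (rule finite_has_maximal2)
  then obtain Y where Y: "P Y" "T \<subseteq> Y" "\<forall>Z\<in>{Y. P Y \<and> T \<subseteq> Y}. Y \<subseteq> Z \<longrightarrow> Y = Z" by auto
  show thesis
  proof (rule that[OF Y(1,2)])
    fix Z assume "P Z" "Y \<subseteq> Z"
    then show "Z = Y" using Y(2,3) by (metis (mono_tags, lifting) mem_Collect_eq order_trans)
  qed
qed

lemma clique_extends:
  assumes "clique V E T"
  obtains Y where "maximal_clique V E Y" "T \<subseteq> Y"
proof (rule exists_maximal_above[of "clique V E" T])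
  show "clique V E T" by fact
  show "Y \<subseteq> V" if "clique V E Y" for Y using that by (simp add: clique_def)
  fix Y assume Y: "clique V E Y" "T \<subseteq> Y" "\<And>Z. clique V E Z \<Longrightarrow> Y \<subseteq> Z \<Longrightarrow> Z = Y"
  then have "maximal_clique V E Y" by (simp add: maximal_clique_def)
  then show thesis using Y(2) by (rule that)
qed

lemma stable_set_extends:
  assumes "stable_set V E T"
  obtains Y where "maximal_stable V E Y" "T \<subseteq> Y"
proof (rule exists_maximal_above[of "stable_set V E" T])
  show "stable_set V E T" by fact
  show "Y \<subseteq> V" if "stable_set V E Y" for Y using that by (simp add: stable_set_def)
  fix Y assume Y: "stable_set V E Y" "T \<subseteq> Y" "\<And>Z. stable_set V E Z \<Longrightarrow> Y \<subseteq> Z \<Longrightarrow> Z = Y"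
  then have "maximal_stable V E Y" by (simp add: maximal_stable_def)
  then show thesis using Y(2) by (rule that)
qed

lemma free_vertex_neighbour:
  assumes "free_vertex V E w" "maximal_clique V E C" "w \<in> C" "{w, u} \<in> E"
  shows "u \<in> C"
proof -
  have "clique V E {w, u}"
    using edge_vertices[OF assms(4)] assms(4) by (auto simp: clique_def insert_commute)
  then obtain D where "maximal_clique V E D" "{w, u} \<subseteq> D" by (rule clique_extends)
  then show ?thesis using assms(1-3) unfolding free_vertex_def by blast
qed

lemma free_vertexI:
  assumes "maximal_clique V E C" "w \<in> C" "\<And>u. {w, u} \<in> E \<Longrightarrow> u \<in> C"
  shows "free_vertex V E w"
proof -
  have C: "clique V E C" using assms(1) by (simp add: maximal_clique_def)
  have "D = C" if D: "maximal_clique V E D" "w \<in> D" for D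
  proof -
    have "clique V E D" using D(1) by (simp add: maximal_clique_def)
    then have "{w, x} \<in> E" if "x \<in> D" "x \<noteq> w" for x
      using that D(2) unfolding clique_def by fast
    then have "D \<subseteq> C" using assms(2,3) by blast
    then show ?thesis using D(1)[unfolded maximal_clique_def, THEN conjunct2, rule_format, of C] C by simp
  qed
  with assms(1,2) have "\<exists>!C. maximal_clique V E C \<and> w \<in> C" by blast
  moreover have "w \<in> V" using C assms(2) by (auto simp: clique_def)
  ultimately show ?thesis unfolding free_vertex_def by simp
qed

subsection \<open>Walks and chordless paths\<close>

abbreviation walk :: "'v list \<Rightarrow> bool" where
  "walk xs \<equiv> xs \<noteq> [] \<and> successively (\<lambda>x y. {x, y} \<in> E) xs"

definition chordless_path :: "'v list \<Rightarrow> bool" where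
  "chordless_path xs \<longleftrightarrow> xs \<noteq> [] \<and> distinct xs \<and>
     (\<forall>i j. i < j \<longrightarrow> j < length xs \<longrightarrow> ({xs ! i, xs ! j} \<in> E \<longleftrightarrow> j = Suc i))"

lemma walk_shortcut:
  assumes w: "walk xs" and ij: "i < j" "j < length xs"
    and e: "{xs ! i, xs ! j} \<in> E \<and> j \<noteq> Suc i \<or> xs ! i = xs ! j"
  obtains ys where "walk ys" "hd ys = hd xs" "last ys = last xs" "set ys \<subseteq> set xs"
    "length ys < length xs"
proof -
  have hj: "drop j xs \<noteq> []" "hd (drop j xs) = xs ! j" using ij by (auto simp: hd_drop_conv_nth)
  have succ: "successively (\<lambda>x y. {x, y} \<in> E) (take k xs)"
    "successively (\<lambda>x y. {x, y} \<in> E) (drop k xs)" for k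
    using w by (simp_all add: successively_conv_nth)
  show thesis
  proof (cases "xs ! i = xs ! j")
    case False
    let ?ys = "take (Suc i) xs @ drop j xs"
    have "last (take (Suc i) xs) = xs ! i" using ij by (simp add: take_Suc_conv_app_nth)
    then have "walk ?ys" using hj succ e False by (simp add: successively_append_iff)
    moreover have "hd ?ys = hd xs" using w by (cases xs) simp_all
    moreover have "last ?ys = last xs" using ij by simp
    moreover have "set ?ys \<subseteq> set xs" by (auto dest: in_set_takeD in_set_dropD)
    moreover have "length ?ys < length xs" using ij e False by auto
    ultimately show ?thesis using that by blast
  next
    case True
    let ?ys = "take i xs @ drop j xs"
    have "walk ?ys"
    proof (cases "i = 0")
      case True
      then show ?thesis using hj succ by auto
    next
      case False
      have tl: "last (take i xs) = xs ! (i - 1)"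
        using ij False by (cases i) (auto simp: take_Suc_conv_app_nth)
      have "Suc (i - 1) < length xs" using ij False by simp
      then have "{xs ! (i - 1), xs ! Suc (i - 1)} \<in> E"
        using w unfolding successively_conv_nth by blast
      then have "{xs ! (i - 1), xs ! j} \<in> E" using False True by simp
      then show ?thesis using tl hj succ by (simp add: successively_append_iff)
    qed
    moreover have "hd ?ys = hd xs"
      using w hj True by (cases xs; cases i) simp_all
    moreover have "last ?ys = last xs" using ij by simp
    moreover have "set ?ys \<subseteq> set xs" by (auto dest: in_set_takeD in_set_dropD)
    moreover have "length ?ys < length xs" using ij by auto
    ultimately show ?thesis using that by blast
  qed
qed

text \<open>Cutting out the part of a walk between the ends of a chord, or between two occurrences of a
  vertex, makes it shorter.\<close>

lemma walk_to_chordless_path: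
  assumes "walk xs"
  shows "\<exists>ys. chordless_path ys \<and> hd ys = hd xs \<and> last ys = last xs \<and> set ys \<subseteq> set xs"
  using assms
proof (induction "length xs" arbitrary: xs rule: less_induct)
  case less
  show ?case
  proof (cases "chordless_path xs")
    case True
    then show ?thesis by blast
  next
    case False
    have succ: "{xs ! i, xs ! Suc i} \<in> E" if "Suc i < length xs" for i
      using less.prems that by (auto simp: successively_conv_nth)
    obtain i j where ij: "i < j" "j < length xs"
      "{xs ! i, xs ! j} \<in> E \<and> j \<noteq> Suc i \<or> xs ! i = xs ! j"
    proof (cases "distinct xs")
      case True
      then obtain i j where "i < j" "j < length xs" "({xs ! i, xs ! j} \<in> E) \<noteq> (j = Suc i)"
        using False less.prems unfolding chordless_path_def by blast
      then show ?thesis using that[of i j] succ[of i] by auto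
    next
      case False
      then obtain i j where "i < length xs" "j < length xs" "i \<noteq> j" "xs ! i = xs ! j"
        unfolding distinct_conv_nth by blast
      then show ?thesis using that[of i j] that[of j i] by (cases "i < j") auto
    qed
    obtain ys where ys: "walk ys" "hd ys = hd xs" "last ys = last xs" "set ys \<subseteq> set xs"
      "length ys < length xs"
      by (rule walk_shortcut[OF less.prems ij])
    from less.hyps[OF ys(5,1)] ys show ?thesis by auto
  qed
qed

definition component :: "'v set \<Rightarrow> 'v \<Rightarrow> 'v set" where
  "component A x = {y. \<exists>xs. walk xs \<and> set xs \<subseteq> A \<and> hd xs = x \<and> last xs = y}"

lemma component_subset: "component A x \<subseteq> A"
  unfolding component_def by (auto intro: last_in_set)

lemma component_self: "x \<in> A \<Longrightarrow> x \<in> component A x"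
  unfolding component_def by (rule CollectI, rule exI[of _ "[x]"]) auto

lemma component_step:
  assumes "y \<in> component A x" "{y, z} \<in> E" "z \<in> A"
  shows "z \<in> component A x"
proof -
  obtain xs where "walk xs" "set xs \<subseteq> A" "hd xs = x" "last xs = y"
    using assms(1) unfolding component_def by blast
  then show ?thesis unfolding component_def using assms(2,3)
    by (intro CollectI exI[of _ "xs @ [z]"]) (auto simp: successively_append_iff)
qed

lemma walk_in_component:
  assumes "walk xs" "set xs \<subseteq> A"
  shows "set xs \<subseteq> component A (hd xs)"
proof -
  have "xs \<noteq> []" using assms by blast
  from this assms show ?thesis
  proof (induction xs rule: rev_nonempty_induct)
    case (single x)
    then show ?case by (auto intro: component_self)
  next
    case (snoc x xs)
    then have "set xs \<subseteq> component A (hd xs)" "{last xs, x} \<in> E" "x \<in> A"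
      by (auto simp: successively_append_iff)
    moreover from this snoc have "last xs \<in> component A (hd xs)" by (meson last_in_set subsetD)
    ultimately show ?case using snoc component_step[of "last xs" A "hd xs" x] by simp
  qed
qed

lemma walk_rev: "walk xs \<Longrightarrow> walk (rev xs)"
  by (simp add: insert_commute)

lemma component_connected:
  assumes "y \<in> component A x" "z \<in> component A x"
  obtains xs where "walk xs" "set xs \<subseteq> component A x" "hd xs = y" "last xs = z"
proof -
  obtain ys where ys: "walk ys" "set ys \<subseteq> A" "hd ys = x" "last ys = y"
    using assms(1) unfolding component_def by blast
  obtain zs where zs: "walk zs" "set zs \<subseteq> A" "hd zs = x" "last zs = z"
    using assms(2) unfolding component_def by blast
  have s: "set ys \<subseteq> component A x" "set zs \<subseteq> component A x"
    using walk_in_component ys zs by metis+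
  show thesis
  proof (cases "tl zs = []")
    case True
    then have "z = x" using zs by (cases zs) auto
    then show ?thesis using that[of "rev ys"] ys s walk_rev[OF ys(1)] by (simp add: hd_rev last_rev)
  next
    case False
    have "zs = x # tl zs" using zs by (cases zs) auto
    then have t: "successively (\<lambda>x y. {x, y} \<in> E) (tl zs)" "{x, hd (tl zs)} \<in> E"
      using zs False by (metis successively_Cons)+
    have "walk (rev ys @ tl zs)"
      using walk_rev[OF ys(1)] t ys False by (simp add: successively_append_iff last_rev)
    moreover have "set (rev ys @ tl zs) \<subseteq> component A x"
      using s zs by (cases zs) auto
    moreover have "hd (rev ys @ tl zs) = y" using ys by (simp add: hd_rev)
    moreover have "last (rev ys @ tl zs) = z" using False zs by (simp add: last_tl)
    ultimately show ?thesis using that by blast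
  qed
qed

lemma component_eq:
  assumes "y \<in> component A x"
  shows "component A y = component A x"
proof
  show "component A y \<subseteq> component A x"
  proof
    fix z assume "z \<in> component A y"
    then obtain zs where zs: "walk zs" "set zs \<subseteq> A" "hd zs = y" "last zs = z"
      unfolding component_def by blast
    have "zs \<noteq> []" using zs by blast
    from this zs(1-3) have "set zs \<subseteq> component A x"
    proof (induction zs rule: rev_nonempty_induct)
      case (single a)
      then show ?case using assms by auto
    next
      case (snoc a xs)
      then have "set xs \<subseteq> component A x" "{last xs, a} \<in> E" "a \<in> A"
        by (auto simp: successively_append_iff)
      moreover have "last xs \<in> set xs" using snoc by simp
      ultimately show ?case using component_step[of "last xs" A x a] by auto
    qed
    then show "z \<in> component A x" using zs by (metis last_in_set subsetD)
  qed
  show "component A x \<subseteq> component A y"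
  proof
    fix z assume "z \<in> component A x"
    from component_connected[OF assms this] obtain xs where
      "walk xs" "set xs \<subseteq> component A x" "hd xs = y" "last xs = z" .
    moreover from this(2) component_subset have "set xs \<subseteq> A" by (rule subset_trans)
    ultimately show "z \<in> component A y" unfolding component_def by auto
  qed
qed

end

locale chordal_graph = finite_simple_graph V E for V :: "'v set" and E :: "'v set set" +
  assumes chordal: "chordal V E"
begin

text \<open>Otherwise the cycle closed by \<open>z\<close> and the first later neighbour of \<open>z\<close> on the path has
  length at least four and no chord.\<close>

lemma neighbour_of_path_ends:
  assumes path: "chordless_path xs" and len: "length xs \<ge> 3" and z: "z \<notin> set xs"
    and e: "{z, hd xs} \<in> E" "{z, last xs} \<in> E"
  shows "{z, xs ! 1} \<in> E"
proof -
  have dist: "distinct xs" and adj: "\<And>i j. i < j \<Longrightarrow> j < length xs \<Longrightarrow> {xs ! i, xs ! j} \<in> E \<longleftrightarrow> j = Suc i"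
    using path unfolding chordless_path_def by blast+
  have V: "set xs \<subseteq> V" 
  proof
    fix x assume "x \<in> set xs"
    then obtain i where i: "i < length xs" "x = xs ! i" by (metis in_set_conv_nth)
    show "x \<in> V"
    proof (cases "Suc i < length xs")
      case True
      then show ?thesis using adj[of i "Suc i"] i edge_vertices by blast
    next
      case False
      then show ?thesis using adj[of "i-1" i] i len edge_vertices by auto
    qed
  qed
  define P where "P j \<longleftrightarrow> 1 \<le> j \<and> j < length xs \<and> {z, xs ! j} \<in> E" for j
  define j where "j = (LEAST j. P j)"
  have "last xs = xs ! (length xs - 1)" using len by (intro last_conv_nth) auto
  then have "P (length xs - 1)" unfolding P_def using e len by auto
  then have Pj: "P j" and min: "\<And>i. P i \<Longrightarrow> j \<le> i"
    unfolding j_def by (auto intro: LeastI Least_le)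
  have j: "1 \<le> j" "j < length xs" "{z, xs ! j} \<in> E" using Pj unfolding P_def by auto
  have z0: "{z, xs ! 0} \<in> E" using e(1) len by (metis hd_conv_nth list.size(3) not_numeral_le_zero)
  show ?thesis
  proof (cases "j = 1")
    case True
    then show ?thesis using j by simp
  next
    case False
    define c where "c = z # take (Suc j) xs"
    have lc: "length c = j + 2" unfolding c_def using j by simp
    have c0: "c ! 0 = z" unfolding c_def by simp
    have cS: "c ! i = xs ! (i - 1)" if "1 \<le> i" "i < length c" for i
      using that lc unfolding c_def by (cases i) auto
    have cyc: "{c ! i, c ! (Suc i mod length c)} \<in> E" if "i < length c" for i
    proof -
      consider "i = 0" | "1 \<le> i" "Suc i < length c" | "Suc i = length c" using \<open>i < length c\<close> by linarith
      then show ?thesis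
      proof cases
        case 1
        then show ?thesis using lc c0 cS[of 1] z0 by simp
      next
        case 2
        then show ?thesis using cS[of i] cS[of "Suc i"] adj[of "i - 1" i] lc j by simp
      next
        case 3
        then show ?thesis using c0 cS[of i] lc j by (simp add: insert_commute)
      qed
    qed
    have "distinct c" unfolding c_def using z dist by (auto dest: in_set_takeD)
    moreover have "set c \<subseteq> V"
      unfolding c_def using V edge_vertices[OF e(1)] by (auto dest: in_set_takeD)
    moreover have "length c \<ge> 4" using lc j False by simp
    ultimately obtain a b where ab: "a < length c" "b < length c" "{c ! a, c ! b} \<in> E"
      "b \<noteq> Suc a mod length c" "a \<noteq> Suc b mod length c"
      using chordal cyc unfolding chordal_def by blast
    have zcase: False if "a' = 0" "b' < length c" "{c ! a', c ! b'} \<in> E"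
      "b' \<noteq> Suc a' mod length c" "a' \<noteq> Suc b' mod length c" for a' b'
    proof -
      have "b' \<noteq> 0" using that no_loop(1)[of "c ! 0"] by metis
      then have cb: "c ! b' = xs ! (b' - 1)" using cS that by simp
      have "b' \<noteq> 1" using that lc by auto
      then have "P (b' - 1)" unfolding P_def using that c0 cb lc j \<open>b' \<noteq> 0\<close> by auto
      then have "j \<le> b' - 1" by (rule min)
      then have "b' = Suc j" using that(2) lc j by linarith
      then show False using that lc by simp
    qed
    have pcase: False if "a' < b'" "1 \<le> a'" "b' < length c" "{c ! a', c ! b'} \<in> E"
      "b' \<noteq> Suc a' mod length c" for a' b'
    proof -
      have "{xs ! (a' - 1), xs ! (b' - 1)} \<in> E" using that cS[of a'] cS[of b'] by simp
      then have "b' - 1 = Suc (a' - 1)" using adj[of "a' - 1" "b' - 1"] that lc j by auto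
      then have "b' = Suc a'" using that by linarith
      then show False using that by simp
    qed
    have "a \<noteq> b" using ab no_loop by auto
    have ba: "{c ! b, c ! a} \<in> E" using ab by (simp add: insert_commute)
    consider "a = 0" | "b = 0" | "1 \<le> a" "1 \<le> b" "a < b" | "1 \<le> a" "1 \<le> b" "b < a"
      using \<open>a \<noteq> b\<close> by linarith
    then have False
    proof cases
      case 1 then show ?thesis using zcase[of a b] ab by blast
    next
      case 2 then show ?thesis using zcase[of b a] ab ba by blast
    next
      case 3 then show ?thesis using pcase[of a b] ab by blast
    next
      case 4 then show ?thesis using pcase[of b a] ab ba by blast
    qed
    then show ?thesis ..
  qed
qed

lemma path_through_component:
  assumes D: "D = component A d" and x: "x \<notin> D" "{x, a} \<in> E" "a \<in> D"
    and y: "{y, b} \<in> E" "b \<in> D" "y \<notin> D" "x \<noteq> y"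
  obtains xs where "chordless_path xs" "hd xs = x" "last xs = y" "set xs \<subseteq> insert x (insert y D)"
proof -
  obtain ws where ws: "walk ws" "set ws \<subseteq> D" "hd ws = a" "last ws = b"
    using component_connected[of a A d b] x y D by metis
  then have "walk (x # ws @ [y])"
    using x y by (auto simp: successively_append_iff successively_Cons insert_commute)
  then obtain xs where xs: "chordless_path xs" "hd xs = hd (x # ws @ [y])"
    "last xs = last (x # ws @ [y])" "set xs \<subseteq> set (x # ws @ [y])"
    using walk_to_chordless_path by blast
  show thesis
  proof (rule that[OF xs(1)])
    show "hd xs = x" "last xs = y" using xs(2,3) by simp_all
    show "set xs \<subseteq> insert x (insert y D)" using xs(4) ws(2) by auto
  qed
qed

text \<open>Otherwise a chordless path through \<open>D\<close> would join \<open>x\<close> and \<open>y\<close>, and \<open>s\<close>, being adjacent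
  to both ends, would be adjacent to a vertex of \<open>D\<close>.\<close>

lemma component_attachment_clique:
  assumes D: "D = component A d" and s: "\<And>a. a \<in> D \<Longrightarrow> a \<noteq> s \<and> {s, a} \<notin> E"
    and x: "{s, x} \<in> E" "{x, a} \<in> E" "a \<in> D" and y: "{s, y} \<in> E" "{y, b} \<in> E" "b \<in> D" and "x \<noteq> y"
  shows "{x, y} \<in> E"
proof -
  have "x \<notin> D" "y \<notin> D" using s x y by blast+
  then obtain xs where xs: "chordless_path xs" "hd xs = x" "last xs = y"
    "set xs \<subseteq> insert x (insert y D)"
    using path_through_component[OF D] x y \<open>x \<noteq> y\<close> by metis
  have ne: "xs \<noteq> []" and dist: "distinct xs" using xs(1) by (auto simp: chordless_path_def)
  have hd: "hd xs = xs ! 0" and last: "last xs = xs ! (length xs - 1)"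
    using ne by (auto simp: hd_conv_nth last_conv_nth)
  show ?thesis
  proof (cases "length xs \<ge> 3")
    case True
    have "s \<notin> set xs" using xs(4) s x y edge_vertices(3) by fastforce
    then have "{s, xs ! 1} \<in> E" using neighbour_of_path_ends xs x y True by metis
    moreover have "xs ! i \<noteq> xs ! j" if "i < length xs" "j < length xs" "i \<noteq> j" for i j
      using nth_eq_iff_index_eq[OF dist that(1,2)] that(3) by blast
    from this[of 1 0] this[of 1 "length xs - 1"] True ne
    have "xs ! 1 \<noteq> xs ! 0" "xs ! 1 \<noteq> xs ! (length xs - 1)" by simp_all
    then have "xs ! 1 \<noteq> x" "xs ! 1 \<noteq> y" using hd last xs by auto
    moreover have "xs ! 1 \<in> set xs" using True by (intro nth_mem) auto
    ultimately show ?thesis using xs(4) s by blast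
  next
    case False
    moreover have "length xs \<noteq> 1" using hd last xs \<open>x \<noteq> y\<close> by auto
    ultimately have "length xs = 2" using ne False length_0_conv[of xs] by linarith
    then show ?thesis using xs(1-3) hd last unfolding chordless_path_def by auto
  qed
qed

definition simplicial_in :: "'v set \<Rightarrow> 'v \<Rightarrow> bool" where
  "simplicial_in U v \<longleftrightarrow> v \<in> U \<and>
     (\<forall>x\<in>U. \<forall>y\<in>U. {v, x} \<in> E \<longrightarrow> {v, y} \<in> E \<longrightarrow> x \<noteq> y \<longrightarrow> {x, y} \<in> E)"

text \<open>This is Dirac's theorem. Let \<open>D\<close> be the component of \<open>t\<close> after removal of the closed
  neighbourhood of \<open>s\<close>, and \<open>S\<close> the set of vertices by which it is attached. As \<open>S\<close> is a clique,
  the induction hypothesis for \<open>D \<union> S\<close> yields a simplicial vertex in \<open>D\<close>, and it stays simplicial in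
  \<open>U\<close> because a vertex of \<open>D\<close> has no neighbours outside \<open>D \<union> S\<close>.\<close>

lemma simplicial_far_from:
  assumes "U \<subseteq> V" "s \<in> U" "t \<in> U" "t \<noteq> s" "{s, t} \<notin> E"
  shows "\<exists>v. simplicial_in U v \<and> v \<noteq> s \<and> {s, v} \<notin> E"
  using assms
proof (induction "card U" arbitrary: U s t rule: less_induct)
  case less
  define A where "A = {a\<in>U. a \<noteq> s \<and> {s, a} \<notin> E}"
  define D where "D = component A t"
  define S where "S = {x\<in>U. {s, x} \<in> E \<and> (\<exists>a\<in>D. {x, a} \<in> E)}"
  have tD: "t \<in> D" unfolding D_def by (rule component_self) (use less.prems A_def in auto)
  have DA: "D \<subseteq> A" unfolding D_def by (rule component_subset)
  then have Dfar: "a \<in> D \<Longrightarrow> a \<noteq> s \<and> {s, a} \<notin> E" for a unfolding A_def by auto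
  have Sclique: "{x, y} \<in> E" if "x \<in> S" "y \<in> S" "x \<noteq> y" for x y
    using that component_attachment_clique[OF D_def Dfar] unfolding S_def by blast
  have sub: "D \<union> S \<subseteq> U - {s}"
    using DA no_loop unfolding A_def S_def by auto
  then have smaller: "card (D \<union> S) < card U" 
    using less.prems finite_vertices
    by (metis card_Diff1_less card_mono finite_Diff finite_subset order_le_less_trans)
  have lift: "simplicial_in U v" if v: "v \<in> D" "simplicial_in (D \<union> S) v" for v
  proof -
    have "x \<in> D \<union> S" if "x \<in> U" "{v, x} \<in> E" for x
    proof (cases "{s, x} \<in> E")
      case True
      then show ?thesis using that v unfolding S_def by (auto simp: insert_commute)
    next
      case False
      moreover have "x \<noteq> s" using that Dfar[of v] v by (auto simp: insert_commute)
      ultimately have "x \<in> A" unfolding A_def using that by auto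
      then show ?thesis using component_step[of v A t x] v that unfolding D_def by auto
    qed
    then show ?thesis using v sub unfolding simplicial_in_def by blast
  qed
  have "\<exists>v\<in>D. simplicial_in (D \<union> S) v"
  proof (cases "\<exists>x\<in>S. \<exists>y\<in>D \<union> S. y \<noteq> x \<and> {x, y} \<notin> E")
    case True
    then obtain x y where "x \<in> S" "y \<in> D \<union> S" "y \<noteq> x" "{x, y} \<notin> E" by blast
    with less.hyps[OF smaller, of x y] sub less.prems(1) obtain v where
      v: "simplicial_in (D \<union> S) v" "v \<noteq> x" "{x, v} \<notin> E" by blast
    then have "v \<in> D" using Sclique \<open>x \<in> S\<close> unfolding simplicial_in_def by blast
    then show ?thesis using v by blast
  next
    case False
    show ?thesis
    proof (cases "\<exists>x\<in>D. \<exists>y\<in>D. y \<noteq> x \<and> {x, y} \<notin> E")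
      case True
      then obtain x y where xy: "x \<in> D" "y \<in> D" "y \<noteq> x" "{x, y} \<notin> E" by blast
      with less.hyps[OF smaller, of x y] sub less.prems(1) obtain v where
        v: "simplicial_in (D \<union> S) v" "v \<noteq> x" "{x, v} \<notin> E" by blast
      have "v \<notin> S" using False v xy by (metis UnI1 insert_commute)
      then have "v \<in> D" using v unfolding simplicial_in_def by blast
      then show ?thesis using v by blast
    next
      case 2: False
      have "{x, y} \<in> E" if "x \<in> D \<union> S" "y \<in> D \<union> S" "x \<noteq> y" for x y
        using that False 2 by (metis Un_iff insert_commute)
      then have "simplicial_in (D \<union> S) t" using tD unfolding simplicial_in_def by blast
      then show ?thesis using tD by blast
    qed
  qed
  then show ?case using lift Dfar by blast
qed

lemma exists_simplicial:
  assumes "U \<subseteq> V" "U \<noteq> {}"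
  obtains v where "simplicial_in U v"
proof (cases "\<exists>s\<in>U. \<exists>t\<in>U. t \<noteq> s \<and> {s, t} \<notin> E")
  case True
  then obtain s t where "s \<in> U" "t \<in> U" "t \<noteq> s" "{s, t} \<notin> E" by blast
  then have "\<exists>v. simplicial_in U v \<and> v \<noteq> s \<and> {s, v} \<notin> E"
    by (rule simplicial_far_from[OF assms(1)])
  then show ?thesis using that by (elim exE conjE)
next
  case False
  obtain v where v: "v \<in> U" using assms(2) by blast
  have "{x, y} \<in> E" if "x \<in> U" "y \<in> U" "x \<noteq> y" for x y using False that by metis
  with v have "simplicial_in U v" unfolding simplicial_in_def by simp
  then show ?thesis by (rule that)
qed

text \<open>A vertex \<open>y\<close> of \<open>D\<close> with as many neighbours in \<open>K\<close> as possible has this property: if \<open>k\<close> is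
  adjacent to \<open>D\<close> but not to \<open>y\<close>, the first vertex of \<open>D\<close> on a chordless path from \<open>k\<close> to \<open>y\<close> is
  adjacent to \<open>k\<close> and to all neighbours of \<open>y\<close> in \<open>K\<close>.\<close>

lemma component_dominating_vertex:
  assumes K: "clique V E K" and D: "D = component (V - K) d" and "d \<in> V - K"
  obtains y where "y \<in> D" "\<And>k a. k \<in> K \<Longrightarrow> a \<in> D \<Longrightarrow> {k, a} \<in> E \<Longrightarrow> {k, y} \<in> E"
proof -
  define N where "N y = {k\<in>K. {k, y} \<in> E}" for y
  have finK: "finite K" using K finite_vertices by (auto simp: clique_def intro: finite_subset)
  have DK: "D \<subseteq> V - K" unfolding D by (rule component_subset)
  have "finite D" using DK finite_vertices by (meson finite_Diff finite_subset)
  moreover have "d \<in> D" unfolding D by (rule component_self) fact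
  ultimately have "finite ((\<lambda>z. card (N z)) ` D)" "(\<lambda>z. card (N z)) ` D \<noteq> {}" by auto
  from Max_in[OF this] Max_ge[OF this(1)]
  obtain y where y: "y \<in> D" "\<And>z. z \<in> D \<Longrightarrow> card (N z) \<le> card (N y)" by fastforce
  have "{k, y} \<in> E" if k: "k \<in> K" "a \<in> D" "{k, a} \<in> E" for k a
  proof (rule ccontr)
    assume nky: "{k, y} \<notin> E"
    have "k \<notin> D" using DK k by blast
    obtain ws where ws: "walk ws" "set ws \<subseteq> D" "hd ws = a" "last ws = y"
      using component_connected[of a "V - K" d y] k y D by metis
    then have "walk (k # ws)" using k by (auto simp: successively_Cons)
    from walk_to_chordless_path[OF this] obtain xs where "chordless_path xs"
      "hd xs = hd (k # ws)" "last xs = last (k # ws)" "set xs \<subseteq> set (k # ws)" by blast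
    then have xs: "chordless_path xs" "hd xs = k" "last xs = y" "set xs \<subseteq> insert k D"
      using ws by auto
    have ne: "xs \<noteq> []" and dist: "distinct xs" using xs(1) by (auto simp: chordless_path_def)
    have hd: "hd xs = xs ! 0" and last: "last xs = xs ! (length xs - 1)"
      using ne by (auto simp: hd_conv_nth last_conv_nth)
    have ky: "k \<noteq> y" using \<open>k \<notin> D\<close> y by blast
    have "length xs \<noteq> 1" using hd last xs ky by auto
    moreover have "length xs \<noteq> 2"
      using nky hd last xs unfolding chordless_path_def by auto
    ultimately have len: "length xs \<ge> 3" using ne length_0_conv[of xs] by linarith
    let ?p = "xs ! 1"
    have p: "?p \<in> D"
    proof -
      have "?p \<in> set xs" using len by (intro nth_mem) auto
      moreover have "1 < length xs" "0 < length xs" using len by linarith+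
      then have "?p \<noteq> k" using hd xs(2) nth_eq_iff_index_eq[OF dist, of 1 0] by simp
      ultimately show ?thesis using xs(4) by blast
    qed
    have kp: "{k, ?p} \<in> E" using xs(1) hd xs(2) len unfolding chordless_path_def by auto
    have "insert k (N y) \<subseteq> N ?p"
    proof -
      have "{k', ?p} \<in> E" if "k' \<in> N y" for k'
      proof -
        have k': "k' \<in> K" "{k', y} \<in> E" "k' \<noteq> k" using that nky unfolding N_def by auto
        then have "{k', k} \<in> E" using K k unfolding clique_def by blast
        moreover have "k' \<notin> set xs" using k' xs(4) DK by blast
        ultimately show ?thesis using neighbour_of_path_ends[OF xs(1) len] xs k' by metis
      qed
      then show ?thesis using kp k unfolding N_def by auto
    qed
    moreover have "k \<notin> N y" "finite (N z)" for z using nky finK unfolding N_def by auto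
    ultimately have "card (N y) < card (N ?p)"
      by (metis card_insert_disjoint card_mono less_eq_Suc_le)
    then show False using y(2)[OF p] by simp
  qed
  then show thesis using y(1) that by blast
qed

text \<open>One vertex from each component of the complement of the clique suffices: by the previous
  lemma it can be chosen adjacent to all vertices of the clique that see the component.\<close>

lemma stable_dominating_clique:
  assumes K: "clique V E K" and out: "\<And>k. k \<in> K \<Longrightarrow> \<exists>a. {k, a} \<in> E \<and> a \<notin> K"
  obtains A where "stable_set V E A" "A \<inter> K = {}" "\<And>k. k \<in> K \<Longrightarrow> \<exists>a\<in>A. {k, a} \<in> E"
proof -
  let ?comp = "component (V - K)"
  define good where "good D y \<longleftrightarrow> y \<in> D \<and> (\<forall>k a. k \<in> K \<longrightarrow> a \<in> D \<longrightarrow> {k, a} \<in> E \<longrightarrow> {k, y} \<in> E)" for D y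
  define f where "f D = (SOME y. good D y)" for D
  have f: "good (?comp d) (f (?comp d))" if "d \<in> V - K" for d
    unfolding f_def by (rule someI_ex)
      (use component_dominating_vertex[OF K refl that] in \<open>unfold good_def, metis\<close>)
  define A where "A = (\<lambda>d. f (?comp d)) ` (V - K)"
  have fin: "f (?comp d) \<in> ?comp d" if "d \<in> V - K" for d
    using f[OF that] unfolding good_def by blast
  have AV: "A \<subseteq> V - K" unfolding A_def using fin component_subset by blast
  have "{x, y} \<notin> E" if xy: "x \<in> A" "y \<in> A" for x y
  proof
    assume e: "{x, y} \<in> E"
    obtain d d' where d: "d \<in> V - K" "x = f (?comp d)" "d' \<in> V - K" "y = f (?comp d')"
      using xy unfolding A_def by blast
    have "y \<in> ?comp d" using component_step[OF fin[OF d(1)]] e d(2) xy AV by blast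
    moreover have "y \<in> ?comp d'" using fin d by blast
    ultimately have "?comp d = ?comp d'" using component_eq by metis
    then show False using d e no_loop by auto
  qed
  then have "stable_set V E A" unfolding stable_set_def using AV by blast
  moreover have "\<exists>a\<in>A. {k, a} \<in> E" if k: "k \<in> K" for k
  proof -
    obtain a where a: "{k, a} \<in> E" "a \<notin> K" using out[OF k] by blast
    then have "a \<in> V - K" using edge_vertices by blast
    with f[OF this] component_self[OF this] a k show ?thesis unfolding good_def A_def by blast
  qed
  ultimately show thesis using that AV by blast
qed

end

definition simplex :: "'v set \<Rightarrow> 'v set set \<Rightarrow> 'v set \<Rightarrow> bool" where
  "simplex V E C \<longleftrightarrow> maximal_clique V E C \<and> (\<exists>v\<in>C. free_vertex V E v)"

context finite_simple_graph
begin

text \<open>A vertex \<open>v\<close> of two simplices could be exchanged, in a maximal stable set, for one free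
  vertex of each of them.\<close>

lemma simplices_disjoint:
  assumes wc: "\<And>T Y. maximal_stable V E T \<Longrightarrow> maximal_stable V E Y \<Longrightarrow> card T = card Y"
    and C: "simplex V E C" and D: "simplex V E D" and v: "v \<in> C" "v \<in> D"
  shows "C = D"
proof (rule ccontr)
  assume "C \<noteq> D"
  obtain c d where c: "c \<in> C" "free_vertex V E c" and d: "d \<in> D" "free_vertex V E d"
    using C D unfolding simplex_def by blast
  have mc: "maximal_clique V E C" "maximal_clique V E D" using C D unfolding simplex_def by auto
  have cD: "c \<notin> D" and dC: "d \<notin> C"
    using c d mc \<open>C \<noteq> D\<close> unfolding free_vertex_def by blast+
  have Nc: "u \<in> C" if "{c, u} \<in> E" for u using free_vertex_neighbour[OF c(2) mc(1) c(1) that] .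
  have Nd: "u \<in> D" if "{d, u} \<in> E" for u using free_vertex_neighbour[OF d(2) mc(2) d(1) that] .
  have V: "v \<in> V" "c \<in> V" "d \<in> V" using mc v c d unfolding maximal_clique_def clique_def by auto
  have "stable_set V E {v}" using V no_loop by (auto simp: stable_set_def)
  then obtain T where T: "maximal_stable V E T" "{v} \<subseteq> T" by (rule stable_set_extends)
  then have Xi: "stable_set V E T" by (simp add: maximal_stable_def)
  have "T \<inter> B = {v}" if "clique V E B" "v \<in> B" for B
    using that T(2) Xi unfolding clique_def stable_set_def by blast
  then have XC: "T \<inter> C = {v}" "T \<inter> D = {v}"
    using mc v by (simp_all add: maximal_clique_def)
  have cdX: "c \<notin> T" "d \<notin> T" "c \<noteq> d" using XC c d v cD dC by auto
  let ?Y = "insert c (insert d (T - {v}))"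
  have "stable_set V E ?Y"
    unfolding stable_set_def
  proof (intro conjI ballI)
    show "?Y \<subseteq> V" using V Xi by (auto simp: stable_set_def)
    have c1: "{c, x} \<notin> E" if "x \<in> insert d (T - {v})" for x using Nc[of x] that dC XC by blast
    have d1: "{d, x} \<notin> E" if "x \<in> insert c (T - {v})" for x using Nd[of x] that cD XC by blast
    have T1: "{x, y} \<notin> E" if "x \<in> T" "y \<in> T" for x y using that Xi by (simp add: stable_set_def)
    fix x y assume "x \<in> ?Y" "y \<in> ?Y"
    then show "{x, y} \<notin> E"
      using c1[of y] c1[of x] d1[of y] d1[of x] T1[of x y] no_loop by (auto simp: insert_commute)
  qed
  then obtain Z where Z: "maximal_stable V E Z" "?Y \<subseteq> Z" by (rule stable_set_extends)
  have fin: "finite T" "finite Z"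
    using Xi Z finite_vertices unfolding maximal_stable_def stable_set_def
    by (auto intro: finite_subset)
  have "v \<in> T" using T(2) by simp
  then have "card T = Suc (card (T - {v}))" using fin by (metis card_Suc_Diff1)
  then have "card ?Y = Suc (card T)" using fin cdX by simp
  moreover have "card ?Y \<le> card Z" using Z fin by (intro card_mono)
  ultimately show False using wc[OF T(1) Z(1)] by simp
qed

end

context chordal_graph
begin

text \<open>Assume that some vertices lie in no simplex. A vertex that is simplicial among them lies in a
  maximal clique \<open>K\<close> without free vertices; extend a stable set that dominates \<open>K\<close> from
  outside to a maximal one, \<open>B\<close>. As \<open>B\<close> has at most one vertex in each simplex, replacing its part
  in the simplices by free vertices loses nothing, and now the simplicial vertex can be added.\<close>

lemma simplices_cover:
  assumes wc: "\<And>T Y. maximal_stable V E T \<Longrightarrow> maximal_stable V E Y \<Longrightarrow> card T = card Y"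
    and v: "v \<in> V"
  shows "\<exists>C. simplex V E C \<and> v \<in> C"
proof (rule ccontr)
  assume no: "\<nexists>C. simplex V E C \<and> v \<in> C"
  let ?S = "{C. simplex V E C}"
  define Z where "Z = V - \<Union>?S"
  have "v \<in> Z" unfolding Z_def using v no by blast
  then obtain z where z: "simplicial_in Z z" using exists_simplicial[of Z] unfolding Z_def by blast
  define N where "N = insert z {x\<in>Z. {z, x} \<in> E}"
  have "clique V E N"
    using z unfolding N_def clique_def simplicial_in_def Z_def by (auto simp: insert_commute)
  then obtain K where K: "maximal_clique V E K" "N \<subseteq> K" by (rule clique_extends)
  have zK: "z \<in> K" using K(2) by (auto simp: N_def)
  have zZ: "z \<in> Z" using z by (simp add: simplicial_in_def)
  have "\<not> simplex V E K" using zK zZ by (auto simp: Z_def)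
  then have nofree: "\<not> free_vertex V E k" if "k \<in> K" for k
    using K(1) that unfolding simplex_def by blast
  have out: "\<exists>a. {k, a} \<in> E \<and> a \<notin> K" if "k \<in> K" for k
    using free_vertexI[OF K(1) that] nofree[OF that] by blast
  have "clique V E K" using K(1) by (simp add: maximal_clique_def)
  from stable_dominating_clique[OF this out] obtain A where
    A: "stable_set V E A" "A \<inter> K = {}" "\<And>k. k \<in> K \<Longrightarrow> \<exists>a\<in>A. {k, a} \<in> E" by blast
  obtain B where B: "maximal_stable V E B" "A \<subseteq> B" using stable_set_extends[OF A(1)] .
  have Bi: "stable_set V E B" using B(1) by (simp add: maximal_stable_def)
  have BK: "B \<inter> K = {}"
  proof (rule equals0I)
    fix k assume "k \<in> B \<inter> K"
    then obtain a where "a \<in> B" "{k, a} \<in> E" "k \<in> B" using A(3) B(2) by blast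
    then show False using Bi unfolding stable_set_def by blast
  qed
  have finB: "finite B" using Bi finite_vertices unfolding stable_set_def by (metis finite_subset)
  have "?S \<subseteq> Pow V" by (auto simp: simplex_def maximal_clique_def clique_def)
  then have finS: "finite ?S" using finite_vertices by (simp add: finite_subset)
  define w where "w C = (SOME w. w \<in> C \<and> free_vertex V E w)" for C
  have w: "w C \<in> C \<and> free_vertex V E (w C)" if "simplex V E C" for C
    unfolding w_def using someI_ex[of "\<lambda>w. w \<in> C \<and> free_vertex V E w"] that
    unfolding simplex_def by blast
  have Nw: "u \<in> C" if "simplex V E C" "{w C, u} \<in> E" for C u
  proof -
    have "free_vertex V E (w C)" "maximal_clique V E C" "w C \<in> C"
      using w[OF that(1)] that(1) by (auto simp: simplex_def)
    then show ?thesis using free_vertex_neighbour that(2) by blast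
  qed
  have SV: "C \<subseteq> V" if "simplex V E C" for C
    using that by (simp add: simplex_def maximal_clique_def clique_def)
  have inj: "inj_on w ?S"
  proof (rule inj_onI)
    fix C D assume CD: "C \<in> ?S" "D \<in> ?S" "w C = w D"
    then have "w C \<in> C" "w C \<in> D" using w[of C] w[of D] by simp_all
    then show "C = D" using simplices_disjoint[OF wc, of C D] CD(1,2) by blast
  qed
  have "card (B - Z) \<le> card ?S"
  proof -
    have "\<forall>b\<in>B - Z. \<exists>C. simplex V E C \<and> b \<in> C"
      using Bi unfolding Z_def stable_set_def by blast
    then obtain g where g: "\<And>b. b \<in> B - Z \<Longrightarrow> simplex V E (g b) \<and> b \<in> g b" by metis
    have "inj_on g (B - Z)"
    proof (rule inj_onI)
      fix x y assume xy: "x \<in> B - Z" "y \<in> B - Z" "g x = g y"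
      then have "x \<in> g x" "y \<in> g x" "clique V E (g x)"
        using g[OF xy(1)] g[OF xy(2)] by (simp_all add: simplex_def maximal_clique_def)
      moreover have "{x, y} \<notin> E" using xy Bi unfolding stable_set_def by blast
      ultimately show "x = y" unfolding clique_def by blast
    qed
    moreover have "g ` (B - Z) \<subseteq> ?S" using g by blast
    ultimately show ?thesis using finS by (rule card_inj_on_le)
  qed
  moreover have "stable_set V E (insert z (B \<inter> Z) \<union> w ` ?S)"
  proof -
    have zB: "{z, b} \<notin> E" if "b \<in> B \<inter> Z" for b
      using that BK K(2) unfolding N_def by blast
    have wZ: "{w C, x} \<notin> E" if "simplex V E C" "x \<in> Z" for C x
    proof
      assume "{w C, x} \<in> E"
      then have "x \<in> C" using Nw that(1) by simp
      then show False using that unfolding Z_def by blast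
    qed
    have ww: "{w C, w D} \<notin> E" if "simplex V E C" "simplex V E D" for C D
    proof
      assume e: "{w C, w D} \<in> E"
      then have "w D \<in> C" using Nw that by blast
      then have "C = D" using simplices_disjoint[OF wc that, of "w D"] w[OF that(2)] by simp
      then show False using e no_loop by simp
    qed
    show ?thesis unfolding stable_set_def
    proof (intro conjI ballI)
      have "w C \<in> V" if "simplex V E C" for C using w[OF that] SV[OF that] by blast
      then have "z \<in> V" "w ` ?S \<subseteq> V" using zZ unfolding Z_def by auto
      then show "insert z (B \<inter> Z) \<union> w ` ?S \<subseteq> V" unfolding Z_def by blast
      fix x y assume "x \<in> insert z (B \<inter> Z) \<union> w ` ?S" "y \<in> insert z (B \<inter> Z) \<union> w ` ?S"
      then consider "x = z" "y = z" | "x = z" "y \<in> B \<inter> Z" | "y = z" "x \<in> B \<inter> Z"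
        | "x \<in> B" "y \<in> B" | C where "simplex V E C" "x = w C" "y \<in> Z"
        | C where "simplex V E C" "y = w C" "x \<in> Z"
        | C D where "simplex V E C" "simplex V E D" "x = w C" "y = w D"
        using zZ by blast
      then show "{x, y} \<notin> E"
      proof cases
        case 1 then show ?thesis using no_loop by simp
      next
        case 2 then show ?thesis using zB by simp
      next
        case 3 then show ?thesis using zB by (simp add: insert_commute)
      next
        case 4 then show ?thesis using Bi by (simp add: stable_set_def)
      next
        case 5 then show ?thesis using wZ by simp
      next
        case 6 then show ?thesis using wZ by (simp add: insert_commute)
      next
        case 7 then show ?thesis using ww by simp
      qed
    qed
  qed
  then obtain Y where Y: "maximal_stable V E Y" "insert z (B \<inter> Z) \<union> w ` ?S \<subseteq> Y"
    by (rule stable_set_extends)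
  have finY: "finite Y" using Y(1) finite_vertices
    by (auto simp: maximal_stable_def stable_set_def intro: finite_subset)
  have "card (insert z (B \<inter> Z) \<union> w ` ?S) = Suc (card (B \<inter> Z)) + card ?S"
  proof -
    have "w C \<notin> Z" if "simplex V E C" for C using w[OF that] that unfolding Z_def by blast
    then have "insert z (B \<inter> Z) \<inter> w ` ?S = {}" using zZ by blast
    moreover have "z \<notin> B" using BK zK by blast
    ultimately show ?thesis using finB finS inj by (simp add: card_Un_disjoint card_image)
  qed
  moreover have "card (insert z (B \<inter> Z) \<union> w ` ?S) \<le> card Y" using Y finY by (intro card_mono)
  moreover have "card B = card (B \<inter> Z) + card (B - Z)"
    using finB by (metis Int_Diff_Un Int_Diff_disjoint card_Un_disjoint finite_Diff finite_Int)
  ultimately show False using wc[OF B(1) Y(1)] by linarith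
qed

end


section \<open>Regular sequences are quasi-regular\<close>

text \<open>The polynomials in a given set of variables form a subring, not a type. Ideals and regular
  sequences are therefore considered inside a subring \<open>S\<close>, and instead of a quotient ring an ideal
  \<open>K\<close> of \<open>S\<close> is carried along.\<close>

locale subring_set =
  fixes S :: "'a::comm_ring_1 set"
  assumes S_zero: "0 \<in> S" and S_one: "1 \<in> S"
    and S_diff: "x \<in> S \<Longrightarrow> y \<in> S \<Longrightarrow> x - y \<in> S"
    and S_mult: "x \<in> S \<Longrightarrow> y \<in> S \<Longrightarrow> x * y \<in> S"
begin

lemma S_uminus: "x \<in> S \<Longrightarrow> - x \<in> S"
  using S_diff[OF S_zero] by simp

lemma S_add: "x \<in> S \<Longrightarrow> y \<in> S \<Longrightarrow> x + y \<in> S"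
  using S_diff[of x "- y"] S_uminus by simp

lemma S_sum: "(\<And>i. i \<in> A \<Longrightarrow> f i \<in> S) \<Longrightarrow> sum f A \<in> S"
  by (induction A rule: infinite_finite_induct) (auto intro: S_add S_zero)

lemma S_prod: "(\<And>i. i \<in> A \<Longrightarrow> f i \<in> S) \<Longrightarrow> prod f A \<in> S"
  by (induction A rule: infinite_finite_induct) (auto intro: S_mult S_one)

lemma S_power: "x \<in> S \<Longrightarrow> x ^ n \<in> S"
  by (induction n) (auto intro: S_mult S_one)

definition ideal_in :: "'a set \<Rightarrow> bool" where
  "ideal_in K \<longleftrightarrow> K \<subseteq> S \<and> 0 \<in> K \<and> (\<forall>x\<in>K. \<forall>y\<in>K. x + y \<in> K) \<and> (\<forall>s\<in>S. \<forall>x\<in>K. s * x \<in> K)"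

lemma ideal_inD:
  assumes "ideal_in K"
  shows "K \<subseteq> S" "0 \<in> K" "x \<in> K \<Longrightarrow> y \<in> K \<Longrightarrow> x + y \<in> K" "s \<in> S \<Longrightarrow> x \<in> K \<Longrightarrow> s * x \<in> K"
    "x \<in> K \<Longrightarrow> - x \<in> K" "x \<in> K \<Longrightarrow> y \<in> K \<Longrightarrow> x - y \<in> K"
proof -
  show *: "K \<subseteq> S" "0 \<in> K" "x \<in> K \<Longrightarrow> y \<in> K \<Longrightarrow> x + y \<in> K" "s \<in> S \<Longrightarrow> x \<in> K \<Longrightarrow> s * x \<in> K" for x y s
    using assms unfolding ideal_in_def by blast+
  show **: "x \<in> K \<Longrightarrow> - x \<in> K" for x using *(4)[of "- 1" x] S_uminus[OF S_one] by simp
  show "x \<in> K \<Longrightarrow> y \<in> K \<Longrightarrow> x - y \<in> K" using *(3)[of x "- y"] **[of y] by simp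
qed

lemma ideal_in_S: "ideal_in S"
  unfolding ideal_in_def using S_zero S_add S_mult by auto

lemma ideal_in_sum: "ideal_in K \<Longrightarrow> (\<And>i. i \<in> A \<Longrightarrow> f i \<in> K) \<Longrightarrow> sum f A \<in> K"
  by (induction A rule: infinite_finite_induct) (auto intro: ideal_inD)

definition generated :: "'a set \<Rightarrow> (nat \<Rightarrow> 'a) \<Rightarrow> nat \<Rightarrow> 'a set" where
  "generated K f r = {k + (\<Sum>i<r. s i * f i) | k s. k \<in> K \<and> (\<forall>i. s i \<in> S)}"

definition regular_mod :: "'a set \<Rightarrow> (nat \<Rightarrow> 'a) \<Rightarrow> nat \<Rightarrow> bool" where
  "regular_mod K f r \<longleftrightarrow>
     (\<forall>i<r. \<forall>x\<in>S. f i * x \<in> generated K f i \<longrightarrow> x \<in> generated K f i)"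

end

definition exponents :: "nat \<Rightarrow> nat \<Rightarrow> (nat \<Rightarrow> nat) set" where
  "exponents r n = {a. (\<forall>i\<ge>r. a i = 0) \<and> (\<Sum>i<r. a i) = n}"

definition mono_eval :: "nat \<Rightarrow> (nat \<Rightarrow> 'a::comm_ring_1) \<Rightarrow> (nat \<Rightarrow> nat) \<Rightarrow> 'a" where
  "mono_eval r f a = (\<Prod>i<r. f i ^ a i)"

definition form :: "nat \<Rightarrow> (nat \<Rightarrow> 'a::comm_ring_1) \<Rightarrow> nat \<Rightarrow> ((nat \<Rightarrow> nat) \<Rightarrow> 'a) \<Rightarrow> 'a" where
  "form r f n c = (\<Sum>a\<in>exponents r n. c a * mono_eval r f a)"

lemma exponents_le: "a \<in> exponents r n \<Longrightarrow> a i \<le> n"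
  unfolding exponents_def
  by (cases "i < r") (auto intro: member_le_sum)

lemma finite_exponents: "finite (exponents r n)"
proof (rule finite_subset)
  show "exponents r n \<subseteq> {a. \<forall>i. (i \<in> {..<r} \<longrightarrow> a i \<in> {..n}) \<and> (i \<notin> {..<r} \<longrightarrow> a i = 0)}"
    using exponents_le by (auto simp: exponents_def)
  show "finite {a. \<forall>i. (i \<in> {..<r} \<longrightarrow> a i \<in> {..n}) \<and> (i \<notin> {..<r} \<longrightarrow> a i = (0::nat))}"
    by (rule finite_set_of_finite_funs) auto
qed

lemma exponents_0: "exponents r 0 = {\<lambda>_. 0}"
  unfolding exponents_def fun_eq_iff by (auto simp: fun_eq_iff) (metis lessThan_iff not_le)

lemma form_0: "form r f 0 c = c (\<lambda>_. 0)"
  unfolding form_def exponents_0 mono_eval_def by simp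

abbreviation bump :: "nat \<Rightarrow> (nat \<Rightarrow> nat) \<Rightarrow> (nat \<Rightarrow> nat)" where
  "bump i a \<equiv> a(i := Suc (a i))"

lemma sum_bump: "i < r \<Longrightarrow> (\<Sum>j<r. bump i a j) = Suc (\<Sum>j<r. a j)"
proof -
  assume "i < r"
  then have "(\<Sum>j<r. bump i a j) = (\<Sum>j<r. a j + of_bool (j = i))"
    by (intro sum.cong) auto
  then show ?thesis using \<open>i < r\<close> by (simp add: sum.distrib)
qed

lemma bump_exponents: "i < r \<Longrightarrow> a \<in> exponents r n \<Longrightarrow> bump i a \<in> exponents r (Suc n)"
  unfolding exponents_def using sum_bump[of i r a] by auto

lemma mono_eval_bump: "i < r \<Longrightarrow> mono_eval r f (bump i a) = f i * mono_eval r f a"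
proof -
  assume "i < r"
  then have "(\<Prod>j<r. f j ^ bump i a j) = (\<Prod>j<r. f j ^ a j * (if j = i then f i else 1))"
    by (intro prod.cong) auto
  then show ?thesis using \<open>i < r\<close> unfolding mono_eval_def by (simp add: prod.distrib mult.commute)
qed

lemma exponents_Suc_bump:
  assumes "b \<in> exponents r (Suc n)"
  obtains i a where "i < r" "a \<in> exponents r n" "b = bump i a"
proof -
  have "(\<Sum>i<r. b i) \<noteq> 0" using assms by (simp add: exponents_def)
  then obtain i where i: "i < r" "b i \<noteq> 0" by (auto elim: sum.not_neutral_contains_not_neutral)
  let ?a = "b(i := b i - 1)"
  have b: "b = bump i ?a" using i by auto
  moreover have "?a \<in> exponents r n"
    using assms i sum_bump[OF i(1), of ?a] b unfolding exponents_def by auto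
  ultimately show thesis using that i by blast
qed

lemma exponents_Suc_Suc:
  "exponents (Suc r) (Suc n) = exponents r (Suc n) \<union> bump r ` exponents (Suc r) n"
  "exponents r (Suc n) \<inter> bump r ` exponents (Suc r) n = {}"
proof -
  show "exponents r (Suc n) \<inter> bump r ` exponents (Suc r) n = {}"
    by (auto simp: exponents_def)
  show "exponents (Suc r) (Suc n) = exponents r (Suc n) \<union> bump r ` exponents (Suc r) n" (is "?L = ?R")
  proof
    show "?R \<subseteq> ?L" using bump_exponents[of r "Suc r"] by (auto simp: exponents_def)
    show "?L \<subseteq> ?R"
    proof
      fix b assume b: "b \<in> ?L"
      show "b \<in> ?R"
      proof (cases "b r = 0")
        case True
        have "b i = 0" if "r \<le> i" for i
          using True b that by (cases "i = r") (auto simp: exponents_def)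
        then show ?thesis using b True by (auto simp: exponents_def)
      next
        case False
        let ?a = "b(r := b r - 1)"
        have "b = bump r ?a" using False by auto
        moreover have "?a \<in> exponents (Suc r) n" using b False by (auto simp: exponents_def)
        ultimately show ?thesis by blast
      qed
    qed
  qed
qed

lemma mono_eval_Suc: "a \<in> exponents r n \<Longrightarrow> mono_eval (Suc r) f a = mono_eval r f a"
  by (simp add: mono_eval_def exponents_def)

lemma form_Suc_Suc:
  "form (Suc r) f (Suc n) c = form r f (Suc n) c + f r * form (Suc r) f n (\<lambda>a. c (bump r a))"
proof -
  have inj: "inj_on (bump r) A" for A
    by (rule inj_onI) (metis fun_upd_same fun_upd_triv fun_upd_upd nat.inject)
  have "form (Suc r) f (Suc n) c = (\<Sum>a\<in>exponents r (Suc n). c a * mono_eval (Suc r) f a) +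
      (\<Sum>a\<in>bump r ` exponents (Suc r) n. c a * mono_eval (Suc r) f a)"
    unfolding form_def exponents_Suc_Suc(1)
    by (rule sum.union_disjoint) (use finite_exponents exponents_Suc_Suc(2) in auto)
  also have "(\<Sum>a\<in>exponents r (Suc n). c a * mono_eval (Suc r) f a) = form r f (Suc n) c"
    unfolding form_def by (intro sum.cong) (auto simp: mono_eval_Suc)
  also have "(\<Sum>a\<in>bump r ` exponents (Suc r) n. c a * mono_eval (Suc r) f a) =
      (\<Sum>a\<in>exponents (Suc r) n. c (bump r a) * mono_eval (Suc r) f (bump r a))"
    by (subst sum.reindex[OF inj]) simp
  also have "\<dots> = f r * form (Suc r) f n (\<lambda>a. c (bump r a))"
    unfolding form_def sum_distrib_left
  proof (rule sum.cong)
    fix a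
    have "mono_eval (Suc r) f (bump r a) = f r * mono_eval (Suc r) f a" by (rule mono_eval_bump) simp
    then show "c (bump r a) * mono_eval (Suc r) f (bump r a) = f r * (c (bump r a) * mono_eval (Suc r) f a)"
      by (simp add: mult_ac)
  qed simp
  finally show ?thesis .
qed

lemma form_add: "form r f n (\<lambda>a. c a + d a) = form r f n c + form r f n d"
  by (simp add: form_def sum.distrib algebra_simps)

lemma form_diff: "form r f n (\<lambda>a. c a - d a) = form r f n c - form r f n d"
  by (simp add: form_def sum_subtractf algebra_simps)

lemma form_mult: "form r f n (\<lambda>a. s * c a) = s * form r f n c"
  by (simp add: form_def sum_distrib_left algebra_simps)

lemma form_single:
  assumes "b \<in> exponents r n"
  shows "form r f n (\<lambda>a. if a = b then c else 0) = c * mono_eval r f b"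
proof -
  have "form r f n (\<lambda>a. if a = b then c else 0) =
      (\<Sum>a\<in>exponents r n. if a = b then c * mono_eval r f b else 0)"
    unfolding form_def by (intro sum.cong) auto
  then show ?thesis using assms finite_exponents by simp
qed

lemma form_extend:
  "form r f n c = form (Suc r) f n (\<lambda>a. if a \<in> exponents r n then c a else 0)"
proof -
  have "exponents r n \<subseteq> exponents (Suc r) n" by (auto simp: exponents_def)
  then have "form (Suc r) f n (\<lambda>a. if a \<in> exponents r n then c a else 0) =
      (\<Sum>a\<in>exponents r n. (if a \<in> exponents r n then c a else 0) * mono_eval (Suc r) f a)"
    unfolding form_def by (intro sum.mono_neutral_right finite_exponents) auto
  also have "\<dots> = form r f n c"
    unfolding form_def by (intro sum.cong) (auto simp: mono_eval_Suc)
  finally show ?thesis by simp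
qed

lemma mono_eval_add: "mono_eval r f (\<lambda>i. a i + b i) = mono_eval r f a * mono_eval r f b"
  by (simp add: mono_eval_def power_add prod.distrib)

context subring_set
begin

lemma generated_ideal:
  assumes K: "ideal_in K" and f: "\<forall>i. f i \<in> S"
  shows "ideal_in (generated K f r)"
  unfolding ideal_in_def
proof (intro conjI ballI)
  show "generated K f r \<subseteq> S"
    using ideal_inD[OF K] f by (auto simp: generated_def intro!: S_add S_sum S_mult)
  show "0 \<in> generated K f r"
    unfolding generated_def using ideal_inD[OF K] S_zero
    by (intro CollectI exI[of _ 0] exI[of _ "\<lambda>_. 0"]) auto
next
  fix x y assume "x \<in> generated K f r" "y \<in> generated K f r"
  then obtain k s k' s' where "x = k + (\<Sum>i<r. s i * f i)" "y = k' + (\<Sum>i<r. s' i * f i)"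
    "k \<in> K" "k' \<in> K" "\<forall>i. s i \<in> S" "\<forall>i. s' i \<in> S" unfolding generated_def by blast
  then show "x + y \<in> generated K f r"
    unfolding generated_def using ideal_inD[OF K] S_add
    by (intro CollectI exI[of _ "k + k'"] exI[of _ "\<lambda>i. s i + s' i"])
      (auto simp: algebra_simps sum.distrib)
next
  fix t x assume "t \<in> S" "x \<in> generated K f r"
  then obtain k s where "x = k + (\<Sum>i<r. s i * f i)" "k \<in> K" "\<forall>i. s i \<in> S"
    unfolding generated_def by blast
  then show "t * x \<in> generated K f r"
    unfolding generated_def using ideal_inD(4)[OF K] S_mult \<open>t \<in> S\<close>
    by (intro CollectI exI[of _ "t * k"] exI[of _ "\<lambda>i. t * s i"])
      (auto simp: distrib_left mult.assoc sum_distrib_left)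
qed

lemma generated_base: "K \<subseteq> generated K f r"
  unfolding generated_def using S_zero by (auto intro!: exI[of _ "\<lambda>_. 0"])

lemma generated_gen:
  assumes K: "ideal_in K" and "s \<in> S" "i < r"
  shows "s * f i \<in> generated K f r"
proof -
  have "(\<Sum>j<r. (if j = i then s else 0) * f j) = (\<Sum>j<r. if j = i then s * f i else 0)"
    by (intro sum.cong) auto
  then show ?thesis unfolding generated_def using assms ideal_inD(2)[OF K] S_zero
    by (intro CollectI exI[of _ 0] exI[of _ "\<lambda>j. if j = i then s else 0"]) auto
qed

lemma generated_least:
  assumes "ideal_in L" "K \<subseteq> L" "\<And>i. i < r \<Longrightarrow> f i \<in> L"
  shows "generated K f r \<subseteq> L"
  using assms unfolding generated_def
  by (auto intro!: ideal_inD(3)[OF assms(1)] ideal_in_sum[OF assms(1)] ideal_inD(4)[OF assms(1)])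

lemma generated_Suc:
  "x \<in> generated K f r \<Longrightarrow> s \<in> S \<Longrightarrow> x + s * f r \<in> generated K f (Suc r)"
proof -
  assume x: "x \<in> generated K f r" and s: "s \<in> S"
  then obtain k t where t: "x = k + (\<Sum>i<r. t i * f i)" "k \<in> K" "\<forall>i. t i \<in> S"
    unfolding generated_def by blast
  have "(\<Sum>i<r. (t(r := s)) i * f i) = (\<Sum>i<r. t i * f i)" by (intro sum.cong) auto
  then show ?thesis unfolding generated_def using t s
    by (intro CollectI exI[of _ k] exI[of _ "t(r := s)"]) auto
qed

text \<open>With \<open>C = S\<close> this is the ideal \<open>K + J^n\<close> for \<open>J = (f 0, \<dots>, f (r - 1))\<close>.\<close>

definition forms :: "'a set \<Rightarrow> (nat \<Rightarrow> 'a) \<Rightarrow> nat \<Rightarrow> nat \<Rightarrow> 'a set \<Rightarrow> 'a set" where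
  "forms K f r n C = {k + form r f n c | k c. k \<in> K \<and> (\<forall>a. c a \<in> C)}"

lemma mono_eval_S: "\<forall>i. f i \<in> S \<Longrightarrow> mono_eval r f a \<in> S"
  unfolding mono_eval_def by (intro S_prod S_power) simp

lemma form_S: "\<forall>i. f i \<in> S \<Longrightarrow> (\<And>a. c a \<in> S) \<Longrightarrow> form r f n c \<in> S"
  unfolding form_def by (intro S_sum S_mult mono_eval_S) auto

lemma forms_ideal:
  assumes K: "ideal_in K" and C: "ideal_in C" and f: "\<forall>i. f i \<in> S"
  shows "ideal_in (forms K f r n C)"
  unfolding ideal_in_def
proof (intro conjI ballI)
  show "forms K f r n C \<subseteq> S"
  proof
    fix x assume "x \<in> forms K f r n C"
    then obtain k c where "x = k + form r f n c" "k \<in> K" "\<forall>a. c a \<in> C" unfolding forms_def by blast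
    moreover from this have "\<And>a. c a \<in> S" using ideal_inD(1)[OF C] by blast
    ultimately show "x \<in> S" using form_S[OF f] ideal_inD(1)[OF K] by (auto intro!: S_add)
  qed
  show "0 \<in> forms K f r n C"
    unfolding forms_def form_def using ideal_inD(2)[OF K] ideal_inD(2)[OF C]
    by (intro CollectI exI[of _ 0] exI[of _ "\<lambda>_. 0"]) auto
next
  fix x y assume "x \<in> forms K f r n C" "y \<in> forms K f r n C"
  then obtain k c l d where "x = k + form r f n c" "y = l + form r f n d"
    "k \<in> K" "l \<in> K" "\<forall>a. c a \<in> C" "\<forall>a. d a \<in> C" unfolding forms_def by blast
  then show "x + y \<in> forms K f r n C"
    unfolding forms_def using ideal_inD(3)[OF K] ideal_inD(3)[OF C]
    by (intro CollectI exI[of _ "k + l"] exI[of _ "\<lambda>a. c a + d a"]) (auto simp: form_add)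
next
  fix t x assume "t \<in> S" "x \<in> forms K f r n C"
  then obtain k c where "x = k + form r f n c" "k \<in> K" "\<forall>a. c a \<in> C" unfolding forms_def by blast
  then show "t * x \<in> forms K f r n C"
    unfolding forms_def using ideal_inD(4)[OF K] ideal_inD(4)[OF C] \<open>t \<in> S\<close>
    by (intro CollectI exI[of _ "t * k"] exI[of _ "\<lambda>a. t * c a"]) (auto simp: form_mult distrib_left)
qed

lemma forms_base:
  assumes "ideal_in C"
  shows "K \<subseteq> forms K f r n C"
  unfolding forms_def form_def using ideal_inD(2)[OF assms] by (auto intro!: exI[of _ "\<lambda>_. 0"])

lemma forms_single:
  assumes "ideal_in K" "ideal_in C" "c \<in> C" "b \<in> exponents r n"
  shows "c * mono_eval r f b \<in> forms K f r n C"
  unfolding forms_def using form_single[OF assms(4), of f c] assms ideal_inD(2)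
  by (intro CollectI exI[of _ 0] exI[of _ "\<lambda>a. if a = b then c else 0"]) auto

lemma forms_least:
  assumes L: "ideal_in L" and "K \<subseteq> L"
    and "\<And>c b. c \<in> C \<Longrightarrow> b \<in> exponents r n \<Longrightarrow> c * mono_eval r f b \<in> L"
  shows "forms K f r n C \<subseteq> L"
proof
  fix x assume "x \<in> forms K f r n C"
  then obtain k c where "x = k + form r f n c" "k \<in> K" "\<forall>a. c a \<in> C" unfolding forms_def by blast
  then show "x \<in> L" unfolding form_def using assms
    by (auto intro!: ideal_inD(3)[OF L] ideal_in_sum[OF L])
qed

text \<open>Both sides are \<open>K + J^(n+1)\<close>.\<close>

lemma forms_Suc:
  assumes K: "ideal_in K" and f: "\<forall>i. f i \<in> S"
  shows "forms K f r (Suc n) S = forms K f r n (generated K f r)"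
proof
  note J = generated_ideal[where r = r, OF K f]
  note SS = ideal_in_S
  show "forms K f r (Suc n) S \<subseteq> forms K f r n (generated K f r)"
  proof (rule forms_least[OF forms_ideal[OF K J f] forms_base[OF J]])
    fix c b assume c: "c \<in> S" and "b \<in> exponents r (Suc n)"
    then obtain i a where "i < r" "a \<in> exponents r n" "b = bump i a" by (metis exponents_Suc_bump)
    then show "c * mono_eval r f b \<in> forms K f r n (generated K f r)"
      using forms_single[OF K J generated_gen[OF K c, of i r f], of a r n f] mono_eval_bump[of i r f a]
      by (simp add: mult.assoc)
  qed
  note FS = forms_ideal[where r = r and n = "Suc n", OF K SS f]
  show "forms K f r n (generated K f r) \<subseteq> forms K f r (Suc n) S"
  proof (rule forms_least[OF FS forms_base[OF SS]])
    fix c b assume "c \<in> generated K f r" and b: "b \<in> exponents r n"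
    then obtain k s where c: "c = k + (\<Sum>i<r. s i * f i)" "k \<in> K" "\<forall>i. s i \<in> S"
      unfolding generated_def by blast
    have "k * mono_eval r f b \<in> K"
      using ideal_inD(4)[OF K mono_eval_S[OF f] c(2)] by (simp add: mult.commute)
    then have "k * mono_eval r f b \<in> forms K f r (Suc n) S" using forms_base[OF SS] by blast
    moreover have "(\<Sum>i<r. s i * mono_eval r f (bump i b)) \<in> forms K f r (Suc n) S"
      using c b by (intro ideal_in_sum[OF FS] forms_single[OF K SS] bump_exponents) auto
    moreover have "c * mono_eval r f b =
        k * mono_eval r f b + (\<Sum>i<r. s i * mono_eval r f (bump i b))"
      unfolding c(1) distrib_right sum_distrib_right
      by (intro arg_cong2[where f = "(+)"] sum.cong) (auto simp: mono_eval_bump mult.assoc)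
    ultimately show "c * mono_eval r f b \<in> forms K f r (Suc n) S" using ideal_inD(3)[OF FS] by simp
  qed
qed

lemma forms_0:
  assumes "ideal_in K"
  shows "forms K f r 0 S = S"
proof
  show "forms K f r 0 S \<subseteq> S"
    unfolding forms_def form_0 using ideal_inD(1)[OF assms] S_add by auto
  show "S \<subseteq> forms K f r 0 S"
    unfolding forms_def form_0 using ideal_inD(2)[OF assms]
    by (intro subsetI CollectI, rename_tac x, rule_tac x = 0 in exI, rule_tac x = "\<lambda>_. x" in exI) simp
qed

lemma forms_mono: "C \<subseteq> D \<Longrightarrow> forms K f r n C \<subseteq> forms K f r n D"
  unfolding forms_def by blast

lemma forms_decreasing:
  assumes K: "ideal_in K" and f: "\<forall>i. f i \<in> S"
  shows "forms K f r (Suc n) S \<subseteq> forms K f r n S"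
  unfolding forms_Suc[OF K f]
  by (rule forms_mono) (rule ideal_inD(1)[OF generated_ideal[OF K f]])

lemma forms_times:
  assumes K: "ideal_in K" and f: "\<forall>i. f i \<in> S"
    and x: "x \<in> forms K f r m S" and y: "y \<in> forms K f r n S"
  shows "x * y \<in> forms K f r (m + n) S"
proof -
  note SS = ideal_in_S
  note F = forms_ideal[OF K SS f]
  let ?L = "{x\<in>S. x * y \<in> forms K f r (m + n) S}"
  have yS: "y \<in> S" using y ideal_inD(1)[OF F] by blast
  have "ideal_in ?L"
    unfolding ideal_in_def using ideal_inD[OF F] S_zero S_add S_mult
    by (auto simp: distrib_right mult.assoc)
  moreover have "K \<subseteq> ?L"
  proof
    fix k assume k: "k \<in> K"
    then have "k * y \<in> K" using ideal_inD(4)[OF K yS k] by (simp add: mult.commute)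
    then have "k * y \<in> forms K f r (m + n) S" using forms_base[OF SS] by (rule rev_subsetD)
    then show "k \<in> ?L" using ideal_inD(1)[OF K] k by auto
  qed
  moreover have "c * mono_eval r f a \<in> ?L" if c: "c \<in> S" and a: "a \<in> exponents r m" for c a
  proof -
    let ?M = "{y\<in>S. c * mono_eval r f a * y \<in> forms K f r (m + n) S}"
    have cm: "c * mono_eval r f a \<in> S" using c mono_eval_S[OF f] S_mult by blast
    have "ideal_in ?M"
      unfolding ideal_in_def using ideal_inD[OF F] S_zero S_add S_mult
      by (auto simp: distrib_left mult.left_commute)
    moreover have "K \<subseteq> ?M"
      using ideal_inD(4)[OF K cm] ideal_inD(1)[OF K] forms_base[OF SS] by blast
    moreover have "d * mono_eval r f b \<in> ?M" if d: "d \<in> S" and b: "b \<in> exponents r n" for d b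
    proof -
      have "(\<lambda>i. a i + b i) \<in> exponents r (m + n)"
        using a b by (simp add: exponents_def sum.distrib)
      from forms_single[OF K SS S_mult[OF c d] this, of f]
      show ?thesis using d mono_eval_S[OF f] S_mult by (simp add: mono_eval_add mult_ac)
    qed
    ultimately have "forms K f r n S \<subseteq> ?M" by (rule forms_least)
    then show ?thesis using y cm by blast
  qed
  ultimately have "forms K f r m S \<subseteq> ?L" by (rule forms_least)
  then show ?thesis using x by blast
qed

text \<open>Induction on the number of elements, the last of which is split off a form. It is a
  nonzerodivisor modulo all powers of the ideal generated by the others, because these are
  quasi-regular; so it can be cancelled, which leaves a form of smaller degree.\<close>

theorem regular_imp_quasi_regular:
  assumes K: "ideal_in K" and f: "\<forall>i. f i \<in> S" and "regular_mod K f r"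
    and "\<And>a. c a \<in> S" and "form r f n c \<in> K" and "a \<in> exponents r n"
  shows "c a \<in> generated K f r"
  using assms(3-6)
proof (induction r arbitrary: n c a)
  case 0
  then have "n = 0" "a = (\<lambda>_. 0)" by (auto simp: exponents_def)
  then show ?case using 0 generated_base form_0 by (metis subsetD)
next
  case (Suc r)
  note SS = ideal_in_S
  note J = generated_ideal[OF K f]
  have reg: "regular_mod K f r" and reg_r: "\<And>x. x \<in> S \<Longrightarrow> f r * x \<in> generated K f r \<Longrightarrow> x \<in> generated K f r"
    using Suc.prems(1) unfolding regular_mod_def by auto
  note IHr = Suc.IH
  have cancel: "x \<in> forms K f r m S" if "x \<in> S" "f r * x \<in> forms K f r m S" for x m
    using that(2)
  proof (induction m)
    case 0
    then show ?case using that(1) forms_0[OF K] by simp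
  next
    case (Suc m)
    then have "x \<in> forms K f r m S" using forms_decreasing[OF K f] by blast
    then obtain k d where x: "x = k + form r f m d" "k \<in> K" "\<forall>a. d a \<in> S"
      unfolding forms_def by blast
    obtain l e where l: "f r * x = l + form r f m e" "l \<in> K" "\<forall>a. e a \<in> generated K f r"
      using Suc.prems unfolding forms_Suc[OF K f] unfolding forms_def by blast
    have "form r f m (\<lambda>a. f r * d a - e a) = l - f r * k"
      using x(1) l(1) unfolding form_diff form_mult by (simp add: distrib_left algebra_simps)
    then have inK: "form r f m (\<lambda>a. f r * d a - e a) \<in> K"
      using ideal_inD[OF K] l(2) x(2) f by simp
    have eS: "e a \<in> S" for a using l(3) ideal_inD(1)[OF J] by blast
    have "d a \<in> generated K f r" if "a \<in> exponents r m" for a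
    proof -
      have "f r * d a - e a \<in> generated K f r"
        by (rule IHr[OF reg _ inK that]) (use f x(3) eS in \<open>auto intro: S_diff S_mult\<close>)
      then have "f r * d a \<in> generated K f r"
        using ideal_inD(3)[OF J[of r], of "f r * d a - e a" "e a"] l(3) by simp
      then show ?thesis using reg_r x(3) by blast
    qed
    note dJ = this
    define d' where "d' a = (if a \<in> exponents r m then d a else 0)" for a
    have "form r f m d = form r f m d'" unfolding form_def d'_def by (intro sum.cong) auto
    moreover have "\<forall>a. d' a \<in> generated K f r"
      unfolding d'_def using dJ ideal_inD(2)[OF J] by simp
    ultimately have "x \<in> forms K f r m (generated K f r)"
      unfolding forms_def using x(1,2) by (intro CollectI exI[of _ k] exI[of _ d']) simp
    then show ?case unfolding forms_Suc[OF K f] .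
  qed
  show ?case using Suc.prems(2-4)
  proof (induction n arbitrary: c a)
    case 0
    then show ?case using generated_base form_0 exponents_0 by (metis singletonD subsetD)
  next
    case (Suc n)
    define G where "G = form r f (Suc n) c"
    define H where "H = form (Suc r) f n (\<lambda>a. c (bump r a))"
    have FGH: "form (Suc r) f (Suc n) c = G + f r * H" unfolding G_def H_def by (rule form_Suc_Suc)
    have HS: "H \<in> S" unfolding H_def by (intro form_S f Suc.prems(1))
    have "G \<in> forms K f r (Suc n) S"
      unfolding forms_def G_def using Suc.prems(1) ideal_inD(2)[OF K]
      by (intro CollectI exI[of _ 0] exI[of _ c]) auto
    moreover have "form (Suc r) f (Suc n) c \<in> forms K f r (Suc n) S"
      using Suc.prems(2) forms_base[OF SS] by blast
    ultimately have "f r * H \<in> forms K f r (Suc n) S"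
      using FGH ideal_inD(6)[OF forms_ideal[OF K SS f], of "form (Suc r) f (Suc n) c" r "Suc n" G] by simp
    from cancel[OF HS this] obtain k h where h: "H = k + form r f (Suc n) h" "k \<in> K" "\<forall>a. h a \<in> S"
      unfolding forms_def by blast
    have "form r f (Suc n) (\<lambda>a. c a + f r * h a) = form (Suc r) f (Suc n) c - f r * k"
      using FGH h(1) unfolding G_def by (simp add: form_add form_mult algebra_simps)
    then have inK: "form r f (Suc n) (\<lambda>a. c a + f r * h a) \<in> K"
      using ideal_inD[OF K] Suc.prems(2) h(2) f by simp
    have low: "c a \<in> generated K f (Suc r)" if "a \<in> exponents r (Suc n)" for a
    proof -
      have "c a + f r * h a \<in> generated K f r"
        by (rule IHr[OF reg _ inK that]) (use f h(3) Suc.prems(1) in \<open>auto intro: S_add S_mult\<close>)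
      from generated_Suc[OF this, of "- h a"] show ?thesis
        using h(3) S_uminus by (simp add: mult.commute)
    qed
    have "form r f (Suc n) h \<in> forms K f (Suc r) (Suc n) S"
      unfolding forms_def form_extend[of r] using ideal_inD(2)[OF K] h(3) S_zero
      by (intro CollectI exI[of _ 0] exI[of _ "\<lambda>a. if a \<in> exponents r (Suc n) then h a else 0"]) auto
    then obtain l e where e: "form r f (Suc n) h = l + form (Suc r) f n e" "l \<in> K"
      "\<forall>a. e a \<in> generated K f (Suc r)"
      unfolding forms_Suc[OF K f] unfolding forms_def by blast
    have eS: "e a \<in> S" for a using e(3) ideal_inD(1)[OF J] by blast
    have inK': "form (Suc r) f n (\<lambda>a. c (bump r a) - e a) \<in> K"
      using h(1,2) e(1,2) ideal_inD(3)[OF K] unfolding H_def form_diff by simp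
    have high: "c (bump r a) \<in> generated K f (Suc r)" if "a \<in> exponents (Suc r) n" for a
    proof -
      have "c (bump r a) - e a \<in> generated K f (Suc r)"
        by (rule Suc.IH[OF _ inK' that]) (use Suc.prems(1) eS in \<open>auto intro: S_diff\<close>)
      then show ?thesis using ideal_inD(3)[OF J[of "Suc r"], of "c (bump r a) - e a" "e a"] e(3) by simp
    qed
    show ?case using low high Suc.prems(3) unfolding exponents_Suc_Suc by blast
  qed
qed

end


abbreviation lookup :: "('a \<Rightarrow>\<^sub>0 'b::zero) \<Rightarrow> 'a \<Rightarrow> 'b" where "lookup \<equiv> Poly_Mapping.lookup"
abbreviation keys :: "('a \<Rightarrow>\<^sub>0 'b::zero) \<Rightarrow> 'a set" where "keys \<equiv> Poly_Mapping.keys"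

lemma digits_inj:
  fixes a b :: "nat \<Rightarrow> nat"
  assumes "\<And>i. i < r \<Longrightarrow> a i < B" "\<And>i. i < r \<Longrightarrow> b i < B"
    and "(\<Sum>i<r. a i * B ^ i) = (\<Sum>i<r. b i * B ^ i)" and "i < r"
  shows "a i = b i"
  using assms
proof (induction r arbitrary: a b i)
  case (Suc r)
  have *: "(\<Sum>i<Suc r. c i * B ^ i) = c 0 + B * (\<Sum>i<r. c (Suc i) * B ^ i)" for c :: "nat \<Rightarrow> nat"
    by (simp add: sum.lessThan_Suc_shift sum_distrib_left algebra_simps del: sum.lessThan_Suc)
  have eq: "a 0 + B * (\<Sum>i<r. a (Suc i) * B ^ i) = b 0 + B * (\<Sum>i<r. b (Suc i) * B ^ i)"
    using Suc.prems(3) unfolding * .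
  have lt: "a 0 < B" "b 0 < B" using Suc.prems(1,2) by auto
  from arg_cong[OF eq, of "\<lambda>n. n mod B"] lt have "a 0 = b 0" by simp
  moreover have "a (Suc j) = b (Suc j)" if "j < r" for j
  proof (rule Suc.IH[OF _ _ _ that])
    show "(\<Sum>i<r. a (Suc i) * B ^ i) = (\<Sum>i<r. b (Suc i) * B ^ i)"
      using eq \<open>a 0 = b 0\<close> lt by simp
  qed (use Suc.prems(1,2) in auto)
  ultimately show ?case using Suc.prems(4) by (cases i) auto
qed simp

context subring_set
begin

text \<open>If \<open>c\<close> has a coefficient outside the ideal, take the least exponents in lexicographic order
  at which \<open>d\<close> does not vanish and at which \<open>c\<close> is outside; the coefficient of the product at
  their sum is outside as well. The order is encoded by reading exponents as digits.\<close>

lemma product_of_forms: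
  assumes K: "ideal_in K" and f: "\<forall>i. f i \<in> S" and reg: "regular_mod K f r"
    and d: "\<And>a. d a \<in> S" "\<And>a. d a \<noteq> 0 \<Longrightarrow> \<exists>y\<in>S. y * d a = 1"
    and d0: "a1 \<in> exponents r e" "d a1 \<noteq> 0" and c: "\<And>a. c a \<in> S"
    and prod: "form r f e d * form r f n c \<in> forms K f r (Suc (e + n)) S"
    and b: "b \<in> exponents r n"
  shows "c b \<in> generated K f r"
proof (rule ccontr)
  assume bad: "c b \<notin> generated K f r"
  note J = generated_ideal[OF K f]
  define B where "B = Suc (e + n)"
  define code where "code a = (\<Sum>i<r. a i * B ^ i)" for a :: "nat \<Rightarrow> nat"
  have code_add: "code (\<lambda>i. a i + b i) = code a + code b" for a b
    by (simp add: code_def algebra_simps sum.distrib)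
  have code_inj: "a = a'" if "a \<in> exponents r k" "a' \<in> exponents r k" "code a = code a'" "k < B" for a a' k
  proof
    fix i
    have "\<And>i. a i < B" "\<And>i. a' i < B"
      using exponents_le[OF that(1)] exponents_le[OF that(2)] that(4) by (meson order.strict_trans1)+
    then show "a i = a' i"
      using digits_inj[of r a B a' i] that unfolding code_def exponents_def
      by (cases "i < r") auto
  qed
  obtain a0 where a0: "a0 \<in> exponents r e" "d a0 \<noteq> 0"
    "\<And>a. a \<in> exponents r e \<Longrightarrow> d a \<noteq> 0 \<Longrightarrow> code a0 \<le> code a"
    using ex_has_least_nat[of "\<lambda>a. a \<in> exponents r e \<and> d a \<noteq> 0" a1 code] d0 by blast
  obtain b0 where b0: "b0 \<in> exponents r n" "c b0 \<notin> generated K f r"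
    "\<And>a. a \<in> exponents r n \<Longrightarrow> c a \<notin> generated K f r \<Longrightarrow> code b0 \<le> code a"
    using ex_has_least_nat[of "\<lambda>a. a \<in> exponents r n \<and> c a \<notin> generated K f r" b code] b bad by blast
  define pairs where "pairs s = {(a, a'). a \<in> exponents r e \<and> a' \<in> exponents r n \<and> (\<lambda>i. a i + a' i) = s}" for s
  define conv where "conv s = (\<Sum>(a, a')\<in>pairs s. d a * c a')" for s
  let ?AB = "exponents r e \<times> exponents r n"
  have finAB: "finite ?AB" using finite_exponents by auto
  have pairs_sub: "pairs s \<subseteq> ?AB" for s unfolding pairs_def by auto
  have "form r f e d * form r f n c =
      (\<Sum>(a, a')\<in>?AB. d a * c a' * mono_eval r f (\<lambda>i. a i + a' i))"
    unfolding form_def sum_product sum.cartesian_product mono_eval_add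
    by (intro sum.cong) (auto simp: algebra_simps)
  also have "\<dots> = (\<Sum>s\<in>exponents r (e + n). \<Sum>(a, a')\<in>{p\<in>?AB. (\<lambda>(a, a') i. a i + a' i) p = s}.
      d a * c a' * mono_eval r f (\<lambda>i. a i + a' i))"
    by (rule sum.group[OF finAB finite_exponents, symmetric])
      (auto simp: exponents_def sum.distrib)
  also have "\<dots> = form r f (e + n) conv"
    unfolding form_def conv_def sum_distrib_right
  proof (intro sum.cong refl)
    fix s
    show "{p\<in>?AB. (\<lambda>(a, a') i. a i + a' i) p = s} = pairs s" unfolding pairs_def by auto
  next
    fix s p assume "p \<in> pairs s"
    then show "(case p of (a, a') \<Rightarrow> d a * c a' * mono_eval r f (\<lambda>i. a i + a' i)) =
        (case p of (a, a') \<Rightarrow> d a * c a') * mono_eval r f s" unfolding pairs_def by auto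
  qed
  finally have "form r f (e + n) conv \<in> forms K f r (e + n) (generated K f r)"
    using prod unfolding forms_Suc[OF K f] by simp
  then obtain k g where g: "form r f (e + n) conv = k + form r f (e + n) g" "k \<in> K"
    "\<forall>a. g a \<in> generated K f r" unfolding forms_def by blast
  have inK: "form r f (e + n) (\<lambda>a. conv a - g a) \<in> K" using g(1,2) by (simp add: form_diff)
  have convS: "conv s - g s \<in> S" for s
  proof -
    have "conv s \<in> S" unfolding conv_def by (intro S_sum) (auto intro: S_mult d c)
    then show ?thesis using g(3) ideal_inD(1)[OF J] by (blast intro: S_diff)
  qed
  let ?s = "\<lambda>i. a0 i + b0 i"
  have "?s \<in> exponents r (e + n)" using a0(1) b0(1) by (simp add: exponents_def sum.distrib)
  from regular_imp_quasi_regular[OF K f reg convS inK this]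
  have "conv ?s \<in> generated K f r" using ideal_inD(3)[OF J[of r], of "conv ?s - g ?s" "g ?s"] g(3) by simp
  moreover have "(\<Sum>(a, a')\<in>pairs ?s - {(a0, b0)}. d a * c a') \<in> generated K f r"
  proof (rule ideal_in_sum[OF J])
    fix p assume "p \<in> pairs ?s - {(a0, b0)}"
    then obtain a a' where p: "p = (a, a')" "a \<in> exponents r e" "a' \<in> exponents r n"
      "(\<lambda>i. a i + a' i) = ?s" "(a, a') \<noteq> (a0, b0)" unfolding pairs_def by auto
    have codes: "code a + code a' = code a0 + code b0" using p(4) code_add by metis
    show "(case p of (a, a') \<Rightarrow> d a * c a') \<in> generated K f r"
    proof (cases "d a = 0 \<or> c a' \<in> generated K f r")
      case True
      then show ?thesis using p(1) ideal_inD(2,4)[OF J] d(1) by auto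
    next
      case False
      then have "code a0 \<le> code a" "code b0 \<le> code a'" using a0(3) b0(3) p by auto
      then have "code a = code a0" "code a' = code b0" using codes by linarith+
      then have "a = a0" "a' = b0" using code_inj p a0(1) b0(1) unfolding B_def by auto
      then show ?thesis using p(5) by simp
    qed
  qed
  moreover have "conv ?s = d a0 * c b0 + (\<Sum>(a, a')\<in>pairs ?s - {(a0, b0)}. d a * c a')"
    unfolding conv_def using sum.remove[of "pairs ?s" "(a0, b0)" "\<lambda>(a, a'). d a * c a'"]
      finite_subset[OF pairs_sub finAB] a0(1) b0(1) by (simp add: pairs_def)
  ultimately have dc: "d a0 * c b0 \<in> generated K f r"
    using ideal_inD(6)[OF J[of r], of "conv ?s" "\<Sum>(a, a')\<in>pairs ?s - {(a0, b0)}. d a * c a'"] by simp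
  obtain y where y: "y \<in> S" "y * d a0 = 1" using d(2)[OF a0(2)] by blast
  have "y * (d a0 * c b0) = c b0" using y(2) by (simp add: mult.assoc[symmetric])
  then show False using ideal_inD(4)[OF J y(1) dc] b0(2) by simp
qed

text \<open>A nonzero polynomial in the \<open>f i\<close> whose nonzero coefficients are units annihilates \<open>u\<close> modulo
  \<open>K\<close>. If \<open>u\<close> is a form of degree \<open>n\<close> in the \<open>f i\<close>, its product with the part of lowest degree of
  the polynomial lies in the next power of \<open>J = (f 0, \<dots>, f (r - 1))\<close>; by the previous lemma the
  coefficients of the form are in \<open>K + J\<close>, and \<open>u\<close> is in \<open>K + J^(n+1)\<close>.\<close>

theorem regular_no_relation:
  assumes K: "ideal_in K" and f: "\<forall>i. f i \<in> S" and reg: "regular_mod K f r"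
    and A: "finite A" "\<And>a i. a \<in> A \<Longrightarrow> r \<le> i \<Longrightarrow> a i = 0"
    and d: "\<And>a. d a \<in> S" "\<And>a. d a \<noteq> 0 \<Longrightarrow> \<exists>y\<in>S. y * d a = 1"
    and nz: "\<exists>a\<in>A. d a \<noteq> 0"
    and u: "u \<in> S" "(\<Sum>a\<in>A. d a * mono_eval r f a) * u \<in> K"
  shows "u \<in> forms K f r n S"
proof -
  note F = forms_ideal[OF K ideal_in_S f]
  define deg where "deg a = (\<Sum>i<r. a i)" for a :: "nat \<Rightarrow> nat"
  obtain a1 where a1: "a1 \<in> A" "d a1 \<noteq> 0" "\<And>a. a \<in> A \<Longrightarrow> d a \<noteq> 0 \<Longrightarrow> deg a1 \<le> deg a"
    using nz ex_has_least_nat[of "\<lambda>a. a \<in> A \<and> d a \<noteq> 0" _ deg] by blast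
  define e where "e = deg a1"
  define d' where "d' a = (if a \<in> A then d a else 0)" for a
  have Aexp: "a \<in> exponents r (deg a)" if "a \<in> A" for a
    using A(2) that unfolding exponents_def deg_def by auto
  have low: "form r f e d' = (\<Sum>a\<in>{a\<in>A. deg a = e}. d a * mono_eval r f a)"
  proof -
    have sub: "{a\<in>A. deg a = e} \<subseteq> exponents r e" using Aexp by blast
    have "form r f e d' = (\<Sum>a\<in>{a\<in>A. deg a = e}. d' a * mono_eval r f a)"
      unfolding form_def
      by (rule sum.mono_neutral_right[OF finite_exponents sub])
        (auto simp: d'_def exponents_def deg_def)
    then show ?thesis by (simp add: d'_def)
  qed
  have split: "(\<Sum>a\<in>A. d a * mono_eval r f a) =
      form r f e d' + (\<Sum>a\<in>{a\<in>A. deg a \<noteq> e}. d a * mono_eval r f a)"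
  proof -
    have "A = {a\<in>A. deg a = e} \<union> {a\<in>A. deg a \<noteq> e}" by blast
    then show ?thesis unfolding low
      using A(1) by (subst (1) \<open>A = _\<close>, intro sum.union_disjoint) auto
  qed
  have decr: "forms K f r (m + k) S \<subseteq> forms K f r m S" for m k
    by (induction k) (use forms_decreasing[OF K f] in force)+
  have high: "(\<Sum>a\<in>{a\<in>A. deg a \<noteq> e}. d a * mono_eval r f a) \<in> forms K f r (Suc e) S"
  proof (rule ideal_in_sum[OF F])
    fix a assume a: "a \<in> {a\<in>A. deg a \<noteq> e}"
    show "d a * mono_eval r f a \<in> forms K f r (Suc e) S"
    proof (cases "d a = 0")
      case True
      then show ?thesis using ideal_inD(2)[OF F] by simp
    next
      case False
      then have "e < deg a" using a a1(3)[of a] unfolding e_def by auto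
      then obtain k where "deg a = Suc e + k" by (metis less_iff_Suc_add add_Suc)
      then show ?thesis using forms_single[OF K ideal_in_S d(1) Aexp[of a]] a decr[of "Suc e" k] by auto
    qed
  qed
  show ?thesis
  proof (induction n)
    case 0
    then show ?case using forms_0[OF K] u(1) by simp
  next
    case (Suc n)
    then obtain k c where c: "u = k + form r f n c" "k \<in> K" "\<forall>a. c a \<in> S" unfolding forms_def by blast
    have FI: "ideal_in (forms K f r (Suc (e + n)) S)" by (rule F)
    have KF: "K \<subseteq> forms K f r (Suc (e + n)) S" by (rule forms_base[OF ideal_in_S])
    have d'S: "d' a \<in> S" for a unfolding d'_def using d(1) S_zero by auto
    have d'u: "d' a \<noteq> 0 \<Longrightarrow> \<exists>y\<in>S. y * d' a = 1" for a unfolding d'_def using d(2) by (auto split: if_splits)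
    let ?h = "\<Sum>a\<in>{a\<in>A. deg a \<noteq> e}. d a * mono_eval r f a"
    have "?h * u \<in> forms K f r (Suc (e + n)) S"
      using forms_times[OF K f high Suc] by simp
    moreover have "form r f e d' * u + ?h * u \<in> forms K f r (Suc (e + n)) S"
      using u(2) KF unfolding split distrib_right by blast
    ultimately have "form r f e d' * u \<in> forms K f r (Suc (e + n)) S"
      using ideal_inD(6)[OF FI, of "form r f e d' * u + ?h * u" "?h * u"] by simp
    moreover have "form r f e d' * k \<in> forms K f r (Suc (e + n)) S"
      using ideal_inD(4)[OF K form_S[OF f] c(2)] d'S KF by blast
    ultimately have "form r f e d' * u - form r f e d' * k \<in> forms K f r (Suc (e + n)) S"
      using ideal_inD(6)[OF FI] by blast
    then have prod: "form r f e d' * form r f n c \<in> forms K f r (Suc (e + n)) S"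
      unfolding c(1) by (simp add: distrib_left)
    have "c b \<in> generated K f r" if "b \<in> exponents r n" for b
    proof (rule product_of_forms[OF K f reg d'S d'u _ _ _ prod that])
      show "a1 \<in> exponents r e" unfolding e_def using Aexp a1(1) .
      show "d' a1 \<noteq> 0" using a1 by (simp add: d'_def)
      show "c a \<in> S" for a using c(3) by blast
    qed
    then have cJ: "\<forall>a. (if a \<in> exponents r n then c a else 0) \<in> generated K f r"
      using ideal_inD(2)[OF generated_ideal[OF K f]] by simp
    have "form r f n c = form r f n (\<lambda>a. if a \<in> exponents r n then c a else 0)"
      unfolding form_def by (intro sum.cong) auto
    then have "u = k + form r f n (\<lambda>a. if a \<in> exponents r n then c a else 0)" using c(1) by simp
    then show ?case unfolding forms_Suc[OF K f] unfolding forms_def using c(2) cJ by blast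
  qed
qed

end

section \<open>Polynomials\<close>

definition polys :: "'v set \<Rightarrow> ('v, 'k::field) mpoly set" where
  "polys V = {f. \<forall>a\<in>keys f. keys a \<subseteq> V}"

lemma mpoly_ring_simps [simp]:
  "carrier (mpoly_ring V) = polys V" "mult (mpoly_ring V) = (*)" "one (mpoly_ring V) = 1"
  "zero (mpoly_ring V) = 0" "add (mpoly_ring V) = (+)"
  by (simp_all add: mpoly_ring_def polys_def)

lemma keys_add_nat: "keys (a + b) = keys a \<union> keys (b :: 'v \<Rightarrow>\<^sub>0 nat)"
  by (auto simp: in_keys_iff lookup_add)

lemma keys_diff_subset: "keys (f - g) \<subseteq> keys f \<union> keys g"
  for f g :: "'a \<Rightarrow>\<^sub>0 'b::cancel_comm_monoid_add"
  by (auto simp: in_keys_iff lookup_minus)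

lemma keys_mult_cases:
  assumes "c \<in> keys (f * g)"
  obtains a b where "a \<in> keys f" "b \<in> keys g" "c = a + b"
  using assms keys_mult[of f g] by blast

lemma poly_mapping_eq_sum_single:
  "f = (\<Sum>a\<in>keys f. Poly_Mapping.single a (Poly_Mapping.lookup f a))"
proof (rule poly_mapping_eqI)
  fix a
  show "lookup f a = lookup (\<Sum>a\<in>keys f. Poly_Mapping.single a (lookup f a)) a"
    by (simp add: lookup_sum lookup_single when_def in_keys_iff)
qed

interpretation polys: subring_set "polys V" for V
proof
  show "x - y \<in> polys V" if "x \<in> polys V" "y \<in> polys V" for x y
    using that keys_diff_subset[of x y] unfolding polys_def by blast
  show "x * y \<in> polys V" if "x \<in> polys V" "y \<in> polys V" for x y
    unfolding polys_def
  proof (intro CollectI ballI)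
    fix c assume "c \<in> keys (x * y)"
    then obtain a b where "a \<in> keys x" "b \<in> keys y" "c = a + b" by (rule keys_mult_cases)
    then show "keys c \<subseteq> V" using that by (simp add: polys_def keys_add_nat)
  qed
qed (auto simp: polys_def)

lemma cring_mpoly_ring: "cring (mpoly_ring V)"
proof (intro cringI abelian_groupI comm_monoidI)
  fix x assume "x \<in> carrier (mpoly_ring V)"
  then show "\<exists>y\<in>carrier (mpoly_ring V). y \<oplus>\<^bsub>mpoly_ring V\<^esub> x = \<zero>\<^bsub>mpoly_ring V\<^esub>"
    by (auto intro!: bexI[of _ "- x"] polys.S_uminus)
qed (auto intro: polys.S_add polys.S_mult polys.S_zero polys.S_one simp: algebra_simps)

lemma lookup_single_mult:
  "lookup (Poly_Mapping.single a c * g) b = (if \<exists>d. b = a + d then c * lookup g (b - a) else 0)"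
  for g :: "('v, 'k::field) mpoly"
proof -
  have "lookup (Poly_Mapping.single a c * g) b =
      Sum_any (\<lambda>l. lookup (Poly_Mapping.single a c) l * Sum_any (\<lambda>q. lookup g q when b = l + q))"
    by (simp add: lookup_mult)
  also have "\<dots> = Sum_any (\<lambda>l. c * Sum_any (\<lambda>q. lookup g q when b = a + q) when l = a)"
    by (rule Sum_any.cong) (simp add: lookup_single when_def)
  also have "\<dots> = c * Sum_any (\<lambda>q. lookup g q when b = a + q)" by simp
  also have "Sum_any (\<lambda>q. lookup g q when b = a + q) = (if \<exists>d. b = a + d then lookup g (b - a) else 0)"
  proof (cases "\<exists>d. b = a + d")
    case True
    then have "(lookup g q when b = a + q) = (lookup g q when q = b - a)" for q
      by (auto simp: when_def)
    then show ?thesis using True by simp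
  qed auto
  finally show ?thesis by simp
qed

lemma lookup_scalar_mult: "lookup (Poly_Mapping.single 0 c * g) b = c * lookup g b"
  for g :: "('v, 'k::field) mpoly"
  by (simp add: lookup_single_mult)

lemma single_in_polys: "keys a \<subseteq> V \<Longrightarrow> Poly_Mapping.single a c \<in> polys V"
  by (simp add: polys_def)

text \<open>The result of setting the variables outside \<open>T\<close> to zero.\<close>

definition restrict_poly :: "'v set \<Rightarrow> ('v, 'k::field) mpoly \<Rightarrow> ('v, 'k) mpoly" where
  "restrict_poly T f =
     (\<Sum>a\<in>{a\<in>keys f. keys a \<subseteq> T}. Poly_Mapping.single a (Poly_Mapping.lookup f a))"

lemma lookup_restrict_poly:
  "lookup (restrict_poly T f) a = (lookup f a when keys a \<subseteq> T)"
proof -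
  have "lookup (restrict_poly T f) a = (\<Sum>b\<in>{b\<in>keys f. keys b \<subseteq> T}. if b = a then lookup f a else 0)"
    unfolding restrict_poly_def lookup_sum by (intro sum.cong) (auto simp: lookup_single when_def)
  also have "\<dots> = (lookup f a when keys a \<subseteq> T)"
    by (simp add: when_def) (simp add: in_keys_iff)
  finally show ?thesis .
qed

lemma restrict_poly_in_polys: "restrict_poly T f \<in> polys T"
  unfolding polys_def
proof (intro CollectI ballI)
  fix a assume "a \<in> keys (restrict_poly T f)"
  then have "(lookup f a when keys a \<subseteq> T) \<noteq> 0" unfolding in_keys_iff lookup_restrict_poly .
  then show "keys a \<subseteq> T" by (simp add: when_neq_zero)
qed

lemma restrict_poly_add: "restrict_poly T (f + g) = restrict_poly T f + restrict_poly T g"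
  by (rule poly_mapping_eqI) (simp add: lookup_restrict_poly lookup_add when_def)

lemma restrict_poly_diff: "restrict_poly T (f - g) = restrict_poly T f - restrict_poly T g"
  by (rule poly_mapping_eqI) (simp add: lookup_restrict_poly lookup_minus when_def)

lemma restrict_poly_sum: "restrict_poly T (sum f A) = (\<Sum>a\<in>A. restrict_poly T (f a))"
  by (rule poly_mapping_eqI) (simp add: lookup_restrict_poly lookup_sum when_def)

lemma restrict_poly_mult: "restrict_poly T (f * g) = restrict_poly T f * restrict_poly T g"
proof (rule poly_mapping_eqI)
  fix k
  show "lookup (restrict_poly T (f * g)) k = lookup (restrict_poly T f * restrict_poly T g) k"
  proof (cases "keys k \<subseteq> T")
    case True
    have "lookup f l * Sum_any (\<lambda>q. lookup g q when k = l + q) =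
        lookup (restrict_poly T f) l * Sum_any (\<lambda>q. lookup (restrict_poly T g) q when k = l + q)" for l
    proof (cases "keys l \<subseteq> T")
      case lT: True
      have "(lookup g q when k = l + q) = (lookup (restrict_poly T g) q when k = l + q)" for q
        using True by (auto simp: when_def lookup_restrict_poly keys_add_nat)
      then show ?thesis using lT by (simp add: lookup_restrict_poly)
    next
      case False
      then have "k \<noteq> l + q" for q using True by (auto simp: keys_add_nat)
      then show ?thesis by simp
    qed
    then show ?thesis using True by (simp add: lookup_restrict_poly lookup_mult)
  next
    case False
    have zero: "lookup (restrict_poly T f) l * Sum_any (\<lambda>q. lookup (restrict_poly T g) q when k = l + q) = 0" for l
    proof (cases "keys l \<subseteq> T")
      case True
      then have "(lookup (restrict_poly T g) q when k = l + q) = 0" for q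
        using False by (auto simp: when_def lookup_restrict_poly keys_add_nat)
      then show ?thesis by simp
    qed (simp add: lookup_restrict_poly)
    have "lookup (restrict_poly T f * restrict_poly T g) k = 0" unfolding lookup_mult zero by simp
    then show ?thesis using False by (simp add: lookup_restrict_poly)
  qed
qed

lemma restrict_poly_1: "restrict_poly T 1 = 1"
  by (rule poly_mapping_eqI) (auto simp: lookup_restrict_poly lookup_one when_def)

lemma restrict_poly_single: "keys a \<subseteq> T \<Longrightarrow> restrict_poly T (Poly_Mapping.single a c) = Poly_Mapping.single a c"
  by (rule poly_mapping_eqI) (auto simp: lookup_restrict_poly lookup_single when_def)

lemma restrict_poly_mono_eval:
  "restrict_poly T (mono_eval r f a) = mono_eval r (\<lambda>i. restrict_poly T (f i)) a"
proof -
  have pow: "restrict_poly T (g ^ n) = restrict_poly T g ^ n" for g n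
    by (induction n) (simp_all add: restrict_poly_1 restrict_poly_mult)
  show ?thesis unfolding mono_eval_def
    by (induction r) (simp_all add: restrict_poly_1 restrict_poly_mult pow)
qed

subsection \<open>Linear dependence of many polynomials in few monomials\<close>

lemma linear_dependence:
  fixes g :: "'i \<Rightarrow> ('b \<Rightarrow>\<^sub>0 'k::field)"
  assumes "finite A" "finite B" "card B < card A" "\<And>a. a \<in> A \<Longrightarrow> keys (g a) \<subseteq> B"
  shows "\<exists>c. (\<exists>a\<in>A. c a \<noteq> 0) \<and> (\<forall>b. (\<Sum>a\<in>A. c a * lookup (g a) b) = 0)"
  using assms(2,1,3,4)
proof (induction B arbitrary: A g rule: finite_induct)
  case empty
  then obtain a where "a \<in> A" by fastforce
  then show ?case using empty by (intro exI[of _ "\<lambda>_. 1"]) (auto simp: lookup_eq_zero_in_keys_contradict)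
next
  case (insert b B)
  show ?case
  proof (cases "\<forall>a\<in>A. lookup (g a) b = 0")
    case True
    have "keys (g a) \<subseteq> B" if "a \<in> A" for a
      using insert.prems(3)[OF that] True that by (auto simp: in_keys_iff)
    then show ?thesis using insert.IH[of A g] insert.prems insert.hyps by simp
  next
    case False
    then obtain p where p: "p \<in> A" "lookup (g p) b \<noteq> 0" by blast
    \<comment> \<open>Gaussian elimination of the coefficient at \<open>b\<close> with pivot \<open>p\<close>.\<close>
    define q where "q a = lookup (g a) b / lookup (g p) b" for a
    define h where "h a = g a - Poly_Mapping.map (\<lambda>x. q a * x) (g p)" for a
    have lh: "lookup (h a) x = lookup (g a) x - q a * lookup (g p) x" for a x
      unfolding h_def by (simp add: lookup_minus map.rep_eq when_def)
    have "keys (h a) \<subseteq> B" if "a \<in> A - {p}" for a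
    proof
      fix x assume "x \<in> keys (h a)"
      then have nz: "lookup (g a) x - q a * lookup (g p) x \<noteq> 0" by (simp add: in_keys_iff lh)
      then have "x \<noteq> b" using p by (auto simp: q_def)
      moreover have "x \<in> insert b B"
      proof -
        have "x \<in> keys (g a) \<or> x \<in> keys (g p)" using nz by (auto simp: in_keys_iff)
        then show ?thesis using insert.prems(3)[of a] insert.prems(3)[of p] that p by blast
      qed
      ultimately show "x \<in> B" by blast
    qed
    moreover have "card B < card (A - {p})"
      using insert.prems insert.hyps p by simp
    ultimately obtain c where c: "\<exists>a\<in>A - {p}. c a \<noteq> 0"
      "\<forall>x. (\<Sum>a\<in>A - {p}. c a * lookup (h a) x) = 0"
      using insert.IH[of "A - {p}" h] insert.prems(1) by auto
    define c' where "c' a = (if a = p then - (\<Sum>a\<in>A - {p}. c a * q a) else c a)" for a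
    have "(\<Sum>a\<in>A. c' a * lookup (g a) x) = 0" for x
    proof -
      have "(\<Sum>a\<in>A. c' a * lookup (g a) x) =
          c' p * lookup (g p) x + (\<Sum>a\<in>A - {p}. c' a * lookup (g a) x)"
        using insert.prems(1) p(1) by (rule sum.remove)
      also have "(\<Sum>a\<in>A - {p}. c' a * lookup (g a) x) = (\<Sum>a\<in>A - {p}. c a * lookup (g a) x)"
        by (intro sum.cong) (auto simp: c'_def)
      also have "\<dots> = (\<Sum>a\<in>A - {p}. c a * lookup (h a) x) + (\<Sum>a\<in>A - {p}. c a * q a) * lookup (g p) x"
        unfolding sum_distrib_right sum.distrib[symmetric] lh by (intro sum.cong) (auto simp: algebra_simps)
      also have "(\<Sum>a\<in>A - {p}. c a * lookup (h a) x) = 0" using c(2) by blast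
      finally show ?thesis by (simp add: c'_def)
    qed
    moreover have "\<exists>a\<in>A. c' a \<noteq> 0" using c(1) by (auto simp: c'_def)
    ultimately show ?thesis by blast
  qed
qed

lemma lookup_mult_le:
  assumes "\<And>a. a \<in> keys f \<Longrightarrow> lookup a v \<le> m"
    and "\<And>a. a \<in> keys g \<Longrightarrow> lookup a v \<le> n" and "a \<in> keys (f * g)"
  shows "lookup a v \<le> m + (n::nat)"
  using assms(3) by (rule keys_mult_cases) (auto simp: lookup_add intro: add_mono assms)

lemma lookup_mono_eval_le:
  assumes "\<And>i a. i < r \<Longrightarrow> a \<in> keys (f i) \<Longrightarrow> lookup a v \<le> D"
    and "\<And>i. i < r \<Longrightarrow> e i \<le> M" and "a \<in> keys (mono_eval r f e)"
  shows "lookup a v \<le> r * (M * (D::nat))"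
proof -
  have pow: "lookup a v \<le> n * D" if "i < r" "a \<in> keys (f i ^ n)" for i n a
    using that(2)
  proof (induction n arbitrary: a)
    case (Suc n)
    show ?case using lookup_mult_le[OF assms(1)[OF that(1)] Suc.IH] Suc.prems by simp
  qed simp
  have "s \<le> r \<Longrightarrow> a \<in> keys (\<Prod>i<s. f i ^ e i) \<Longrightarrow> lookup a v \<le> s * (M * D)" for s a
  proof (induction s arbitrary: a)
    case (Suc s)
    have "lookup b v \<le> M * D" if "b \<in> keys (f s ^ e s)" for b
      using pow[OF _ that] assms(2)[of s] Suc.prems(1) by (meson Suc_le_eq mult_le_mono1 order.trans)
    with Suc have "lookup a v \<le> s * (M * D) + M * D"
      by (intro lookup_mult_le[of "\<Prod>i<s. f i ^ e i" v _ "f s ^ e s"]) auto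
    then show ?case by simp
  qed simp
  then show ?thesis using assms(3) unfolding mono_eval_def by blast
qed

text \<open>A box of \<open>M ^ r\<close> monomials in the \<open>f i\<close> lies in a space of dimension at most
  \<open>(r M D + 1) ^ card T\<close>.\<close>

lemma algebraic_relation:
  fixes f :: "nat \<Rightarrow> ('v, 'k::field) mpoly"
  assumes "finite T" "\<And>i. f i \<in> polys T" "card T < r"
  shows "\<exists>A c. finite A \<and> (\<forall>a\<in>A. \<forall>i\<ge>r. a i = 0) \<and> (\<exists>a\<in>A. c a \<noteq> 0) \<and>
    (\<Sum>a\<in>A. Poly_Mapping.single 0 (c a) * mono_eval r f a) = 0"
proof -
  define D where "D = (\<Sum>i<r. \<Sum>a\<in>keys (f i). \<Sum>v\<in>keys a. lookup a v)"
  have D: "lookup a v \<le> D" if "i < r" "a \<in> keys (f i)" for i a v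
  proof (cases "v \<in> keys a")
    case True
    have "lookup a v \<le> (\<Sum>v\<in>keys a. lookup a v)"
      using True by (intro member_le_sum) auto
    also have "\<dots> \<le> (\<Sum>a\<in>keys (f i). \<Sum>v\<in>keys a. lookup a v)"
      using that by (intro member_le_sum[where f = "\<lambda>a. \<Sum>v\<in>keys a. lookup a v"]) auto
    also have "\<dots> \<le> D"
      unfolding D_def using that
      by (intro member_le_sum[where f = "\<lambda>i. \<Sum>a\<in>keys (f i). \<Sum>v\<in>keys a. lookup a v"]) auto
    finally show ?thesis .
  qed (simp add: in_keys_iff)
  define d where "d = card T"
  define M where "M = (r * D + 1) ^ d + 1"
  define N where "N = r * (M * D)"
  define A where "A = {a :: nat \<Rightarrow> nat. \<forall>i. (i \<in> {..<r} \<longrightarrow> a i \<in> {..<M}) \<and> (i \<notin> {..<r} \<longrightarrow> a i = 0)}"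
  have finA: "finite A" unfolding A_def by (rule finite_set_of_finite_funs) auto
  have cardA: "card A = M ^ r"
  proof -
    have "bij_betw (\<lambda>a. \<lambda>i. if i < r then a i else 0) ({..<r} \<rightarrow>\<^sub>E {..<M}) A"
      by (rule bij_betwI[where g = "\<lambda>a. restrict a {..<r}"])
        (auto simp: A_def fun_eq_iff PiE_def extensional_def Pi_def restrict_def)
    then show ?thesis using bij_betw_same_card card_PiE[of "{..<r}" "\<lambda>_. {..<M}"] by fastforce
  qed
  define B where "B = {b :: 'v \<Rightarrow>\<^sub>0 nat. keys b \<subseteq> T \<and> (\<forall>v. lookup b v \<le> N)}"
  have B: "finite B" "card B \<le> (N + 1) ^ d"
  proof -
    have inj: "inj_on (\<lambda>b. restrict (lookup b) T) B"
    proof (rule inj_onI)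
      fix b b' assume *: "b \<in> B" "b' \<in> B" "restrict (lookup b) T = restrict (lookup b') T"
      show "b = b'"
      proof (rule poly_mapping_eqI)
        fix v
        show "lookup b v = lookup b' v"
        proof (cases "v \<in> T")
          case True
          then show ?thesis using fun_cong[OF *(3), of v] by simp
        next
          case False
          then have "v \<notin> keys b" "v \<notin> keys b'" using * by (auto simp: B_def)
          then show ?thesis by (simp add: in_keys_iff)
        qed
      qed
    qed
    have sub: "(\<lambda>b. restrict (lookup b) T) ` B \<subseteq> (T \<rightarrow>\<^sub>E {..N})" by (auto simp: B_def)
    have fin: "finite (T \<rightarrow>\<^sub>E {..N})" using assms(1) by (intro finite_PiE) auto
    show "finite B" using inj sub fin by (meson finite_imageD finite_subset)
    show "card B \<le> (N + 1) ^ d"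
      using card_inj_on_le[OF inj sub fin] assms(1) by (simp add: card_PiE d_def)
  qed
  have "(N + 1) ^ d \<le> ((r * D + 1) * M) ^ d"
    by (intro power_mono) (auto simp: N_def M_def algebra_simps)
  also have "\<dots> = (r * D + 1) ^ d * M ^ d" by (rule power_mult_distrib)
  also have "\<dots> < M * M ^ d" by (intro mult_strict_right_mono) (auto simp: M_def)
  also have "\<dots> \<le> M ^ r"
    using assms(3) power_increasing[of "Suc d" r M] by (simp add: d_def M_def)
  finally have less: "card B < card A" using B(2) cardA by linarith
  have keysB: "keys (mono_eval r f a) \<subseteq> B" if "a \<in> A" for a
  proof
    fix b assume b: "b \<in> keys (mono_eval r f a)"
    have "mono_eval r f a \<in> polys T" using polys.mono_eval_S assms(2) by blast
    then have "keys b \<subseteq> T" using b by (auto simp: polys_def)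
    moreover have "lookup b v \<le> N" for v unfolding N_def
      by (rule lookup_mono_eval_le[OF D _ b]) (use that in \<open>auto simp: A_def less_imp_le\<close>)
    ultimately show "b \<in> B" by (simp add: B_def)
  qed
  have "\<exists>c. (\<exists>a\<in>A. c a \<noteq> 0) \<and> (\<forall>b. (\<Sum>a\<in>A. c a * lookup (mono_eval r f a) b) = 0)"
    by (rule linear_dependence[OF finA B(1) less]) (rule keysB)
  then obtain c where c: "\<exists>a\<in>A. c a \<noteq> 0" "\<forall>b. (\<Sum>a\<in>A. c a * lookup (mono_eval r f a) b) = 0"
    by (elim exE conjE)
  note scal = lookup_scalar_mult
  have "(\<Sum>a\<in>A. Poly_Mapping.single 0 (c a) * mono_eval r f a) = 0"
    by (rule poly_mapping_eqI) (use c(2) in \<open>simp add: lookup_sum scal\<close>)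
  then show ?thesis using finA c(1) by (intro exI[of _ A] exI[of _ c]) (auto simp: A_def)
qed


section \<open>Cohen--Macaulay graphs are well covered\<close>

definition cube :: "'v set \<Rightarrow> 'b \<Rightarrow> ('v \<Rightarrow>\<^sub>0 'b::comm_monoid_add)" where
  "cube A k = (\<Sum>v\<in>A. Poly_Mapping.single v k)"

lemma lookup_cube: "finite A \<Longrightarrow> lookup (cube A k) v = (if v \<in> A then k else 0)"
  unfolding cube_def by (auto simp: lookup_sum lookup_single when_def)

lemma cube_add: "cube A (k + l) = cube A k + cube A l"
  unfolding cube_def by (simp add: single_add sum.distrib)

lemma keys_cube: "finite A \<Longrightarrow> k \<noteq> 0 \<Longrightarrow> keys (cube A k) = A"
  by (auto simp: in_keys_iff lookup_cube split: if_splits)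

context finite_simple_graph
begin

text \<open>The Stanley--Reisner ideal of the complex of stable sets. It equals the edge ideal
  (\<open>edge_ideal_eq\<close>), but membership can be read off the supports of the terms.\<close>

definition nonstable_polys :: "('v, 'k::field) mpoly set" where
  "nonstable_polys = {f \<in> polys V. \<forall>a\<in>keys f. \<not> stable_set V E (keys a)}"

lemma stable_subset: "stable_set V E T \<Longrightarrow> U \<subseteq> T \<Longrightarrow> stable_set V E U"
  unfolding stable_set_def by blast

lemma stable_finite: "stable_set V E T \<Longrightarrow> finite T"
  unfolding stable_set_def using finite_vertices finite_subset by blast

lemma nonstable_polys_ideal_in: "polys.ideal_in V (nonstable_polys :: ('v, 'k::field) mpoly set)"
  unfolding polys.ideal_in_def
proof (intro conjI ballI)
  show "(nonstable_polys :: ('v, 'k) mpoly set) \<subseteq> polys V" by (auto simp: nonstable_polys_def)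
  show "(0 :: ('v, 'k) mpoly) \<in> nonstable_polys" by (auto simp: nonstable_polys_def polys.S_zero)
next
  fix x y :: "('v, 'k) mpoly" assume "x \<in> nonstable_polys" "y \<in> nonstable_polys"
  then show "x + y \<in> nonstable_polys"
    using keys_add[of x y] by (auto simp: nonstable_polys_def intro: polys.S_add)
next
  fix s x :: "('v, 'k) mpoly" assume s: "s \<in> polys V" and x: "x \<in> nonstable_polys"
  then have "s * x \<in> polys V" by (auto simp: nonstable_polys_def intro: polys.S_mult)
  moreover have "\<not> stable_set V E (keys c)" if c: "c \<in> keys (s * x)" for c
  proof -
    obtain a b where "a \<in> keys s" "b \<in> keys x" "c = a + b" using c by (rule keys_mult_cases)
    then show ?thesis using x stable_subset[of "keys c" "keys b"]
      by (auto simp: nonstable_polys_def keys_add_nat)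
  qed
  ultimately show "s * x \<in> nonstable_polys" by (simp add: nonstable_polys_def)
qed

end

lemma ideal_iff_ideal_in:
  fixes K :: "('v, 'k::field) mpoly set"
  shows "ideal K (mpoly_ring V) \<longleftrightarrow> polys.ideal_in V K"
proof
  assume "ideal K (mpoly_ring V)"
  then interpret ideal K "mpoly_ring V" .
  show "polys.ideal_in V K" unfolding polys.ideal_in_def
    using a_subset additive_subgroup.zero_closed[OF additive_subgroup_axioms]
      additive_subgroup.a_closed[OF additive_subgroup_axioms] I_l_closed by auto
next
  assume K: "polys.ideal_in V K"
  interpret cring "mpoly_ring V :: ('v, 'k) mpoly ring" by (rule cring_mpoly_ring)
  note D = polys.ideal_inD[OF K]
  show "ideal K (mpoly_ring V)"
  proof (rule idealI)
    show "ring (mpoly_ring V :: ('v, 'k) mpoly ring)" by (rule ring_axioms)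
    show "subgroup K (add_monoid (mpoly_ring V))"
    proof (rule add.subgroupI)
      show "K \<subseteq> carrier (mpoly_ring V)" using D(1) by simp
      show "K \<noteq> {}" using D(2) by blast
      show "a \<oplus>\<^bsub>mpoly_ring V\<^esub> b \<in> K" if "a \<in> K" "b \<in> K" for a b using D(3) that by simp
      show "\<ominus>\<^bsub>mpoly_ring V\<^esub> a \<in> K" if "a \<in> K" for a
      proof -
        have "\<ominus>\<^bsub>mpoly_ring V\<^esub> a = - a"
          using minus_equality[of "- a" a] D(1) that polys.S_uminus[of a V] by auto
        then show ?thesis using D(5) that by simp
      qed
    qed
    show "x \<otimes>\<^bsub>mpoly_ring V\<^esub> a \<in> K" "a \<otimes>\<^bsub>mpoly_ring V\<^esub> x \<in> K"
      if "a \<in> K" "x \<in> carrier (mpoly_ring V)" for a x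
      using D(4)[of x a] that by (simp_all add: Groups.mult.commute)
  qed
qed

context finite_simple_graph
begin

lemma nonstable_monomial_factor:
  assumes "\<not> stable_set V E (keys a)" "keys a \<subseteq> V"
  obtains x y b where "{x, y} \<in> E" "a = b + (Poly_Mapping.single x 1 + Poly_Mapping.single y (1::nat))"
    "keys b \<subseteq> V"
proof -
  obtain x y where xy: "{x, y} \<in> E" "x \<in> keys a" "y \<in> keys a"
    using assms unfolding stable_set_def by blast
  have "x \<noteq> y" using edge_vertices[OF xy(1)] by blast
  define b where "b = a - (Poly_Mapping.single x 1 + Poly_Mapping.single y (1::nat))"
  have "a = b + (Poly_Mapping.single x 1 + Poly_Mapping.single y 1)"
    using xy(2,3) \<open>x \<noteq> y\<close>
    by (intro poly_mapping_eqI) (auto simp: b_def lookup_add lookup_minus lookup_single when_def in_keys_iff)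
  moreover from this have "keys b \<subseteq> V" using assms(2) keys_add_nat[of b] by (metis Un_subset_iff)
  ultimately show thesis using that xy(1) by blast
qed

theorem edge_ideal_eq: "(edge_ideal V E :: ('v, 'k::field) mpoly set) = nonstable_polys"
proof
  interpret cring "mpoly_ring V :: ('v, 'k) mpoly ring" by (rule cring_mpoly_ring)
  let ?G = "{variable u * variable v | u v. {u, v} \<in> E} :: ('v, 'k) mpoly set"
  have var: "variable u * variable v =
      (Poly_Mapping.single (Poly_Mapping.single u 1 + Poly_Mapping.single v 1) 1 :: ('v, 'k) mpoly)" for u v
    unfolding variable_def by (simp add: mult_single)
  have edge: "\<not> stable_set V E (keys (Poly_Mapping.single u 1 + Poly_Mapping.single v (1::nat)))"
    "keys (Poly_Mapping.single u 1 + Poly_Mapping.single v (1::nat)) \<subseteq> V" if "{u, v} \<in> E" for u v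
    using edge_vertices[OF that] that unfolding keys_add_nat by (auto simp: stable_set_def)
  have "?G \<subseteq> nonstable_polys"
    unfolding var nonstable_polys_def using edge by (auto simp: single_in_polys)
  note GN = this
  then have G: "?G \<subseteq> carrier (mpoly_ring V)" by (auto simp: nonstable_polys_def)
  have "ideal nonstable_polys (mpoly_ring V :: ('v, 'k) mpoly ring)"
    unfolding ideal_iff_ideal_in by (rule nonstable_polys_ideal_in)
  then show "edge_ideal V E \<subseteq> (nonstable_polys :: ('v, 'k) mpoly set)"
    unfolding edge_ideal_def using GN by (rule genideal_minimal)
  have I: "polys.ideal_in V (edge_ideal V E :: ('v, 'k) mpoly set)"
    unfolding edge_ideal_def ideal_iff_ideal_in[symmetric] using G by (rule genideal_ideal)
  show "nonstable_polys \<subseteq> (edge_ideal V E :: ('v, 'k) mpoly set)"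
  proof
    fix f :: "('v, 'k) mpoly" assume f: "f \<in> nonstable_polys"
    have "Poly_Mapping.single a c \<in> edge_ideal V E" if "a \<in> keys f" for a and c :: 'k
    proof -
      have "\<not> stable_set V E (keys a)" "keys a \<subseteq> V"
        using f that by (auto simp: nonstable_polys_def polys_def)
      then obtain x y b where b: "{x, y} \<in> E" "keys b \<subseteq> V"
        "a = b + (Poly_Mapping.single x 1 + Poly_Mapping.single y (1::nat))"
        by (rule nonstable_monomial_factor)
      have "variable x * variable y \<in> (edge_ideal V E :: ('v, 'k) mpoly set)"
        unfolding edge_ideal_def using genideal_self[OF G] b(1) by blast
      from polys.ideal_inD(4)[OF I single_in_polys[OF b(2), of c] this]
      show ?thesis unfolding var b(3) by (simp add: mult_single)
    qed
    then show "f \<in> edge_ideal V E"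
      by (subst poly_mapping_eq_sum_single) (rule polys.ideal_in_sum[OF I])
  qed
qed

text \<open>Let \<open>u\<close> be the product of the variables in \<open>T\<close>. All other variables annihilate it, so \<open>u\<close>
  is annihilated by an algebraic relation, over the field, among the restrictions of the \<open>f i\<close>
  to \<open>T\<close>. Such a relation exists if there are more than \<open>card T\<close> of them; then \<open>u\<close> lies in every
  power of the ideal they generate, which is impossible by its degree.\<close>

theorem regular_mod_length_le:
  fixes f :: "nat \<Rightarrow> ('v, 'k::field) mpoly"
  assumes T: "maximal_stable V E T"
    and f: "\<forall>i. f i \<in> polys V" "\<And>i. lookup (f i) 0 = 0"
    and reg: "polys.regular_mod V nonstable_polys f r"
  shows "r \<le> card T"
proof (rule ccontr)
  assume "\<not> r \<le> card T"
  then have less: "card T < r" by simp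
  have st: "stable_set V E T" using T by (simp add: maximal_stable_def)
  then have finT: "finite T" and TV: "T \<subseteq> V" using stable_finite by (auto simp: stable_set_def)
  define u :: "('v, 'k) mpoly" where "u = Poly_Mapping.single (cube T (1::nat)) 1"
  have uV: "u \<in> polys V" unfolding u_def using TV
    by (intro single_in_polys) (simp add: keys_cube finT)
  obtain A c where A: "finite A" "\<And>a i. a \<in> A \<Longrightarrow> r \<le> i \<Longrightarrow> a i = 0" "\<exists>a\<in>A. c a \<noteq> 0"
    "(\<Sum>a\<in>A. Poly_Mapping.single 0 (c a) * mono_eval r (\<lambda>i. restrict_poly T (f i)) a) = 0"
    using algebraic_relation[OF finT restrict_poly_in_polys less, of f] by blast
  define d :: "(nat \<Rightarrow> nat) \<Rightarrow> ('v, 'k) mpoly" where "d a = Poly_Mapping.single 0 (c a)" for a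
  define p where "p = (\<Sum>a\<in>A. d a * mono_eval r f a)"
  have dV: "d a \<in> polys V" for a unfolding d_def by (simp add: single_in_polys)
  have pV: "p \<in> polys V" unfolding p_def
    by (intro polys.S_sum polys.S_mult dV polys.mono_eval_S f)
  have "restrict_poly T p = 0"
    unfolding p_def restrict_poly_sum restrict_poly_mult restrict_poly_mono_eval d_def
    using A(4) by (simp add: restrict_poly_single)
  have "p * u \<in> nonstable_polys"
    unfolding nonstable_polys_def
  proof (intro CollectI conjI ballI polys.S_mult pV uV)
    fix e assume "e \<in> keys (p * u)"
    then obtain a where a: "a \<in> keys p" "e = a + cube T 1"
      unfolding u_def by (auto elim!: keys_mult_cases)
    have "\<not> keys a \<subseteq> T"
    proof
      assume "keys a \<subseteq> T"
      then have "lookup p a = lookup (restrict_poly T p) a" by (simp add: lookup_restrict_poly)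
      then show False using \<open>restrict_poly T p = 0\<close> a(1) by (simp add: in_keys_iff)
    qed
    moreover have "keys e = keys a \<union> T" unfolding a(2) keys_add_nat
      by (simp add: keys_cube finT)
    ultimately show "\<not> stable_set V E (keys e)"
      using T unfolding maximal_stable_def by blast
  qed
  then have pu: "(\<Sum>a\<in>A. d a * mono_eval r f a) * u \<in> nonstable_polys" by (simp add: p_def)
  have dunit: "\<exists>y\<in>polys V. y * d a = 1" if "d a \<noteq> 0" for a
  proof -
    have "c a \<noteq> 0" using that by (auto simp: d_def)
    then have "Poly_Mapping.single 0 (inverse (c a)) * d a = 1"
      by (simp add: d_def mult_single)
    then show ?thesis by (intro bexI[of _ "Poly_Mapping.single 0 (inverse (c a))"]) (simp_all add: single_in_polys)
  qed
  have nz: "\<exists>a\<in>A. d a \<noteq> 0" using A(3) by (auto simp: d_def) (metis lookup_single_eq lookup_zero)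
  note K = nonstable_polys_ideal_in[where 'k = 'k]
  have "u \<in> polys.forms nonstable_polys f r (Suc (card T)) (polys V)"
    by (rule polys.regular_no_relation[where d = d, OF K f(1) reg A(1) _ _ _ nz uV pu])
      (use A(2) dV dunit in blast)+
  \<comment> \<open>A term of an element of \<open>K + J^n\<close> has degree at least \<open>n\<close> or nonstable support, but \<open>u\<close> has
    degree \<open>card T\<close> and stable support.\<close>
  moreover have "polys.forms nonstable_polys f r n (polys V) \<subseteq>
      {g\<in>polys V. \<forall>a\<in>keys g. stable_set V E (keys a) \<longrightarrow> n \<le> monomial_degree a}" (is "_ \<subseteq> ?L n") for n
  proof (rule polys.forms_least)
    have deg_add: "monomial_degree (a + b) = monomial_degree a + monomial_degree b" for a b :: "'v \<Rightarrow>\<^sub>0 nat"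
    proof -
      have "(\<Sum>v\<in>keys a \<union> keys b. lookup a v) = monomial_degree a"
        "(\<Sum>v\<in>keys a \<union> keys b. lookup b v) = monomial_degree b"
        unfolding monomial_degree_def by (intro sum.mono_neutral_right; simp add: in_keys_iff)+
      then show ?thesis by (simp add: monomial_degree_def keys_add_nat lookup_add sum.distrib)
    qed
    have Lmult: "g * h \<in> ?L (m + n)" if "g \<in> ?L m" "h \<in> ?L n" for g h :: "('v, 'k) mpoly" and m n
    proof -
      have "m + n \<le> monomial_degree a" if a: "a \<in> keys (g * h)" "stable_set V E (keys a)" for a
      proof -
        obtain b b' where b: "b \<in> keys g" "b' \<in> keys h" "a = b + b'"
          using a(1) by (rule keys_mult_cases)
        then have "stable_set V E (keys b)" "stable_set V E (keys b')"
          using a(2) stable_subset by (auto simp: keys_add_nat)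
        then show ?thesis using b \<open>g \<in> ?L m\<close> \<open>h \<in> ?L n\<close> by (auto simp: deg_add intro!: add_mono)
      qed
      then show ?thesis using that by (auto intro: polys.S_mult)
    qed
    show "polys.ideal_in V (?L n)" unfolding polys.ideal_in_def
    proof (intro conjI ballI)
      show "0 \<in> ?L n" by (simp add: polys.S_zero)
      show "x + y \<in> ?L n" if "x \<in> ?L n" "y \<in> ?L n" for x y :: "('v, 'k) mpoly"
        using that keys_add[of x y] by (auto intro: polys.S_add)
      show "s * x \<in> ?L n" if "s \<in> polys V" "x \<in> ?L n" for s x :: "('v, 'k) mpoly"
        using Lmult[of s 0 x n] that by simp
    qed auto
    show "nonstable_polys \<subseteq> ?L n" by (auto simp: nonstable_polys_def)
    fix g :: "('v, 'k) mpoly" and b assume g: "g \<in> polys V" and b: "b \<in> exponents r n"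
    have fL: "f i \<in> ?L 1" for i
    proof -
      have "1 \<le> monomial_degree a" if "a \<in> keys (f i)" for a
      proof -
        have "a \<noteq> 0" using that f(2)[of i] by (auto simp: in_keys_iff)
        then obtain v where "v \<in> keys a" by (metis all_not_in_conv keys_eq_empty)
        then have "lookup a v \<le> monomial_degree a" "lookup a v \<noteq> 0"
          unfolding monomial_degree_def by (auto simp: in_keys_iff intro!: member_le_sum)
        then show ?thesis by simp
      qed
      then show ?thesis using f(1) by simp
    qed
    have "1 \<in> ?L 0" by (simp add: polys.S_one)
    have pow: "f i ^ k \<in> ?L k" for i k
      by (induction k) (use \<open>1 \<in> ?L 0\<close> Lmult[of "f i" 1 "f i ^ k" k for k] fL in auto)
    have "(\<Prod>i<s. f i ^ b i) \<in> ?L (\<Sum>i<s. b i)" for s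
    proof (induction s)
      case (Suc s)
      show ?case using Lmult[OF Suc pow[of s "b s"]] unfolding prod.lessThan_Suc sum.lessThan_Suc .
    qed (use \<open>1 \<in> ?L 0\<close> in simp)
    from Lmult[OF _ this[of r], of g 0] g b show "g * mono_eval r f b \<in> ?L n"
      by (simp add: mono_eval_def exponents_def)
  qed
  ultimately have "u \<in> ?L (Suc (card T))" by blast
  moreover have "monomial_degree (cube T 1) = card T"
    unfolding monomial_degree_def keys_cube[OF finT one_neq_zero]
    by (simp add: lookup_cube finT)
  ultimately show False using st by (simp add: u_def keys_cube finT)
qed

end

subsection \<open>The two sides of the Cohen--Macaulay condition at the origin\<close>

locale stanley_reisner = finite_simple_graph V E for V :: "'v::linorder set" and E +
  fixes field_type :: "'k::field itself"
begin

abbreviation R :: "('v, 'k) mpoly ring" where "R \<equiv> mpoly_ring V"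
abbreviation I :: "('v, 'k) mpoly set" where "I \<equiv> nonstable_polys"
abbreviation Q :: "('v, 'k) mpoly set ring" where "Q \<equiv> R Quot I"
abbreviation proj :: "('v, 'k) mpoly \<Rightarrow> ('v, 'k) mpoly set" where "proj f \<equiv> I +>\<^bsub>R\<^esub> f"

sublocale R: cring R by (rule cring_mpoly_ring)

sublocale I: ideal I R unfolding ideal_iff_ideal_in by (rule nonstable_polys_ideal_in)

sublocale Q: cring Q by (rule I.quotient_is_cring) (rule R.is_cring)

lemma proj_eq_iff:
  assumes "f \<in> polys V" "g \<in> polys V"
  shows "proj f = proj g \<longleftrightarrow> f - g \<in> I"
proof -
  have mem: "x \<in> proj h \<longleftrightarrow> x - h \<in> I" for x h
  proof
    assume "x - h \<in> I"
    moreover have "x = (x - h) + h" by simp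
    ultimately show "x \<in> proj h" unfolding a_r_coset_def' by (auto intro: bexI[of _ "x - h"])
  qed (auto simp: a_r_coset_def')
  have 1: "proj f = proj g \<longleftrightarrow> (\<forall>x. x - f \<in> I \<longleftrightarrow> x - g \<in> I)"
    unfolding set_eq_iff mem ..
  note K = polys.ideal_inD[OF nonstable_polys_ideal_in[where 'k = 'k]]
  show ?thesis
  proof
    assume "proj f = proj g"
    then have "f - f \<in> I \<longleftrightarrow> f - g \<in> I" using 1 by blast
    then show "f - g \<in> I" using K(2) by simp
  next
    assume fg: "f - g \<in> I"
    have "x - f \<in> I \<longleftrightarrow> x - g \<in> I" for x
      using K(3)[OF _ fg, of "x - f"] K(6)[OF _ fg, of "x - g"] by auto
    then show "proj f = proj g" using 1 by blast
  qed
qed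

lemma carrier_Q: "carrier Q = proj ` polys V"
  by (auto simp: FactRing_def A_RCOSETS_def')

lemma proj_closed: "f \<in> polys V \<Longrightarrow> proj f \<in> carrier Q"
  using carrier_Q by blast

lemma proj_mult: "f \<in> polys V \<Longrightarrow> g \<in> polys V \<Longrightarrow> proj f \<otimes>\<^bsub>Q\<^esub> proj g = proj (f * g)"
  using I.rcoset_mult_add[of f g] by (simp add: FactRing_def)

lemma proj_image_mem:
  assumes "polys.ideal_in V L" "I \<subseteq> L" "f \<in> polys V"
  shows "proj f \<in> proj ` L \<longleftrightarrow> f \<in> L"
proof
  note L = polys.ideal_inD[OF assms(1)]
  assume "proj f \<in> proj ` L"
  then obtain g where g: "g \<in> L" "proj f = proj g" by blast
  then have "f - g \<in> L" using proj_eq_iff[OF assms(3), of g] L(1) assms(2) by blast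
  then show "f \<in> L" using L(3)[of "f - g" g] g(1) by simp
qed blast

lemma ideal_proj_image:
  assumes "polys.ideal_in V L"
  shows "ideal (proj ` L) Q"
  using R.ring_ideal_imp_quot_ideal[OF I.is_ideal] assms by (simp add: ideal_iff_ideal_in)

text \<open>This translates regular sequences of the quotient ring into sequences of polynomials that
  are regular modulo \<open>I\<close>.\<close>

lemma genideal_proj:
  assumes f: "\<forall>i. f i \<in> polys V" and g: "g \<in> polys V"
  shows "proj g \<in> genideal Q ((\<lambda>i. proj (f i)) ` {..<n}) \<longleftrightarrow> g \<in> polys.generated V I f n"
proof -
  note II = nonstable_polys_ideal_in[where 'k = 'k]
  have L: "polys.ideal_in V (polys.generated V I f n)" by (rule polys.generated_ideal[OF II f])
  let ?G = "(\<lambda>i. proj (f i)) ` {..<n}"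
  have G: "?G \<subseteq> carrier Q" using f proj_closed by blast
  interpret J: ideal "genideal Q ?G" Q by (rule Q.genideal_ideal[OF G])
  have "?G \<subseteq> proj ` polys.generated V I f n"
    using polys.generated_gen[OF II polys.S_one, of _ n f] by force
  then have 1: "genideal Q ?G \<subseteq> proj ` polys.generated V I f n"
    by (rule Q.genideal_minimal[OF ideal_proj_image[OF L]])
  \<comment> \<open>The preimage of the generated ideal is an ideal that contains the generators.\<close>
  define P where "P = {h\<in>polys V. proj h \<in> genideal Q ?G}"
  have "ideal P R"
  proof -
    have "ideal {r \<in> carrier R. proj r \<in> genideal Q ?G} R"
      by (rule ring_hom_ring.ideal_vimage[OF I.rcos_ring_hom_ring J.is_ideal])
    then show ?thesis by (simp add: P_def)
  qed
  moreover have "I \<subseteq> P"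
  proof
    fix h assume h: "h \<in> I"
    then have "proj h = proj 0"
      using proj_eq_iff[of h 0] polys.ideal_inD(1)[OF II] polys.S_zero by auto
    also have "\<dots> = \<zero>\<^bsub>Q\<^esub>" using ring_hom_zero[OF I.rcos_ring_hom R.ring_axioms Q.ring_axioms] by simp
    finally show "h \<in> P" unfolding P_def using h polys.ideal_inD(1)[OF II] J.zero_closed by auto
  qed
  moreover have "f i \<in> P" if "i < n" for i
    unfolding P_def using f Q.genideal_self[OF G] that by blast
  ultimately have "polys.generated V I f n \<subseteq> P"
    by (intro polys.generated_least) (auto simp: ideal_iff_ideal_in)
  then show ?thesis
    using 1 proj_image_mem[OF L polys.generated_base g] unfolding P_def by blast
qed

text \<open>The prime generated by the variables outside \<open>T\<close>, as the kernel of setting them to zero.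
  For \<open>T = {}\<close> it is the maximal ideal of the origin.\<close>

definition monomial_prime :: "'v set \<Rightarrow> ('v, 'k) mpoly set" where
  "monomial_prime T = {f \<in> polys V. restrict_poly T f = 0}"

lemma monomial_prime_ideal_in: "polys.ideal_in V (monomial_prime T)"
  unfolding polys.ideal_in_def monomial_prime_def
  by (auto intro: polys.S_zero polys.S_add polys.S_mult
      simp: restrict_poly_add restrict_poly_mult restrict_poly_def[of T 0])

lemma monomial_prime_above:
  assumes "stable_set V E T"
  shows "I \<subseteq> monomial_prime T"
proof
  fix f assume f: "f \<in> I"
  have "restrict_poly T f = 0"
  proof (rule poly_mapping_eqI)
    fix a
    have "a \<notin> keys f" if "keys a \<subseteq> T"
      using f stable_subset[OF assms that] by (auto simp: nonstable_polys_def)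
    then show "lookup (restrict_poly T f) a = lookup 0 a"
      by (auto simp: lookup_restrict_poly when_def in_keys_iff)
  qed
  then show "f \<in> monomial_prime T" using f by (simp add: monomial_prime_def nonstable_polys_def)
qed

lemma primeideal_monomial_prime:
  assumes "stable_set V E T"
  shows "primeideal (proj ` monomial_prime T) Q"
proof (rule primeidealI[OF ideal_proj_image[OF monomial_prime_ideal_in] Q.is_cring])
  note mem = proj_image_mem[OF monomial_prime_ideal_in monomial_prime_above[OF assms]]
  have "1 \<notin> monomial_prime T" by (simp add: monomial_prime_def restrict_poly_1)
  then show "carrier Q \<noteq> proj ` monomial_prime T"
    using mem[of 1] proj_closed[of 1] polys.S_one by blast
  fix a b assume "a \<in> carrier Q" "b \<in> carrier Q" and ab: "a \<otimes>\<^bsub>Q\<^esub> b \<in> proj ` monomial_prime T"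
  then obtain f g where fg: "f \<in> polys V" "g \<in> polys V" "a = proj f" "b = proj g"
    unfolding carrier_Q by blast
  then have "f * g \<in> monomial_prime T" using ab mem[of "f * g"] polys.S_mult proj_mult by metis
  then have "restrict_poly T f * restrict_poly T g = 0"
    by (simp add: monomial_prime_def restrict_poly_mult)
  then have "f \<in> monomial_prime T \<or> g \<in> monomial_prime T"
    using fg by (auto simp: monomial_prime_def)
  then show "a \<in> proj ` monomial_prime T \<or> b \<in> proj ` monomial_prime T" using fg by blast
qed

lemma stable_empty: "stable_set V E {}"
  by (simp add: stable_set_def)

lemma restrict_poly_empty: "restrict_poly {} f = Poly_Mapping.single 0 (lookup f 0)"
  by (rule poly_mapping_eqI) (auto simp: lookup_restrict_poly lookup_single when_def)

lemma maximalideal_origin: "maximalideal (proj ` monomial_prime {}) Q"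
proof (rule maximalidealI)
  show "ideal (proj ` monomial_prime {}) Q" by (rule ideal_proj_image[OF monomial_prime_ideal_in])
  show "carrier Q \<noteq> proj ` monomial_prime {}"
    using primeideal.I_notcarr[OF primeideal_monomial_prime[OF stable_empty]] .
  fix J assume J: "ideal J Q" "proj ` monomial_prime {} \<subseteq> J" "J \<subseteq> carrier Q"
  interpret J: ideal J Q by fact
  show "J = proj ` monomial_prime {} \<or> J = carrier Q"
  proof (cases "J \<subseteq> proj ` monomial_prime {}")
    case False
    then obtain f where f: "f \<in> polys V" "proj f \<in> J" "f \<notin> monomial_prime {}"
      using J(3) unfolding carrier_Q by blast
    define c where "c = lookup f 0"
    have "c \<noteq> 0" using f unfolding c_def by (auto simp: monomial_prime_def restrict_poly_empty)
    define s :: "('v, 'k) mpoly" where "s = Poly_Mapping.single 0 (inverse c)"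
    have sV: "s \<in> polys V" unfolding s_def by (simp add: single_in_polys)
    have "restrict_poly {} (1 - s * f) = 0"
      using \<open>c \<noteq> 0\<close> unfolding restrict_poly_diff restrict_poly_mult restrict_poly_1
      by (simp add: restrict_poly_empty s_def c_def mult_single)
    then have "1 - s * f \<in> monomial_prime {}"
      using f sV by (simp add: monomial_prime_def polys.S_diff polys.S_mult polys.S_one)
    then have "proj (1 - s * f) \<in> J" using J(2) by blast
    moreover have "proj (s * f) \<in> J"
      using J.I_l_closed[OF f(2) proj_closed[OF sV]] by (simp add: proj_mult sV f(1))
    ultimately have "proj (1 - s * f) \<oplus>\<^bsub>Q\<^esub> proj (s * f) \<in> J" by (rule J.a_closed)
    moreover have "proj (1 - s * f) \<oplus>\<^bsub>Q\<^esub> proj (s * f) = proj ((1 - s * f) + s * f)"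
      using ring_hom_add[OF I.rcos_ring_hom, of "1 - s * f" "s * f"] f sV
      by (simp add: polys.S_diff polys.S_mult polys.S_one)
    ultimately have "proj 1 \<in> J" by simp
    then have "\<one>\<^bsub>Q\<^esub> \<in> J" using ring_hom_one[OF I.rcos_ring_hom] by simp
    then show ?thesis using J.one_imp_carrier by blast
  qed (use J(2) in blast)
qed

text \<open>Removing the elements of \<open>T\<close> one after the other gives an ascending chain of monomial primes
  that ends at the origin.\<close>

theorem height_origin_ge:
  assumes T: "stable_set V E T"
  shows "enat (card T) \<le> prime_height Q (proj ` monomial_prime {})"
proof -
  have finT: "finite T" using stable_finite[OF T] .
  then obtain xs where xs: "set xs = T" "distinct xs" using finite_distinct_list by blast
  define n where "n = length xs"
  have n: "n = card T" using xs distinct_card n_def by metis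
  define U where "U i = set (drop i xs)" for i
  have st: "stable_set V E (U i)" for i
    using stable_subset[OF T, of "U i"] xs(1) set_drop_subset unfolding U_def by fast
  let ?P = "\<lambda>i. proj ` monomial_prime (U i)"
  have "\<forall>i\<le>n. primeideal (?P i) Q" using primeideal_monomial_prime[OF st] by blast
  moreover have "\<forall>i<n. ?P i \<subset> ?P (Suc i)"
  proof (intro allI impI)
    fix i assume i: "i < n"
    let ?x = "xs ! i"
    have dr: "drop i xs = ?x # drop (Suc i) xs" using i n_def by (simp add: Cons_nth_drop_Suc)
    have x: "?x \<in> U i" "?x \<notin> U (Suc i)" "U (Suc i) \<subseteq> U i"
      using dr distinct_drop[OF xs(2), of i] unfolding U_def by auto
    have "monomial_prime (U i) \<subseteq> monomial_prime (U (Suc i))"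
    proof
      fix f assume f: "f \<in> monomial_prime (U i)"
      have "restrict_poly (U (Suc i)) f = 0"
      proof (rule poly_mapping_eqI)
        fix a
        have "lookup (restrict_poly (U i) f) a = 0" using f by (simp add: monomial_prime_def)
        then show "lookup (restrict_poly (U (Suc i)) f) a = lookup 0 a"
          using x(3) by (auto simp: lookup_restrict_poly when_def split: if_splits)
      qed
      then show "f \<in> monomial_prime (U (Suc i))" using f by (simp add: monomial_prime_def)
    qed
    moreover have "proj (variable ?x) \<notin> ?P i" "proj (variable ?x) \<in> ?P (Suc i)"
    proof -
      have "?x \<in> V" using T x(1) xs(1) set_drop_subset unfolding U_def stable_set_def by fast
      then have vV: "(variable ?x :: ('v, 'k) mpoly) \<in> polys V"
        unfolding variable_def by (simp add: single_in_polys)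
      have "restrict_poly (U i) (variable ?x :: ('v, 'k) mpoly) = variable ?x"
        unfolding variable_def using x(1) by (simp add: restrict_poly_single)
      moreover have "(variable ?x :: ('v, 'k) mpoly) \<noteq> 0"
        unfolding variable_def by (metis lookup_single_eq lookup_zero zero_neq_one)
      ultimately have "variable ?x \<notin> monomial_prime (U i)" by (simp add: monomial_prime_def)
      then show "proj (variable ?x) \<notin> ?P i"
        using proj_image_mem[OF monomial_prime_ideal_in monomial_prime_above[OF st] vV] by blast
      have "restrict_poly (U (Suc i)) (variable ?x :: ('v, 'k) mpoly) = 0"
        unfolding variable_def using x(2)
        by (intro poly_mapping_eqI) (auto simp: lookup_restrict_poly lookup_single when_def)
      then show "proj (variable ?x) \<in> ?P (Suc i)" using vV by (simp add: monomial_prime_def)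
    qed
    ultimately show "?P i \<subset> ?P (Suc i)" by blast
  qed
  moreover have "?P n = proj ` monomial_prime {}" by (simp add: U_def n_def)
  ultimately show ?thesis unfolding prime_height_def n[symmetric]
    by (intro SUP_upper CollectI exI[of _ ?P]) blast
qed

theorem depth_origin_le:
  assumes T: "maximal_stable V E T"
  shows "ideal_depth Q (proj ` monomial_prime {}) \<le> enat (card T)"
  unfolding ideal_depth_def
proof (rule SUP_least)
  fix xs assume "xs \<in> {xs. regular_sequence Q xs \<and> set xs \<subseteq> proj ` monomial_prime {}}"
  then have reg: "regular_sequence Q xs" and sub: "set xs \<subseteq> proj ` monomial_prime {}" by auto
  define r where "r = length xs"
  have "\<exists>g\<in>monomial_prime {}. xs ! i = proj g" if "i < r" for i
    using sub nth_mem[of i xs] that unfolding r_def by blast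
  then obtain g where g: "\<And>i. i < r \<Longrightarrow> g i \<in> monomial_prime {} \<and> xs ! i = proj (g i)" by metis
  define f where "f i = (if i < r then g i else 0)" for i
  have f: "f i \<in> polys V" "lookup (f i) 0 = 0" for i
  proof -
    have "f i \<in> monomial_prime {}"
      using g polys.ideal_inD(2)[OF monomial_prime_ideal_in] by (simp add: f_def)
    then show "f i \<in> polys V" "lookup (f i) 0 = 0"
      by (auto simp: monomial_prime_def restrict_poly_empty)
        (metis lookup_single_eq lookup_zero)
  qed
  have takes: "set (take i xs) = (\<lambda>i. proj (f i)) ` {..<i}" if "i \<le> r" for i
    using that g unfolding nth_image[symmetric, OF that[unfolded r_def]] f_def r_def by (intro image_cong) auto
  have "polys.regular_mod V I f r"
    unfolding polys.regular_mod_def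
  proof (intro allI impI ballI)
    fix i x assume i: "i < r" and x: "x \<in> polys V" "f i * x \<in> polys.generated V I f i"
    have "xs ! i \<otimes>\<^bsub>Q\<^esub> proj x = proj (f i * x)"
      using g[OF i] i proj_mult[OF f(1)[of i] x(1)] by (simp add: f_def)
    then have "xs ! i \<otimes>\<^bsub>Q\<^esub> proj x \<in> genideal Q (set (take i xs))"
      using x f i genideal_proj[of f "f i * x" i] takes by (simp add: polys.S_mult)
    then have "proj x \<in> genideal Q (set (take i xs))"
      using reg i proj_closed[OF x(1)] unfolding regular_sequence_def r_def by blast
    then show "x \<in> polys.generated V I f i"
      using genideal_proj[of f x i] x f i takes by simp
  qed
  then show "enat (length xs) \<le> enat (card T)"
    using regular_mod_length_le[OF T _ f(2)] f(1) unfolding r_def by simp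
qed

theorem Cohen_Macaulay_imp_well_covered:
  assumes "Cohen_Macaulay_graph TYPE('k) V E"
    and T: "maximal_stable V E T" and U: "maximal_stable V E U"
  shows "card T = card U"
proof -
  have CM: "ideal_depth Q (proj ` monomial_prime {}) = prime_height Q (proj ` monomial_prime {})"
    using assms(1) maximalideal_origin
    unfolding Cohen_Macaulay_graph_def Cohen_Macaulay_ring_def edge_ideal_eq by blast
  have "card T \<le> card U" if "maximal_stable V E T" "maximal_stable V E U" for T U
  proof -
    have "enat (card T) \<le> enat (card U)"
    proof (rule order.trans)
      show "enat (card T) \<le> prime_height Q (proj ` monomial_prime {})"
        using that(1) by (intro height_origin_ge) (simp add: maximal_stable_def)
      show "prime_height Q (proj ` monomial_prime {}) \<le> enat (card U)"
        using depth_origin_le[OF that(2)] CM by simp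
    qed
    then show ?thesis by simp
  qed
  then show ?thesis using T U by (simp add: antisym)
qed

end


section \<open>Coordinates on the localizations\<close>

lemma additive_finsum:
  fixes \<theta> :: "'a \<Rightarrow> 'b::comm_monoid_add"
  assumes "abelian_monoid G" and zero: "\<theta> \<zero>\<^bsub>G\<^esub> = 0"
    and add: "\<And>x y. x \<in> carrier G \<Longrightarrow> y \<in> carrier G \<Longrightarrow> \<theta> (x \<oplus>\<^bsub>G\<^esub> y) = \<theta> x + \<theta> y"
    and "finite A" "\<And>i. i \<in> A \<Longrightarrow> f i \<in> carrier G"
  shows "\<theta> (finsum G f A) = (\<Sum>i\<in>A. \<theta> (f i))"
proof -
  interpret abelian_monoid G by fact
  show ?thesis using assms(4,5)
    by (induction A rule: finite_induct) (auto simp: zero add finsum_closed Pi_def)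
qed

definition nat_exponent :: "('v \<Rightarrow>\<^sub>0 int) \<Rightarrow> ('v \<Rightarrow>\<^sub>0 nat)" where
  "nat_exponent a = Poly_Mapping.map nat a"

lemma lookup_nat_exponent: "lookup (nat_exponent a) v = nat (lookup a v)"
  unfolding nat_exponent_def by (simp add: map.rep_eq when_def)

definition int_exponent :: "('v \<Rightarrow>\<^sub>0 nat) \<Rightarrow> ('v \<Rightarrow>\<^sub>0 int)" where
  "int_exponent a = Poly_Mapping.map int a"

lemma lookup_int_exponent: "lookup (int_exponent a) v = int (lookup a v)"
  unfolding int_exponent_def by (simp add: map.rep_eq when_def)

context stanley_reisner
begin

abbreviation M :: "(('v, 'k) mpoly, ('v, 'k) mpoly set) module" where "M \<equiv> edge_ring_module V E"

lemma a_r_coset_self_module: "I +>\<^bsub>self_module R\<^esub> f = proj f"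
  by (simp add: a_r_coset_def' self_module_def)

lemma M_simps: "carrier M = proj ` polys V" "\<zero>\<^bsub>M\<^esub> = I" "add M = set_add (self_module R)"
  "module.smult M = (\<lambda>r P. \<Union>a\<in>P. proj (r * a))"
  unfolding edge_ring_module_def edge_ideal_eq quotient_module_def
  by (simp_all add: A_RCOSETS_def' a_r_coset_self_module)
    (auto simp: self_module_def)

lemma mem_proj_iff: "x \<in> proj h \<longleftrightarrow> x - h \<in> I"
proof
  assume "x - h \<in> I"
  moreover have "x = (x - h) + h" by simp
  ultimately show "x \<in> proj h" unfolding a_r_coset_def' by (auto intro: bexI[of _ "x - h"])
qed (auto simp: a_r_coset_def')

lemmas I_ideal = polys.ideal_inD[OF nonstable_polys_ideal_in[where 'k = 'k]]

lemma M_add: "f \<in> polys V \<Longrightarrow> g \<in> polys V \<Longrightarrow> proj f \<oplus>\<^bsub>M\<^esub> proj g = proj (f + g)"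
proof -
  assume fg: "f \<in> polys V" "g \<in> polys V"
  have "proj f \<oplus>\<^bsub>M\<^esub> proj g = proj f <+>\<^bsub>R\<^esub> proj g"
    unfolding M_simps(3) by (simp add: set_add_def' self_module_def)
  then show ?thesis using I.a_rcos_sum[of f g] fg by simp
qed

lemma M_zero: "\<zero>\<^bsub>M\<^esub> = proj 0"
  using mem_proj_iff[of _ 0] by (auto simp: M_simps)

lemma M_smult: "r \<in> polys V \<Longrightarrow> f \<in> polys V \<Longrightarrow> r \<odot>\<^bsub>M\<^esub> proj f = proj (r * f)"
proof -
  assume rf: "r \<in> polys V" "f \<in> polys V"
  have "proj (r * a) = proj (r * f)" if "a \<in> proj f" for a
  proof -
    have af: "a - f \<in> I" using that by (simp add: mem_proj_iff)
    then have "a \<in> polys V" using rf I_ideal(1) polys.S_add[of "a - f" V f] by auto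
    moreover have "r * a - r * f \<in> I" using I_ideal(4)[OF rf(1) af] by (simp add: algebra_simps)
    ultimately show ?thesis using proj_eq_iff rf polys.S_mult by blast
  qed
  moreover have "f \<in> proj f" using I_ideal(2) by (simp add: mem_proj_iff)
  ultimately show ?thesis unfolding M_simps by blast
qed

abbreviation xprod :: "'v set \<Rightarrow> ('v, 'k) mpoly" where "xprod A \<equiv> finprod R variable A"
abbreviation xpow :: "'v set \<Rightarrow> nat \<Rightarrow> ('v, 'k) mpoly" where
  "xpow A k \<equiv> Poly_Mapping.single (cube A k) 1"

lemma variable_closed: "v \<in> V \<Longrightarrow> (variable v :: ('v, 'k) mpoly) \<in> polys V"
  unfolding variable_def by (simp add: single_in_polys)

lemma finite_sub: "A \<subseteq> V \<Longrightarrow> finite A"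
  using finite_vertices finite_subset by blast

lemma x_eq: "A \<subseteq> V \<Longrightarrow> xprod A = xpow A 1"
proof -
  assume "A \<subseteq> V"
  then have "finite A" by (rule finite_sub)
  then show ?thesis using \<open>A \<subseteq> V\<close>
  proof (induction A rule: finite_induct)
    case (insert v A)
    then have "xprod (insert v A) = variable v * xprod A"
      by (subst R.finprod_insert) (auto simp: variable_closed subset_iff)
    also have "xprod A = xpow A 1" using insert by blast
    also have "variable v * xpow A 1 = xpow (insert v A) 1"
      using insert.hyps by (simp add: cube_def variable_def mult_single)
    finally show ?case .
  qed (simp add: cube_def)
qed

lemma pow_R: "f [^]\<^bsub>R\<^esub> (k::nat) = f ^ k"
  by (induction k) (simp_all add: mult.commute)

lemma x_pow: "A \<subseteq> V \<Longrightarrow> xprod A [^]\<^bsub>R\<^esub> (k::nat) = xpow A k"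
proof -
  assume A: "A \<subseteq> V"
  have "xpow A 1 ^ k = xpow A k"
  proof (induction k)
    case 0
    then show ?case by (simp add: cube_def)
  next
    case (Suc k)
    then show ?case using cube_add[of A 1 k] by (simp add: mult_single)
  qed
  then show ?thesis using x_eq[OF A] pow_R by metis
qed

lemma variable_pow: "variable v [^]\<^bsub>R\<^esub> (k::nat) = xpow {v} k"
proof -
  have "variable v ^ k = (xpow {v} k :: ('v, 'k) mpoly)"
    by (induction k) (simp_all add: cube_def variable_def mult_single single_add[symmetric])
  then show ?thesis by (simp add: pow_R)
qed

lemma xpow_closed: "A \<subseteq> V \<Longrightarrow> xpow A k \<in> polys V"
proof -
  assume A: "A \<subseteq> V"
  have "keys (cube A k) \<subseteq> A" using lookup_cube[OF finite_sub[OF A], of k]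
    by (auto simp: in_keys_iff split: if_splits)
  then show ?thesis using A by (intro single_in_polys) blast
qed

text \<open>The coefficient of the Laurent monomial with exponent \<open>a\<close> in \<open>f / x_A^k\<close>. The monomial
  vanishes in the localization of the Stanley--Reisner ring if \<open>A \<union> keys a\<close> is not stable; with the
  value zero in this case the coefficients depend on the fraction only.\<close>

definition laurent_coeff :: "'v set \<Rightarrow> ('v, 'k) mpoly \<Rightarrow> nat \<Rightarrow> ('v \<Rightarrow>\<^sub>0 int) \<Rightarrow> 'k" where
  "laurent_coeff A f k a =
     (if stable_set V E (A \<union> keys a) \<and> (\<forall>v. 0 \<le> lookup (a + cube A (int k)) v)
      then lookup f (nat_exponent (a + cube A (int k))) else 0)"

lemma keys_shift:
  assumes fin: "finite A"
  shows "keys (nat_exponent (a + cube A (int k))) \<subseteq> A \<union> keys a"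
proof
  fix v assume v: "v \<in> keys (nat_exponent (a + cube A (int k)))"
  show "v \<in> A \<union> keys a"
  proof (rule ccontr)
    assume "v \<notin> A \<union> keys a"
    then have "lookup a v = 0" "v \<notin> A" by (simp_all add: in_keys_iff)
    then show False using v fin by (simp add: in_keys_iff lookup_nat_exponent lookup_add lookup_cube)
  qed
qed

lemma laurent_coeff_cong:
  assumes "f - g \<in> I"
  shows "laurent_coeff A f k a = laurent_coeff A g k a"
proof (cases "stable_set V E (A \<union> keys a)")
  case True
  let ?e = "nat_exponent (a + cube A (int k))"
  have "finite A" using stable_finite[OF True] by simp
  then have "stable_set V E (keys ?e)" using stable_subset[OF True keys_shift] by blast
  then have "?e \<notin> keys (f - g)" using assms by (auto simp: nonstable_polys_def)
  then have "lookup f ?e = lookup g ?e" by (simp add: in_keys_iff lookup_minus)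
  then show ?thesis by (simp add: laurent_coeff_def)
qed (simp add: laurent_coeff_def)

lemma laurent_coeff_xpow:
  "laurent_coeff A (xpow A j * f) (j + k) a = laurent_coeff A f k a"
proof (cases "stable_set V E (A \<union> keys a)")
  case True
  have fin: "finite A" using stable_finite[OF True] by simp
  let ?s = "a + cube A (int k)" and ?t = "a + cube A (int (j + k))"
  have t: "lookup ?t v = lookup ?s v + (if v \<in> A then int j else 0)" for v
    using fin by (simp add: lookup_add lookup_cube)
  show ?thesis
  proof (cases "\<forall>v. 0 \<le> lookup ?s v")
    case s: True
    then have "\<forall>v. 0 \<le> lookup ?t v" unfolding t by (simp add: add_nonneg_nonneg)
    moreover have "nat_exponent ?t = cube A j + nat_exponent ?s"
    proof (rule poly_mapping_eqI)
      fix v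
      have "0 \<le> lookup ?s v" using s by blast
      then show "lookup (nat_exponent ?t) v = lookup (cube A j + nat_exponent ?s) v"
        unfolding lookup_nat_exponent lookup_add[of "cube A j"] t
        by (simp add: lookup_nat_exponent lookup_cube fin nat_add_distrib)
    qed
    ultimately show ?thesis using True s
      unfolding laurent_coeff_def by (simp add: lookup_single_mult)
  next
    case False
    then obtain v where v: "lookup ?s v < 0" by (meson not_le)
    have "lookup (xpow A j * f) (nat_exponent ?t) = 0" if "\<forall>v. 0 \<le> lookup ?t v"
    proof -
      have "v \<in> A" using that t[of v] v by (auto split: if_splits) (metis not_le)
      then have "lookup (nat_exponent ?t) v < j"
        using v that[rule_format, of v] unfolding lookup_nat_exponent t by simp
      then have "nat_exponent ?t \<noteq> cube A j + d" for d
        using \<open>v \<in> A\<close> lookup_cube[OF fin, of j v] lookup_add[of "cube A j" d v] by auto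
      then show ?thesis unfolding lookup_single_mult by auto
    qed
    then show ?thesis using False unfolding laurent_coeff_def by auto
  qed
qed (simp add: laurent_coeff_def)

lemma laurent_coeff_add:
  "laurent_coeff A (f + g) k a = laurent_coeff A f k a + laurent_coeff A g k a"
  by (simp add: laurent_coeff_def lookup_add)

lemma laurent_coeff_scalar:
  "laurent_coeff A (scalar c * f) k a = c * laurent_coeff A f k a"
  by (simp add: laurent_coeff_def scalar_def lookup_scalar_mult)

lemma laurent_coeff_localization_map:
  assumes v: "v \<in> B"
  shows "laurent_coeff B (xpow {v} k * f) k a =
    (if stable_set V E (B \<union> keys a) then laurent_coeff (B - {v}) f k a else 0)"
proof (cases "stable_set V E (B \<union> keys a)")
  case True
  then have st: "stable_set V E (B - {v} \<union> keys a)" by (rule stable_subset) blast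
  have fin: "finite B" "finite (B - {v})" using stable_finite[OF True] by simp_all
  let ?s = "a + cube (B - {v}) (int k)" and ?t = "a + cube B (int k)"
  have t: "lookup ?t u = lookup ?s u + (if u = v then int k else 0)" for u
    using fin v by (simp add: lookup_add lookup_cube)
  show ?thesis
  proof (cases "\<forall>u. 0 \<le> lookup ?s u")
    case s: True
    then have "\<forall>u. 0 \<le> lookup ?t u" unfolding t by (simp add: add_nonneg_nonneg)
    moreover have "nat_exponent ?t = cube {v} k + nat_exponent ?s"
    proof (rule poly_mapping_eqI)
      fix u
      have "0 \<le> lookup ?s u" using s by blast
      then show "lookup (nat_exponent ?t) u = lookup (cube {v} k + nat_exponent ?s) u"
        unfolding lookup_nat_exponent lookup_add[of "cube {v} k"] t
        by (simp add: lookup_nat_exponent lookup_cube nat_add_distrib)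
    qed
    ultimately show ?thesis using True st s
      unfolding laurent_coeff_def by (simp add: lookup_single_mult)
  next
    case False
    then obtain u where u: "lookup ?s u < 0" by (meson not_le)
    have "lookup (xpow {v} k * f) (nat_exponent ?t) = 0" if "\<forall>u. 0 \<le> lookup ?t u"
    proof -
      have "u = v" using that t[of u] u by (auto split: if_splits) (metis not_le)
      then have "lookup (nat_exponent ?t) v < k"
        using u that[rule_format, of v] unfolding lookup_nat_exponent t by simp
      then have "nat_exponent ?t \<noteq> cube {v} k + d" for d
        using lookup_cube[of "{v}" k v] lookup_add[of "cube {v} k" d v] by auto
      then show ?thesis unfolding lookup_single_mult by auto
    qed
    then show ?thesis using False unfolding laurent_coeff_def by auto
  qed
qed (simp add: laurent_coeff_def)

text \<open>These are the exponents of the Laurent monomials that form a basis of the localization at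
  \<open>x_A\<close>.\<close>

definition admissible :: "'v set \<Rightarrow> ('v \<Rightarrow>\<^sub>0 int) \<Rightarrow> bool" where
  "admissible A a \<longleftrightarrow> stable_set V E (A \<union> keys a) \<and> (\<forall>v. v \<notin> A \<longrightarrow> 0 \<le> lookup a v)"

lemma laurent_coeff_admissible:
  assumes "laurent_coeff A f k a \<noteq> 0"
  shows "admissible A a"
proof -
  have st: "stable_set V E (A \<union> keys a)" and nn: "\<forall>v. 0 \<le> lookup (a + cube A (int k)) v"
    using assms unfolding laurent_coeff_def by (auto split: if_splits)
  have "finite A" using stable_finite[OF st] by simp
  then have "0 \<le> lookup a v" if "v \<notin> A" for v
    using nn[rule_format, of v] that by (simp add: lookup_add lookup_cube)
  then show ?thesis using st by (simp add: admissible_def)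
qed

lemma laurent_exponent_inverse:
  assumes "\<forall>v. 0 \<le> lookup (a + cube A (int k)) v" "nat_exponent (a + cube A (int k)) = e"
  shows "a = int_exponent e - cube A (int k)"
proof (rule poly_mapping_eqI)
  fix v
  have "0 \<le> lookup (a + cube A (int k)) v" using assms(1) by blast
  then show "lookup a v = lookup (int_exponent e - cube A (int k)) v"
    unfolding assms(2)[symmetric] by (simp add: lookup_minus lookup_int_exponent lookup_nat_exponent lookup_add)
qed

lemma finite_laurent_support: "finite {a. laurent_coeff A f k a \<noteq> 0}"
proof (rule finite_subset)
  show "{a. laurent_coeff A f k a \<noteq> 0} \<subseteq> (\<lambda>e. int_exponent e - cube A (int k)) ` keys f"
  proof
    fix a assume "a \<in> {a. laurent_coeff A f k a \<noteq> 0}"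
    then have "\<forall>v. 0 \<le> lookup (a + cube A (int k)) v" "nat_exponent (a + cube A (int k)) \<in> keys f"
      unfolding laurent_coeff_def by (auto simp: in_keys_iff split: if_splits)
    then show "a \<in> (\<lambda>e. int_exponent e - cube A (int k)) ` keys f"
      using laurent_exponent_inverse by blast
  qed
qed simp

text \<open>After multiplication with a power of \<open>x_A\<close>, the support of every monomial of the numerators
  contains \<open>A\<close>; if it is stable, the coefficient of the monomial is one of the given ones.\<close>

lemma laurent_coeff_eqD:
  assumes A: "A \<subseteq> V" and fg: "f \<in> polys V" "g \<in> polys V"
    and eq: "\<And>a. laurent_coeff A f k a = laurent_coeff A g l a"
  shows "xpow A (1 + l) * f - xpow A (1 + k) * g \<in> I"
  unfolding nonstable_polys_def
proof (intro CollectI conjI ballI notI)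
  have fin: "finite A" using finite_sub[OF A] .
  let ?F = "xpow A (1 + l) * f" and ?G = "xpow A (1 + k) * g"
  show "?F - ?G \<in> polys V" using fg xpow_closed[OF A] by (intro polys.S_diff polys.S_mult)
  fix e assume e: "e \<in> keys (?F - ?G)" and st: "stable_set V E (keys e)"
  have Ae: "A \<subseteq> keys e"
  proof -
    obtain p c where "e = cube A (Suc p) + c"
    proof -
      have "e \<in> keys ?F \<or> e \<in> keys ?G" using e keys_diff_subset[of ?F ?G] by auto
      then show thesis
        using that[of l] that[of k] by (auto elim!: keys_mult_cases)
    qed
    then have "lookup e v = lookup (cube A (Suc p)) v + lookup c v" for v by (simp add: lookup_add)
    then show ?thesis using fin by (auto simp: in_keys_iff lookup_cube)
  qed
  define n where "n = 1 + k + l"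
  define a where "a = int_exponent e - cube A (int n)"
  have s: "a + cube A (int n) = int_exponent e" by (simp add: a_def)
  have ne: "nat_exponent (int_exponent e) = e"
    by (rule poly_mapping_eqI) (simp add: lookup_nat_exponent lookup_int_exponent)
  have "keys a \<subseteq> keys e \<union> A"
    using fin by (auto simp: a_def in_keys_iff lookup_minus lookup_int_exponent lookup_cube split: if_splits)
  with Ae have "A \<union> keys a \<subseteq> keys e" by blast
  with st have sta: "stable_set V E (A \<union> keys a)" by (rule stable_subset)
  have at: "laurent_coeff A h n a = lookup h e" for h
    unfolding laurent_coeff_def s ne using sta by (simp add: lookup_int_exponent)
  have "lookup ?F e = laurent_coeff A f k a"
    using laurent_coeff_xpow[of A "1 + l" f k a] at[of ?F] by (simp add: n_def add_ac)
  moreover have "lookup ?G e = laurent_coeff A g l a"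
    using laurent_coeff_xpow[of A "1 + k" g l a] at[of ?G] by (simp add: n_def add_ac)
  ultimately show False using e eq by (simp add: in_keys_iff lookup_minus)
qed

abbreviation L :: "'v set \<Rightarrow> (('v, 'k) mpoly, (('v, 'k) mpoly set \<times> nat) set) module" where
  "L A \<equiv> cech_localization R M variable A"

definition frac :: "'v set \<Rightarrow> ('v, 'k) mpoly \<Rightarrow> nat \<Rightarrow> (('v, 'k) mpoly set \<times> nat) set" where
  "frac A f k = fraction R M (xprod A) (proj f) k"

lemma mem_frac_iff:
  assumes A: "A \<subseteq> V" and f: "f \<in> polys V"
  shows "(b, l) \<in> frac A f k \<longleftrightarrow>
    (\<exists>g\<in>polys V. b = proj g \<and> (\<forall>a. laurent_coeff A g l a = laurent_coeff A f k a))"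
proof -
  have *: "(\<exists>j. xprod A [^]\<^bsub>R\<^esub> (j + l) \<odot>\<^bsub>M\<^esub> proj f = xprod A [^]\<^bsub>R\<^esub> (j + k) \<odot>\<^bsub>M\<^esub> proj g) \<longleftrightarrow>
      (\<forall>a. laurent_coeff A g l a = laurent_coeff A f k a)" if g: "g \<in> polys V" for g
  proof -
    have 1: "xprod A [^]\<^bsub>R\<^esub> (j + l) \<odot>\<^bsub>M\<^esub> proj f = xprod A [^]\<^bsub>R\<^esub> (j + k) \<odot>\<^bsub>M\<^esub> proj g \<longleftrightarrow>
        xpow A (j + l) * f - xpow A (j + k) * g \<in> I" for j
      using A f g by (simp add: x_pow M_smult xpow_closed proj_eq_iff polys.S_mult)
    show ?thesis unfolding 1
    proof
      assume "\<exists>j. xpow A (j + l) * f - xpow A (j + k) * g \<in> I"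
      then obtain j where "xpow A (j + l) * f - xpow A (j + k) * g \<in> I" by blast
      then have "laurent_coeff A (xpow A (j + l) * f) (j + l + k) a =
          laurent_coeff A (xpow A (j + k) * g) (j + k + l) a" for a
        using laurent_coeff_cong by (metis add.assoc add.commute)
      then show "\<forall>a. laurent_coeff A g l a = laurent_coeff A f k a"
        unfolding laurent_coeff_xpow by simp
    next
      assume "\<forall>a. laurent_coeff A g l a = laurent_coeff A f k a"
      then have "xpow A (1 + l) * f - xpow A (1 + k) * g \<in> I"
        by (intro laurent_coeff_eqD A f g) simp
      then show "\<exists>j. xpow A (j + l) * f - xpow A (j + k) * g \<in> I" by blast
    qed
  qed
  show ?thesis
    unfolding frac_def fraction_def M_simps(1) using * by auto
qed

lemma frac_eq_iff:
  assumes "A \<subseteq> V" "f \<in> polys V" "g \<in> polys V"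
  shows "frac A f k = frac A g l \<longleftrightarrow> (\<forall>a. laurent_coeff A f k a = laurent_coeff A g l a)"
proof
  assume eq: "frac A f k = frac A g l"
  have "(proj f, k) \<in> frac A f k" using mem_frac_iff[OF assms(1,2)] assms(2) by blast
  then obtain f' where f': "f' \<in> polys V" "proj f = proj f'"
    "\<forall>a. laurent_coeff A f' k a = laurent_coeff A g l a"
    unfolding eq using mem_frac_iff[OF assms(1,3)] by blast
  then have "f - f' \<in> I" using proj_eq_iff assms(2) by blast
  then show "\<forall>a. laurent_coeff A f k a = laurent_coeff A g l a"
    using f'(3) laurent_coeff_cong by simp
next
  assume "\<forall>a. laurent_coeff A f k a = laurent_coeff A g l a"
  then have "(b, m) \<in> frac A f k \<longleftrightarrow> (b, m) \<in> frac A g l" for b m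
    unfolding mem_frac_iff[OF assms(1,2)] mem_frac_iff[OF assms(1,3)] by simp
  then show "frac A f k = frac A g l" by auto
qed

text \<open>The function of all Laurent coefficients of a fraction, for any way of writing it. The module
  operations, the localization maps and the grading are determined by it, so that computations with
  classes of classes become computations with functions.\<close>

definition coord :: "'v set \<Rightarrow> (('v, 'k) mpoly set \<times> nat) set \<Rightarrow> ('v \<Rightarrow>\<^sub>0 int) \<Rightarrow> 'k" where
  "coord A P = (THE h. \<exists>f\<in>polys V. \<exists>k. P = frac A f k \<and> h = laurent_coeff A f k)"

lemma coord_frac:
  assumes "A \<subseteq> V" "f \<in> polys V"
  shows "coord A (frac A f k) = laurent_coeff A f k"
  unfolding coord_def
  by (rule the_equality) (use assms in \<open>auto simp: frac_eq_iff\<close>)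

lemma carrier_L: "carrier (L A) = {frac A f k | f k. f \<in> polys V}"
  unfolding cech_localization_def localization_def frac_def by (auto simp: M_simps(1))

lemma carrier_L_E:
  assumes "P \<in> carrier (L A)"
  obtains f k where "f \<in> polys V" "P = frac A f k"
  using assms unfolding carrier_L by blast

lemma frac_closed: "f \<in> polys V \<Longrightarrow> frac A f k \<in> carrier (L A)"
  unfolding carrier_L by blast

lemma coord_inject:
  assumes "A \<subseteq> V" "P \<in> carrier (L A)" "P' \<in> carrier (L A)" "coord A P = coord A P'"
  shows "P = P'"
  using assms(2,3)
  by (elim carrier_L_E) (use assms(1,4) in \<open>auto simp: frac_eq_iff coord_frac\<close>)

lemma coord_admissible:
  assumes "A \<subseteq> V" "P \<in> carrier (L A)" "coord A P a \<noteq> 0"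
  shows "admissible A a"
  using assms(2) by (elim carrier_L_E) (use assms laurent_coeff_admissible in \<open>auto simp: coord_frac\<close>)

lemma finite_coord_support:
  assumes "A \<subseteq> V" "P \<in> carrier (L A)"
  shows "finite {a. coord A P a \<noteq> 0}"
  using assms(2) by (elim carrier_L_E) (use assms finite_laurent_support in \<open>auto simp: coord_frac\<close>)

lemma union_const: "P \<noteq> {} \<Longrightarrow> (\<And>p. p \<in> P \<Longrightarrow> F p = c) \<Longrightarrow> (\<Union>p\<in>P. F p) = c"
  by auto

lemma frac_nonempty:
  assumes "A \<subseteq> V" "f \<in> polys V"
  shows "frac A f k \<noteq> {}"
  using mem_frac_iff[OF assms, of "proj f" k k] assms(2) by blast

lemma L_zero: "\<zero>\<^bsub>L A\<^esub> = frac A 0 0"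
  unfolding cech_localization_def localization_def frac_def by (simp add: M_zero)

lemma L_add:
  assumes A: "A \<subseteq> V" and "f \<in> polys V" "g \<in> polys V"
  shows "frac A f k \<oplus>\<^bsub>L A\<^esub> frac A g l = frac A (xpow A l * f + xpow A k * g) (k + l)" (is "_ = ?S")
proof -
  have inner: "fraction R M (xprod A) ((xprod A [^]\<^bsub>R\<^esub> l') \<odot>\<^bsub>M\<^esub> a \<oplus>\<^bsub>M\<^esub> (xprod A [^]\<^bsub>R\<^esub> k') \<odot>\<^bsub>M\<^esub> b) (k' + l') = ?S"
    if ab: "(a, k') \<in> frac A f k" "(b, l') \<in> frac A g l" for a k' b l'
  proof -
    obtain f' g' where f': "f' \<in> polys V" "a = proj f'" "\<forall>a. laurent_coeff A f' k' a = laurent_coeff A f k a"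
      and g': "g' \<in> polys V" "b = proj g'" "\<forall>a. laurent_coeff A g' l' a = laurent_coeff A g l a"
      using ab unfolding mem_frac_iff[OF A assms(2)] mem_frac_iff[OF A assms(3)] by (elim bexE conjE)
    have "fraction R M (xprod A) ((xprod A [^]\<^bsub>R\<^esub> l') \<odot>\<^bsub>M\<^esub> a \<oplus>\<^bsub>M\<^esub> (xprod A [^]\<^bsub>R\<^esub> k') \<odot>\<^bsub>M\<^esub> b) (k' + l') =
        frac A (xpow A l' * f' + xpow A k' * g') (k' + l')"
      using A f'(1) g'(1) unfolding f'(2) g'(2) frac_def
      by (simp add: x_pow M_smult M_add xpow_closed polys.S_mult)
    also have "\<dots> = ?S"
    proof (subst frac_eq_iff[OF A])
      have c: "laurent_coeff A (xpow A l * f + xpow A k * g) (k + l) a =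
          laurent_coeff A f k a + laurent_coeff A g l a" for f g k l a
        using laurent_coeff_xpow[of A l f k a] laurent_coeff_xpow[of A k g l a]
        unfolding laurent_coeff_add by (simp add: add.commute)
      show "\<forall>a. laurent_coeff A (xpow A l' * f' + xpow A k' * g') (k' + l') a =
          laurent_coeff A (xpow A l * f + xpow A k * g) (k + l) a"
        unfolding c using f'(3) g'(3) by simp
    qed (use A assms f' g' in \<open>auto intro!: polys.S_add polys.S_mult xpow_closed\<close>)
    finally show ?thesis .
  qed
  have "frac A f k \<oplus>\<^bsub>L A\<^esub> frac A g l = (\<Union>(a, k')\<in>frac A f k. \<Union>(b, l')\<in>frac A g l.
      fraction R M (xprod A) ((xprod A [^]\<^bsub>R\<^esub> l') \<odot>\<^bsub>M\<^esub> a \<oplus>\<^bsub>M\<^esub> (xprod A [^]\<^bsub>R\<^esub> k') \<odot>\<^bsub>M\<^esub> b) (k' + l'))"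
    by (simp add: cech_localization_def localization_def)
  also have "\<dots> = ?S"
    using frac_nonempty[OF A assms(2), of k] frac_nonempty[OF A assms(3), of l]
    by (auto intro!: union_const inner)
  finally show ?thesis .
qed

lemma L_smult:
  assumes A: "A \<subseteq> V" and f: "f \<in> polys V"
  shows "scalar c \<odot>\<^bsub>L A\<^esub> frac A f k = frac A (scalar c * f) k"
proof -
  have sc: "(scalar c :: ('v, 'k) mpoly) \<in> polys V" by (simp add: scalar_def single_in_polys)
  have "scalar c \<odot>\<^bsub>L A\<^esub> frac A f k = (\<Union>(a, k')\<in>frac A f k. fraction R M (xprod A) (scalar c \<odot>\<^bsub>M\<^esub> a) k')"
    by (simp add: cech_localization_def localization_def)
  also have "\<dots> = frac A (scalar c * f) k"
  proof (rule union_const[OF frac_nonempty[OF A f]])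
    fix p assume p: "p \<in> frac A f k"
    obtain a k' where ak: "p = (a, k')" by (cases p)
    obtain f' where f': "f' \<in> polys V" "a = proj f'" "\<forall>a. laurent_coeff A f' k' a = laurent_coeff A f k a"
      using p mem_frac_iff[OF A f] unfolding ak by blast
    have "fraction R M (xprod A) (scalar c \<odot>\<^bsub>M\<^esub> a) k' = frac A (scalar c * f') k'"
      using f' sc by (simp add: M_smult frac_def)
    also have "\<dots> = frac A (scalar c * f) k"
      using frac_eq_iff[OF A polys.S_mult[OF sc f'(1)] polys.S_mult[OF sc f]] f'(3)
      by (simp add: laurent_coeff_scalar)
    finally show "(case p of (a, k') \<Rightarrow> fraction R M (xprod A) (scalar c \<odot>\<^bsub>M\<^esub> a) k') = frac A (scalar c * f) k"
      by (simp add: ak)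
  qed
  finally show ?thesis .
qed

lemma localization_map_frac:
  assumes B: "B \<subseteq> V" and v: "v \<in> B" and f: "f \<in> polys V"
  shows "localization_map R M (variable v) (xprod B) (frac (B - {v}) f k) = frac B (xpow {v} k * f) k"
proof -
  have A: "B - {v} \<subseteq> V" "{v} \<subseteq> V" using B v by auto
  show ?thesis unfolding localization_map_def
  proof (rule union_const[OF frac_nonempty[OF A(1) f]])
    fix p assume p: "p \<in> frac (B - {v}) f k"
    obtain a k' where ak: "p = (a, k')" by (cases p)
    obtain f' where f': "f' \<in> polys V" "a = proj f'"
      "\<forall>a. laurent_coeff (B - {v}) f' k' a = laurent_coeff (B - {v}) f k a"
      using p mem_frac_iff[OF A(1) f] unfolding ak by blast
    have "fraction R M (xprod B) ((variable v [^]\<^bsub>R\<^esub> k') \<odot>\<^bsub>M\<^esub> a) k' = frac B (xpow {v} k' * f') k'"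
      using f' xpow_closed[OF A(2)] by (simp add: M_smult frac_def variable_pow)
    also have "\<dots> = frac B (xpow {v} k * f) k"
      using frac_eq_iff[OF B polys.S_mult[OF xpow_closed[OF A(2)] f'(1)] polys.S_mult[OF xpow_closed[OF A(2)] f]] f'(3)
      by (simp add: laurent_coeff_localization_map[OF v])
    finally show "(case p of (a, k') \<Rightarrow> fraction R M (xprod B) ((variable v [^]\<^bsub>R\<^esub> k') \<odot>\<^bsub>M\<^esub> a) k') = frac B (xpow {v} k * f) k"
      by (simp add: ak)
  qed
qed

lemma coord_zero: "A \<subseteq> V \<Longrightarrow> coord A \<zero>\<^bsub>L A\<^esub> a = 0"
  unfolding L_zero by (simp add: coord_frac polys.S_zero laurent_coeff_def)

lemma zero_closed_L: "\<zero>\<^bsub>L A\<^esub> \<in> carrier (L A)"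
  unfolding L_zero by (intro frac_closed polys.S_zero)

lemma coord_add:
  assumes A: "A \<subseteq> V" and "P \<in> carrier (L A)" "P' \<in> carrier (L A)"
  shows "P \<oplus>\<^bsub>L A\<^esub> P' \<in> carrier (L A)" "coord A (P \<oplus>\<^bsub>L A\<^esub> P') a = coord A P a + coord A P' a"
proof -
  obtain f k g l where f: "f \<in> polys V" "P = frac A f k" and g: "g \<in> polys V" "P' = frac A g l"
    using assms(2,3) by (elim carrier_L_E)
  have S: "xpow A l * f + xpow A k * g \<in> polys V"
    using f g A by (intro polys.S_add polys.S_mult xpow_closed)
  show "P \<oplus>\<^bsub>L A\<^esub> P' \<in> carrier (L A)"
    using f g A S by (simp add: L_add frac_closed)
  show "coord A (P \<oplus>\<^bsub>L A\<^esub> P') a = coord A P a + coord A P' a"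
    using f g A S laurent_coeff_xpow[of A l f k a] laurent_coeff_xpow[of A k g l a]
    by (simp add: L_add coord_frac laurent_coeff_add add.commute[of l])
qed

lemma coord_smult:
  assumes A: "A \<subseteq> V" and "P \<in> carrier (L A)"
  shows "scalar c \<odot>\<^bsub>L A\<^esub> P \<in> carrier (L A)" "coord A (scalar c \<odot>\<^bsub>L A\<^esub> P) a = c * coord A P a"
proof -
  obtain f k where f: "f \<in> polys V" "P = frac A f k"
    using assms(2) by (elim carrier_L_E)
  have S: "scalar c * f \<in> polys V" using f by (auto simp: scalar_def intro!: polys.S_mult single_in_polys)
  show "scalar c \<odot>\<^bsub>L A\<^esub> P \<in> carrier (L A)" using f A S by (simp add: L_smult frac_closed)
  show "coord A (scalar c \<odot>\<^bsub>L A\<^esub> P) a = c * coord A P a"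
    using f A S by (simp add: L_smult coord_frac laurent_coeff_scalar)
qed

lemma coord_localization_map:
  assumes B: "B \<subseteq> V" and v: "v \<in> B" and P: "P \<in> carrier (L (B - {v}))"
  shows "localization_map R M (variable v) (xprod B) P \<in> carrier (L B)"
    "coord B (localization_map R M (variable v) (xprod B) P) a =
       (if stable_set V E (B \<union> keys a) then coord (B - {v}) P a else 0)"
proof -
  obtain f k where f: "f \<in> polys V" "P = frac (B - {v}) f k"
    using P by (elim carrier_L_E)
  have S: "xpow {v} k * f \<in> polys V" using f B v by (intro polys.S_mult xpow_closed) auto
  have B': "B - {v} \<subseteq> V" using B by blast
  show "localization_map R M (variable v) (xprod B) P \<in> carrier (L B)"
    using f S B v by (simp add: localization_map_frac frac_closed)
  show "coord B (localization_map R M (variable v) (xprod B) P) a =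
       (if stable_set V E (B \<union> keys a) then coord (B - {v}) P a else 0)"
    using f S B v B' by (simp add: localization_map_frac coord_frac laurent_coeff_localization_map)
qed

lemma abelian_monoid_L:
  assumes A: "A \<subseteq> V"
  shows "abelian_monoid (L A)"
proof (rule abelian_monoidI)
  note c = coord_add[OF A]
  show "\<zero>\<^bsub>L A\<^esub> \<in> carrier (L A)" by (rule zero_closed_L)
  fix P P' assume P: "P \<in> carrier (L A)" "P' \<in> carrier (L A)"
  show "P \<oplus>\<^bsub>L A\<^esub> P' \<in> carrier (L A)" using c P by simp
  show "P \<oplus>\<^bsub>L A\<^esub> P' = P' \<oplus>\<^bsub>L A\<^esub> P"
    by (rule coord_inject[OF A]) (use c P in \<open>auto simp: fun_eq_iff add.commute\<close>)
  fix P'' assume P'': "P'' \<in> carrier (L A)"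
  show "P \<oplus>\<^bsub>L A\<^esub> P' \<oplus>\<^bsub>L A\<^esub> P'' = P \<oplus>\<^bsub>L A\<^esub> (P' \<oplus>\<^bsub>L A\<^esub> P'')"
    by (rule coord_inject[OF A]) (use c P P'' in \<open>auto simp: fun_eq_iff add.assoc\<close>)
next
  fix P assume P: "P \<in> carrier (L A)"
  show "\<zero>\<^bsub>L A\<^esub> \<oplus>\<^bsub>L A\<^esub> P = P"
    by (rule coord_inject[OF A])
      (use coord_add[OF A zero_closed_L P] coord_zero[OF A] P in \<open>auto simp: fun_eq_iff\<close>)
qed

definition total_degree :: "('v \<Rightarrow>\<^sub>0 int) \<Rightarrow> int" where
  "total_degree a = (\<Sum>v\<in>V. lookup a v)"

abbreviation component_L :: "'v set \<Rightarrow> int \<Rightarrow> (('v, 'k) mpoly set \<times> nat) set set" where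
  "component_L A l \<equiv> cech_localization_component R M (edge_ring_component V E) variable A l"

lemma monomial_degree_total:
  assumes "keys e \<subseteq> V"
  shows "int (monomial_degree e) = (\<Sum>v\<in>V. int (lookup e v))"
proof -
  have "monomial_degree e = (\<Sum>v\<in>V. lookup e v)"
    unfolding monomial_degree_def
    by (rule sum.mono_neutral_left[OF finite_vertices assms]) (simp add: in_keys_iff)
  then show ?thesis by simp
qed

lemma component_L_E:
  assumes "P \<in> component_L A l"
  obtains f k where "f \<in> polys V" "P = frac A f k"
    "\<forall>e\<in>keys f. int (monomial_degree e) = l + int k * int (card A)"
proof -
  obtain f k where "P = fraction R M (xprod A) (proj f) k" "f \<in> mpoly_component V (l + int k * int (card A))"
    using assms unfolding cech_localization_component_def edge_ring_component_def edge_ideal_eq by blast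
  then show thesis using that[of f k] unfolding frac_def mpoly_component_def by auto
qed

lemma coord_degree:
  assumes A: "A \<subseteq> V" and P: "P \<in> component_L A l" and nz: "coord A P a \<noteq> 0"
  shows "total_degree a = l"
proof -
  obtain f k where f: "f \<in> polys V" "P = frac A f k"
    "\<forall>e\<in>keys f. int (monomial_degree e) = l + int k * int (card A)"
    using P by (rule component_L_E)
  let ?e = "nat_exponent (a + cube A (int k))"
  have nz': "laurent_coeff A f k a \<noteq> 0" using nz f A by (simp add: coord_frac)
  then have nn: "\<forall>v. 0 \<le> lookup (a + cube A (int k)) v" and e: "?e \<in> keys f"
    unfolding laurent_coeff_def by (auto simp: in_keys_iff split: if_splits)
  have "keys ?e \<subseteq> V" using e f(1) by (auto simp: polys_def)
  then have "(\<Sum>v\<in>V. int (lookup ?e v)) = l + int k * int (card A)"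
    using f(3) e monomial_degree_total[of ?e] by simp
  moreover have "int (lookup ?e v) = lookup a v + (if v \<in> A then int k else 0)" for v
    using nn[rule_format, of v] finite_sub[OF A] by (simp add: lookup_nat_exponent lookup_add lookup_cube)
  moreover have "(\<Sum>v\<in>V. if v \<in> A then int k else 0) = int k * int (card A)"
    using A finite_vertices by (simp add: sum.If_cases Int_absorb1)
  ultimately show ?thesis unfolding total_degree_def by (simp add: sum.distrib)
qed

text \<open>A common denominator makes all exponents in a finite set of admissible ones nonnegative.\<close>

lemma coord_surj:
  assumes A: "A \<subseteq> V" and fin: "finite {a. h a \<noteq> 0}" and adm: "\<And>a. h a \<noteq> 0 \<Longrightarrow> admissible A a"
  obtains P where "P \<in> carrier (L A)" "coord A P = h"
    "\<And>l. (\<And>a. h a \<noteq> 0 \<Longrightarrow> total_degree a = l) \<Longrightarrow> P \<in> component_L A l"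
proof -
  let ?D = "{a. h a \<noteq> 0}"
  have finA: "finite A" using finite_sub[OF A] .
  define k where "k = (\<Sum>a\<in>?D. \<Sum>v\<in>A. nat (- lookup a v))"
  have nn: "0 \<le> lookup (a + cube A (int k)) v" if "a \<in> ?D" for a v
  proof (cases "v \<in> A")
    case True
    have "nat (- lookup a v) \<le> (\<Sum>v\<in>A. nat (- lookup a v))"
      using True finA by (intro member_le_sum) auto
    also have "\<dots> \<le> k" unfolding k_def
      using that fin by (intro member_le_sum[where f = "\<lambda>a. \<Sum>v\<in>A. nat (- lookup a v)"]) auto
    finally show ?thesis using True finA by (simp add: lookup_add lookup_cube)
  next
    case False
    then show ?thesis using adm[of a] that finA by (simp add: lookup_add lookup_cube admissible_def)
  qed
  define ex where "ex a = nat_exponent (a + cube A (int k))" for a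
  have inj: "a = b" if "a \<in> ?D" "\<forall>v. 0 \<le> lookup (b + cube A (int k)) v" "ex a = ex b" for a b
    using laurent_exponent_inverse[of a A k "ex b"] laurent_exponent_inverse[of b A k "ex b"] nn that
    unfolding ex_def by metis
  define f where "f = (\<Sum>a\<in>?D. Poly_Mapping.single (ex a) (h a))"
  have keys_ex: "keys (ex a) \<subseteq> V" if "a \<in> ?D" for a
    using keys_shift[OF finA, of a k] adm[of a] that unfolding ex_def admissible_def stable_set_def by auto
  have fV: "f \<in> polys V" unfolding f_def by (intro polys.S_sum single_in_polys keys_ex)
  have lookup_f: "lookup f (ex b) = h b" if "\<forall>v. 0 \<le> lookup (b + cube A (int k)) v" for b
  proof -
    have "lookup f (ex b) = (\<Sum>a\<in>?D. if a = b then h b else 0)"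
      unfolding f_def lookup_sum by (intro sum.cong) (use inj that in \<open>auto simp: lookup_single when_def\<close>)
    then show ?thesis using fin by simp
  qed
  have coeff: "laurent_coeff A f k b = h b" for b
  proof (cases "h b = 0")
    case True
    then show ?thesis using lookup_f[of b] unfolding laurent_coeff_def ex_def by simp
  next
    case False
    then show ?thesis using lookup_f[of b] nn[of b] adm[OF False]
      unfolding laurent_coeff_def ex_def admissible_def by simp
  qed
  show thesis
  proof (rule that[of "frac A f k"])
    show "frac A f k \<in> carrier (L A)" using fV by (rule frac_closed)
    show "coord A (frac A f k) = h" using coord_frac[OF A fV] coeff by (simp add: fun_eq_iff)
    fix l assume deg: "\<And>a. h a \<noteq> 0 \<Longrightarrow> total_degree a = l"
    have "int (monomial_degree e) = l + int k * int (card A)" if "e \<in> keys f" for e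
    proof -
      have "lookup f e \<noteq> 0" using that by (simp add: in_keys_iff)
      then obtain a where a: "a \<in> ?D" "e = ex a"
        unfolding f_def lookup_sum lookup_single
        by (auto elim!: sum.not_neutral_contains_not_neutral simp: when_def split: if_splits)
      have "int (lookup e v) = lookup a v + (if v \<in> A then int k else 0)" for v
        using nn[OF a(1), of v] finA unfolding a(2) ex_def
        by (simp add: lookup_nat_exponent lookup_add lookup_cube)
      then have "(\<Sum>v\<in>V. int (lookup e v)) = total_degree a + (\<Sum>v\<in>V. if v \<in> A then int k else 0)"
        by (simp add: total_degree_def sum.distrib)
      also have "(\<Sum>v\<in>V. if v \<in> A then int k else 0) = int k * int (card A)"
        using A finite_vertices by (simp add: sum.If_cases Int_absorb1)
      finally show ?thesis using deg a keys_ex[OF a(1)] by (simp add: monomial_degree_total)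
    qed
    then show "frac A f k \<in> component_L A l"
      using fV unfolding cech_localization_component_def edge_ring_component_def edge_ideal_eq
        mpoly_component_def frac_def by auto
  qed
qed

end


section \<open>Top cohomology of the independence complex\<close>

lemma card_sum_split:
  assumes "finite A"
  shows "card {x\<in>A. P x} = card {x\<in>A. P x \<and> Q x} + card {x\<in>A. P x \<and> \<not> Q x}"
proof -
  have "{x\<in>A. P x} = {x\<in>A. P x \<and> Q x} \<union> {x\<in>A. P x \<and> \<not> Q x}" by blast
  then show ?thesis using assms by (simp only:) (rule card_Un_disjoint; auto)
qed

definition insertion_sign :: "'v::linorder \<Rightarrow> 'v set \<Rightarrow> 'k::field" where
  "insertion_sign u B = (- 1) ^ card {y\<in>B. y < u}"

lemma insertion_sign_square: "insertion_sign u B * insertion_sign u B = 1"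
  unfolding insertion_sign_def by (simp add: power_mult_distrib[symmetric])

text \<open>In a fixed multidegree, the Cech differential acts like the coboundary of a simplicial
  complex on the vertex set, with cochains extended by zero to all sets.\<close>

definition coboundary :: "('v::linorder set \<Rightarrow> 'k::field) \<Rightarrow> 'v set \<Rightarrow> 'k" where
  "coboundary c H = (\<Sum>v\<in>H. insertion_sign v H * c (H - {v}))"

lemma coboundary_add: "coboundary (\<lambda>A. c A + d A) H = coboundary c H + coboundary d H"
  by (simp add: coboundary_def algebra_simps sum.distrib)

text \<open>The contracting homotopy of the cone with apex \<open>v\<close>.\<close>

definition contraction :: "'v::linorder \<Rightarrow> ('v set \<Rightarrow> 'k::field) \<Rightarrow> 'v set \<Rightarrow> 'k" where
  "contraction v c A = (if v \<in> A then 0 else insertion_sign v (insert v A) * c (insert v A))"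

lemma coboundary_contraction:
  assumes "finite H" "v \<in> H"
  shows "coboundary (contraction v c) H = c H"
proof -
  have "insertion_sign u H * contraction v c (H - {u}) = (if u = v then c H else 0)" if "u \<in> H" for u
    using assms that insertion_sign_square[of v H]
    by (auto simp: contraction_def insert_absorb mult.assoc[symmetric])
  then have "coboundary (contraction v c) H = (\<Sum>u\<in>H. if u = v then c H else 0)"
    unfolding coboundary_def by (intro sum.cong) auto
  then show ?thesis using assms by simp
qed

locale simplex_partition = finite_simple_graph V E
  for V :: "'v::linorder set" and E :: "'v set set" +
  fixes F :: "nat \<Rightarrow> 'v set" and w :: "nat \<Rightarrow> 'v" and m :: nat
  assumes F_clique: "i \<in> {1..m} \<Longrightarrow> clique V E (F i)"
    and F_cover: "v \<in> V \<Longrightarrow> \<exists>i\<in>{1..m}. v \<in> F i"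
    and F_disjoint: "i \<in> {1..m} \<Longrightarrow> j \<in> {1..m} \<Longrightarrow> v \<in> F i \<Longrightarrow> v \<in> F j \<Longrightarrow> i = j"
    and w_in_F: "i \<in> {1..m} \<Longrightarrow> w i \<in> F i"
    and w_neighbour: "i \<in> {1..m} \<Longrightarrow> {w i, u} \<in> E \<Longrightarrow> u \<in> F i"
begin

definition W :: "'v set" where "W = w ` {1..m}"

lemma W_I: "i \<in> {1..m} \<Longrightarrow> w i \<in> W"
  by (auto simp: W_def)

lemma W_E: "y \<in> W \<Longrightarrow> (\<And>i. i \<in> {1..m} \<Longrightarrow> y = w i \<Longrightarrow> thesis) \<Longrightarrow> thesis"
  by (auto simp: W_def)

definition part_index :: "'v \<Rightarrow> nat" where
  "part_index v = (SOME i. i \<in> {1..m} \<and> v \<in> F i)"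

lemma part_index:
  assumes "v \<in> V"
  shows "part_index v \<in> {1..m}" "v \<in> F (part_index v)"
  using someI_ex[of "\<lambda>i. i \<in> {1..m} \<and> v \<in> F i"] F_cover[OF assms] unfolding part_index_def by blast+

lemma part_index_unique: "v \<in> V \<Longrightarrow> i \<in> {1..m} \<Longrightarrow> v \<in> F i \<Longrightarrow> part_index v = i"
  using F_disjoint part_index by blast

lemma w_in_V: "i \<in> {1..m} \<Longrightarrow> w i \<in> V"
  using w_in_F F_clique unfolding clique_def by blast

lemma part_index_w: "i \<in> {1..m} \<Longrightarrow> part_index (w i) = i"
  using part_index_unique w_in_V w_in_F by blast

lemma stable_inj:
  assumes "stable_set V E T"
  shows "inj_on part_index T"
proof (rule inj_onI)
  fix x y assume xy: "x \<in> T" "y \<in> T" "part_index x = part_index y"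
  have "x \<in> V" "y \<in> V" "{x, y} \<notin> E" using xy assms by (auto simp: stable_set_def)
  then show "x = y"
    using part_index[of x] part_index[of y] F_clique[of "part_index x"] xy(3) unfolding clique_def by auto
qed

lemma stable_card_le:
  assumes "stable_set V E T"
  shows "card T \<le> m"
proof -
  have "part_index ` T \<subseteq> {1..m}" using assms part_index(1) by (auto simp: stable_set_def)
  then have "card T \<le> card {1..m}" by (intro card_inj_on_le[OF stable_inj[OF assms]]) auto
  then show ?thesis by simp
qed

lemma stable_insert_w:
  assumes "stable_set V E T" "i \<in> {1..m}" "\<And>x. x \<in> T \<Longrightarrow> part_index x \<noteq> i"
  shows "stable_set V E (insert (w i) T)"
proof -
  have "{w i, x} \<notin> E" if "x \<in> T" for x
    using w_neighbour[OF assms(2), of x] assms(1,3) that part_index_unique[of x i] assms(2)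
    by (auto simp: stable_set_def)
  then show ?thesis using assms(1) w_in_V[OF assms(2)] no_loop
    by (auto simp: stable_set_def insert_commute)
qed

lemma maximal_stable_meets:
  assumes "maximal_stable V E T" "i \<in> {1..m}"
  shows "\<exists>x\<in>T. part_index x = i"
proof (rule ccontr)
  assume no: "\<not> ?thesis"
  have "stable_set V E T" using assms(1) by (simp add: maximal_stable_def)
  then have "stable_set V E (insert (w i) T)" using stable_insert_w[OF _ assms(2)] no by blast
  then have "w i \<in> T" using assms(1) unfolding maximal_stable_def by (metis insertI1 subset_insertI)
  then show False using no part_index_w[OF assms(2)] by blast
qed

lemma maximal_stable_stable: "maximal_stable V E T \<Longrightarrow> stable_set V E T"
  by (simp add: maximal_stable_def)

lemma maximal_stable_card:
  assumes "maximal_stable V E T"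
  shows "card T = m"
proof -
  have "{1..m} \<subseteq> part_index ` T" using maximal_stable_meets[OF assms] by blast
  then have "m \<le> card T"
    using surj_card_le[of T "{1..m}" part_index] stable_finite[OF maximal_stable_stable[OF assms]] by simp
  then show ?thesis using stable_card_le[OF maximal_stable_stable[OF assms]] by simp
qed

lemma maximal_stableI:
  assumes "stable_set V E T" "card T = m"
  shows "maximal_stable V E T"
  unfolding maximal_stable_def
proof (intro conjI allI impI assms(1))
  fix Y assume Y: "stable_set V E Y \<and> T \<subseteq> Y"
  then have "card Y \<le> card T" using stable_card_le assms(2) by simp
  then show "Y = T" using Y stable_finite[of Y] card_seteq[of Y T] by auto
qed

text \<open>The coboundary uses the order of the vertices; the cycles below are products over the parts
  and would be oriented by the order of the parts. The sign of the permutation relating the two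
  is the parity of the number of inversions.\<close>

definition inversions :: "'v set \<Rightarrow> nat" where
  "inversions H = card {(x, y) \<in> H \<times> H. x < y \<and> part_index y < part_index x}"

lemma inversions_remove:
  assumes st: "stable_set V E H" and u: "u \<in> H"
  shows "inversions H + card {y\<in>H. y < u} =
    inversions (H - {u}) + card {y\<in>H - {u}. part_index y < part_index u} +
      2 * card {y\<in>H - {u}. y < u \<and> part_index u < part_index y}"
proof -
  let ?A = "H - {u}"
  have fin: "finite H" using stable_finite[OF st] .
  have neq: "part_index y \<noteq> part_index u" if "y \<in> ?A" for y
    using stable_inj[OF st] u that by (auto simp: inj_on_def)
  let ?inv = "\<lambda>H. {(x, y) \<in> H \<times> H. x < y \<and> part_index y < part_index x}"
  let ?B = "{y\<in>?A. y < u \<and> part_index u < part_index y}"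
  let ?C = "{y\<in>?A. u < y \<and> part_index y < part_index u}"
  have "?inv H = ?inv ?A \<union> ((\<lambda>x. (x, u)) ` ?B \<union> (\<lambda>y. (u, y)) ` ?C)" using u by auto
  moreover have "card \<dots> = card (?inv ?A) + card ((\<lambda>x. (x, u)) ` ?B \<union> (\<lambda>y. (u, y)) ` ?C)"
    using fin by (intro card_Un_disjoint finite_subset[of "?inv ?A" "H \<times> H"]) auto
  moreover have "card ((\<lambda>x. (x, u)) ` ?B \<union> (\<lambda>y. (u, y)) ` ?C) =
      card ((\<lambda>x. (x, u)) ` ?B) + card ((\<lambda>y. (u, y)) ` ?C)"
    using fin by (intro card_Un_disjoint) auto
  ultimately have 1: "inversions H = inversions ?A + card ?B + card ?C"
    unfolding inversions_def by (simp add: card_image inj_on_def)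
  have "{y\<in>H. y < u} = {y\<in>?A. y < u}" by auto
  moreover have "{y\<in>?A. y < u \<and> \<not> part_index u < part_index y} =
      {y\<in>?A. y < u \<and> part_index y < part_index u}"
    using neq by (auto simp: not_less order.strict_iff_order)
  ultimately have 2: "card {y\<in>H. y < u} = card ?B + card {y\<in>?A. y < u \<and> part_index y < part_index u}"
    using card_sum_split[of ?A "\<lambda>y. y < u" "\<lambda>y. part_index u < part_index y"] fin by simp
  have "{y\<in>?A. part_index y < part_index u \<and> \<not> y < u} = ?C" by auto
  moreover have "{y\<in>?A. part_index y < part_index u \<and> y < u} = {y\<in>?A. y < u \<and> part_index y < part_index u}"
    by auto
  ultimately have 3: "card {y\<in>?A. part_index y < part_index u} =
      card {y\<in>?A. y < u \<and> part_index y < part_index u} + card ?C"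
    using card_sum_split[of ?A "\<lambda>y. part_index y < part_index u" "\<lambda>y. y < u"] fin by simp
  show ?thesis using 1 2 3 by simp
qed

definition orientation :: "'v set \<Rightarrow> 'k::field" where
  "orientation H = (- 1) ^ inversions H"

lemma orientation_square: "orientation H * orientation H = 1"
  unfolding orientation_def by (simp add: power_mult_distrib[symmetric])

lemma orientation_insertion_sign:
  assumes "stable_set V E H" "u \<in> H"
  shows "orientation H * insertion_sign u H =
    (- 1) ^ (inversions (H - {u}) + card {y\<in>H - {u}. part_index y < part_index u})"
  unfolding orientation_def insertion_sign_def power_add[symmetric] inversions_remove[OF assms]
  by (simp add: power_add power_mult)

subsection \<open>Cochains modulo coboundaries\<close>

text \<open>For fixed \<open>\<sigma>\<close> these sets index a basis of the top cohomology.\<close>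

definition good_facet :: "'v set \<Rightarrow> 'v set \<Rightarrow> bool" where
  "good_facet \<sigma> H \<longleftrightarrow> maximal_stable V E H \<and> \<sigma> \<subseteq> H \<and> (H - \<sigma>) \<inter> W = {}"

definition cross_polytope :: "'v set \<Rightarrow> 'v set \<Rightarrow> 'v set set" where
  "cross_polytope \<sigma> G = {H. maximal_stable V E H \<and> \<sigma> \<subseteq> H \<and> H \<subseteq> G \<union> W}"

text \<open>For a good facet \<open>G\<close>, the facets that arise from it by exchanging vertices outside \<open>\<sigma>\<close>
  for the chosen free vertices in the same parts form the boundary of a cross polytope; this is the
  pairing of a cochain with its fundamental cycle.\<close>

definition cycle_pairing :: "'v set \<Rightarrow> 'v set \<Rightarrow> ('v set \<Rightarrow> 'k::field) \<Rightarrow> 'k" where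
  "cycle_pairing \<sigma> G c =
     (\<Sum>H\<in>cross_polytope \<sigma> G. orientation H * (- 1) ^ card (H - G) * c H)"

lemma maximal_stable_finite: "maximal_stable V E H \<Longrightarrow> finite H"
  using stable_finite maximal_stable_stable by blast

lemma finite_maximal_stable: "finite {H. maximal_stable V E H}"
  by (rule finite_subset[of _ "Pow V"])
    (use finite_vertices in \<open>auto simp: maximal_stable_def stable_set_def\<close>)

lemma finite_cross_polytope: "finite (cross_polytope \<sigma> G)"
  by (rule finite_subset[OF _ finite_maximal_stable]) (auto simp: cross_polytope_def)

lemma good_in_cross_polytope:
  assumes "good_facet \<sigma> G" "H \<in> cross_polytope \<sigma> G" "(H - \<sigma>) \<inter> W = {}"
  shows "H = G"
proof -
  have "H \<subseteq> G" using assms unfolding good_facet_def cross_polytope_def by blast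
  then show ?thesis
    using assms unfolding good_facet_def cross_polytope_def
    by (metis card_subset_eq maximal_stable_card maximal_stable_finite mem_Collect_eq)
qed

lemma cycle_pairing_good:
  assumes G: "good_facet \<sigma> G"
    and c: "\<And>H. H \<in> cross_polytope \<sigma> G \<Longrightarrow> c H \<noteq> 0 \<Longrightarrow> (H - \<sigma>) \<inter> W = {}"
  shows "cycle_pairing \<sigma> G c = orientation G * c G"
proof -
  have "G \<in> cross_polytope \<sigma> G" using G by (auto simp: good_facet_def cross_polytope_def)
  moreover have "orientation H * (- 1) ^ card (H - G) * c H = (if H = G then orientation G * c G else 0)"
    if "H \<in> cross_polytope \<sigma> G" for H
    using good_in_cross_polytope[OF G that] c[OF that] by auto
  ultimately show ?thesis unfolding cycle_pairing_def
    using finite_cross_polytope[of \<sigma> G] by (simp cong: sum.cong)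
qed

text \<open>Exchanging \<open>u\<close> for \<open>v\<close> in the same part preserves the product of orientation and insertion
  sign, but changes the distance to \<open>G\<close> by one; hence the terms cancel in pairs.\<close>

lemma cycle_pairing_coboundary:
  fixes c :: "'v set \<Rightarrow> 'k::field"
  assumes G: "good_facet \<sigma> G" and c: "\<And>A. c A \<noteq> 0 \<Longrightarrow> \<sigma> \<subseteq> A"
  shows "cycle_pairing \<sigma> G (coboundary c) = 0"
proof -
  let ?C = "cross_polytope \<sigma> G"
  have Gm: "maximal_stable V E G" and Gs: "stable_set V E G" and \<sigma>G: "\<sigma> \<subseteq> G" and GW: "(G - \<sigma>) \<inter> W = {}"
    using G maximal_stable_stable by (auto simp: good_facet_def)
  define t where "t p = (case p of (H, u) \<Rightarrow>
    orientation H * (- 1) ^ card (H - G) * (insertion_sign u H * c (H - {u})))" for p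
  define P where "P = {(H, u). H \<in> ?C \<and> u \<in> H \<and> u \<notin> \<sigma> \<and> u \<in> G}"
  define N where "N = {(H, u). H \<in> ?C \<and> u \<in> H \<and> u \<notin> \<sigma> \<and> u \<notin> G}"
  have finC: "finite H" if "H \<in> ?C" for H
    using that maximal_stable_finite by (auto simp: cross_polytope_def)
  have "finite (Sigma ?C (\<lambda>H. H))" using finite_cross_polytope finC by blast
  then have fin: "finite P" "finite N"
    by (rule finite_subset[rotated], auto simp: P_def N_def)+
  have "cycle_pairing \<sigma> G (coboundary c) = (\<Sum>p\<in>Sigma ?C (\<lambda>H. H). t p)"
    unfolding cycle_pairing_def coboundary_def t_def sum_distrib_left
    using finite_cross_polytope finC by (subst sum.Sigma) auto
  also have "\<dots> = (\<Sum>p\<in>P \<union> N. t p)"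
  proof (rule sum.mono_neutral_right)
    show "finite (Sigma ?C (\<lambda>H. H))" using finite_cross_polytope finC by blast
    show "\<forall>p\<in>Sigma ?C (\<lambda>H. H) - (P \<union> N). t p = 0"
      using c by (fastforce simp: t_def P_def N_def)
  qed (auto simp: P_def N_def)
  also have "\<dots> = (\<Sum>p\<in>P. t p) + (\<Sum>p\<in>N. t p)"
    using fin by (intro sum.union_disjoint) (auto simp: P_def N_def)
  also have "(\<Sum>p\<in>P. t p) = (\<Sum>p\<in>N. - t p)"
  proof -
    define to_w where "to_w = (\<lambda>(H, u). (insert (w (part_index u)) (H - {u}), w (part_index u)))"
    define h where "h u = (THE x. x \<in> G \<and> part_index x = part_index u)" for u
    have h: "h u \<in> G \<and> part_index (h u) = part_index u" if uV: "u \<in> V" for u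
    proof -
      obtain x where x: "x \<in> G" "part_index x = part_index u"
        using maximal_stable_meets[OF Gm part_index(1)[OF uV]] by blast
      have "\<exists>!x. x \<in> G \<and> part_index x = part_index u"
        using x inj_onD[OF stable_inj[OF Gs]] by (intro ex1I[of _ x]) auto
      then show ?thesis unfolding h_def by (rule theI')
    qed
    have h_eq: "h u = x" if "x \<in> G" "part_index x = part_index u" "u \<in> V" for u x
      using h[OF that(3)] that stable_inj[OF Gs] unfolding inj_on_def by metis
    define to_h where "to_h = (\<lambda>(H, u). (insert (h u) (H - {u}), h u))"
    have CV: "H \<subseteq> V" "stable_set V E H" if "H \<in> ?C" for H
      using that maximal_stable_stable unfolding cross_polytope_def stable_set_def by blast+
    have others: "part_index x \<noteq> part_index u" if "H \<in> ?C" "u \<in> H" "x \<in> H - {u}" for H u x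
      using stable_inj[OF CV(2)[OF that(1)]] that unfolding inj_on_def by blast
    have maxI: "maximal_stable V E (insert x (H - {u}))"
      if "H \<in> ?C" "u \<in> H" "x \<notin> H - {u}" "stable_set V E (insert x (H - {u}))" for H u x
    proof (rule maximal_stableI[OF that(4)])
      have "card H = m" using that(1) maximal_stable_card by (auto simp: cross_polytope_def)
      then show "card (insert x (H - {u})) = m"
        using that finC[OF that(1)] by (metis card.insert_remove card_Suc_Diff1 finite_Diff insert_Diff_single Diff_insert_absorb card_insert_disjoint)
    qed
    have P_to: "to_w p \<in> N \<and> to_h (to_w p) = p \<and> t p = - t (to_w p)" if "p \<in> P" for p
    proof -
      obtain H u where p: "p = (H, u)" by (cases p)
      have H: "H \<in> ?C" and u: "u \<in> H" "u \<notin> \<sigma>" "u \<in> G" using that by (auto simp: p P_def)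
      let ?i = "part_index u" let ?y = "w ?i" let ?H = "insert ?y (H - {u})"
      have uV: "u \<in> V" using CV(1)[OF H] u(1) by blast
      have i: "?i \<in> {1..m}" using part_index(1)[OF uV] .
      have yW: "?y \<in> W" using i by (rule W_I)
      have "u \<in> G - \<sigma>" using u by simp
      then have "u \<noteq> ?y" using yW GW by (metis IntI emptyE)
      have yi: "part_index ?y = ?i" by (rule part_index_w[OF i])
      have yH: "?y \<notin> H" using others[OF H u(1), of ?y] yi \<open>u \<noteq> ?y\<close> by auto
      have yG: "?y \<notin> G" using stable_inj[OF Gs] u(3) yi \<open>u \<noteq> ?y\<close> unfolding inj_on_def by metis
      have "stable_set V E ?H"
        by (rule stable_insert_w[OF stable_subset[OF CV(2)[OF H]] i]) (use others[OF H u(1)] in auto)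
      then have "maximal_stable V E ?H" using maxI[OF H u(1)] yH by blast
      then have HC: "?H \<in> ?C" using H u yW unfolding cross_polytope_def by auto
      have N: "to_w p \<in> N" using HC yG \<sigma>G by (auto simp: to_w_def p N_def)
      have hy: "h ?y = u" using h_eq[OF u(3)] yi w_in_V[OF i] by simp
      have Hy: "?H - {?y} = H - {u}" using yH by auto
      have "to_h (to_w p) = p" using hy Hy u(1) by (auto simp: to_h_def to_w_def p)
      moreover have "t p = - t (to_w p)"
      proof -
        have "?H - G = insert ?y (H - G)" using yG u(3) by auto
        moreover have "?y \<notin> H - G" using yH by blast
        ultimately have "card (?H - G) = Suc (card (H - G))" using finC[OF H] by simp
        moreover have "orientation ?H * insertion_sign ?y ?H = (orientation H * insertion_sign u H :: 'k)"
        proof -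
          let ?rhs = "(- 1) ^ (inversions (H - {u}) + card {y\<in>H - {u}. part_index y < part_index u}) :: 'k"
          have "orientation ?H * insertion_sign ?y ?H = ?rhs"
            using orientation_insertion_sign[OF CV(2)[OF HC], of ?y] by (simp add: Hy yi)
          moreover have "orientation H * insertion_sign u H = ?rhs"
            by (rule orientation_insertion_sign[OF CV(2)[OF H] u(1)])
          ultimately show ?thesis by simp
        qed
        moreover have "t (H', u') = orientation H' * insertion_sign u' H' * ((- 1) ^ card (H' - G) * c (H' - {u'}))" for H' u'
          by (simp add: t_def mult_ac)
        ultimately show ?thesis by (simp add: p to_w_def Hy)
      qed
      ultimately show ?thesis using N by blast
    qed
    have N_to: "to_h p \<in> P \<and> to_w (to_h p) = p" if "p \<in> N" for p
    proof -
      obtain H u where p: "p = (H, u)" by (cases p)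
      have H: "H \<in> ?C" and u: "u \<in> H" "u \<notin> \<sigma>" "u \<notin> G" using that by (auto simp: p N_def)
      have uV: "u \<in> V" using CV(1)[OF H] u(1) by blast
      let ?i = "part_index u" let ?H = "insert (h u) (H - {u})"
      have "u \<in> W" using H u unfolding cross_polytope_def by blast
      then have wu: "w ?i = u" using part_index_w by (auto elim!: W_E)
      have hu: "h u \<in> G" "part_index (h u) = ?i" using h[OF uV] by auto
      have "h u \<noteq> u" using hu u by metis
      have hH: "h u \<notin> H" using others[OF H u(1), of "h u"] hu \<open>h u \<noteq> u\<close> by auto
      have hV: "h u \<in> V" using hu Gs by (auto simp: stable_set_def)
      have ne: "{h u, x} \<notin> E" if x: "x \<in> H - {u}" for x
      proof (cases "x \<in> G")
        case True
        then show ?thesis using hu Gs by (auto simp: stable_set_def)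
      next
        case False
        then have "x \<in> W" using x H unfolding cross_polytope_def by blast
        then obtain j where j: "j \<in> {1..m}" "x = w j" by (rule W_E)
        have "j \<noteq> ?i" using others[OF H u(1) x] j part_index_w by metis
        then show ?thesis using w_neighbour[OF j(1), of "h u"] j part_index_unique[OF hV j(1)] hu
          by (auto simp: insert_commute)
      qed
      have "stable_set V E ?H"
        using CV(2)[OF H] ne hV no_loop unfolding stable_set_def by (auto simp: insert_commute)
      then have "maximal_stable V E ?H" using maxI[OF H u(1)] hH by blast
      then have HC: "?H \<in> ?C" using H u hu unfolding cross_polytope_def by auto
      have "h u \<notin> \<sigma>" using hH H unfolding cross_polytope_def by blast
      then have "to_h p \<in> P" using HC hu by (auto simp: to_h_def p P_def)
      moreover have "to_w (to_h p) = p" using hH hu wu u(1) by (auto simp: to_h_def to_w_def p)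
      ultimately show ?thesis by blast
    qed
    show ?thesis
      by (rule sum.reindex_bij_witness[of P to_h to_w]) (use P_to N_to in auto)
  qed
  finally show ?thesis by (simp add: sum_negf)
qed

definition facet_cochain :: "'v set \<Rightarrow> ('v set \<Rightarrow> 'k::field) \<Rightarrow> bool" where
  "facet_cochain \<sigma> c \<longleftrightarrow> (\<forall>H. c H \<noteq> 0 \<longrightarrow> maximal_stable V E H \<and> \<sigma> \<subseteq> H)"

definition ridge_cochain :: "'v set \<Rightarrow> ('v set \<Rightarrow> 'k::field) \<Rightarrow> bool" where
  "ridge_cochain \<sigma> b \<longleftrightarrow>
     (\<forall>A. b A \<noteq> 0 \<longrightarrow> \<sigma> \<subseteq> A \<and> (\<exists>v. v \<notin> A \<and> maximal_stable V E (insert v A)))"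

lemma ridge_cochain_contraction:
  assumes "facet_cochain \<sigma> c" "v \<notin> \<sigma>"
  shows "ridge_cochain \<sigma> (contraction v c)"
  unfolding ridge_cochain_def
proof (intro allI impI)
  fix A assume "contraction v c A \<noteq> 0"
  then have "v \<notin> A" "c (insert v A) \<noteq> 0" by (auto simp: contraction_def split: if_splits)
  then show "\<sigma> \<subseteq> A \<and> (\<exists>v. v \<notin> A \<and> maximal_stable V E (insert v A))"
    using assms unfolding facet_cochain_def by blast
qed

lemma ridge_cochain_add:
  "ridge_cochain \<sigma> b \<Longrightarrow> ridge_cochain \<sigma> b' \<Longrightarrow> ridge_cochain \<sigma> (\<lambda>A. b A + b' A)"
  unfolding ridge_cochain_def by (metis add_0)

lemma coboundary_ridge_cochain:
  assumes "ridge_cochain \<sigma> b" "coboundary b H \<noteq> 0"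
  shows "\<sigma> \<subseteq> H"
proof -
  have "\<exists>v\<in>H. insertion_sign v H * b (H - {v}) \<noteq> 0"
    using assms(2) unfolding coboundary_def by (meson sum.neutral)
  then show ?thesis using assms(1) unfolding ridge_cochain_def by fastforce
qed

text \<open>Contracting with one free vertex after the other makes the cochain vanish on all facets that
  contain one of them outside \<open>\<sigma>\<close>: a facet containing an earlier one, \<open>y'\<close>, is only affected by
  facets that contain \<open>y'\<close> too, because a facet cannot miss a part.\<close>

lemma kill_free_vertices:
  assumes c: "facet_cochain \<sigma> c"
  shows "\<exists>b. ridge_cochain \<sigma> b \<and>
    (\<forall>H. maximal_stable V E H \<longrightarrow> (H - \<sigma>) \<inter> W \<noteq> {} \<longrightarrow> coboundary b H = c H)"
proof -
  have "finite U \<Longrightarrow> U \<subseteq> W - \<sigma> \<Longrightarrow> \<exists>b. ridge_cochain \<sigma> b \<and>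
    (\<forall>H. maximal_stable V E H \<longrightarrow> H \<inter> U \<noteq> {} \<longrightarrow> coboundary b H = c H)" for U
  proof (induction U rule: finite_induct)
    case empty
    show ?case by (rule exI[of _ "\<lambda>_. 0"]) (auto simp: ridge_cochain_def)
  next
    case (insert y U)
    then obtain b where b: "ridge_cochain \<sigma> b"
      "\<And>H. maximal_stable V E H \<Longrightarrow> H \<inter> U \<noteq> {} \<Longrightarrow> coboundary b H = c H" by auto
    define c' where "c' H = (if maximal_stable V E H then c H - coboundary b H else 0)" for H
    have c': "facet_cochain \<sigma> c'"
      unfolding facet_cochain_def c'_def
      using c coboundary_ridge_cochain[OF b(1)] unfolding facet_cochain_def by (metis diff_0_right)
    have y: "y \<notin> \<sigma>" "y \<in> W" using insert.prems by auto
    let ?b = "\<lambda>A. b A + contraction y c' A"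
    have "coboundary ?b H = c H" if H: "maximal_stable V E H" "H \<inter> insert y U \<noteq> {}" for H
    proof (cases "y \<in> H")
      case True
      then show ?thesis
        using coboundary_contraction[OF maximal_stable_finite[OF H(1)] True, of c'] H(1)
        by (simp add: coboundary_add c'_def)
    next
      case False
      then obtain y' where y': "y' \<in> H" "y' \<in> U" using H by blast
      have "contraction y c' (H - {u}) = 0" if "u \<in> H" for u
      proof -
        have "c' (insert y (H - {u})) = 0"
        proof (cases "u = y'")
          case True
          have "\<not> maximal_stable V E (insert y (H - {u}))"
          proof
            assume max: "maximal_stable V E (insert y (H - {u}))"
            have uV: "u \<in> V" using H(1) that by (auto simp: maximal_stable_def stable_set_def)
            obtain z where z: "z \<in> insert y (H - {u})" "part_index z = part_index u"
              using maximal_stable_meets[OF max part_index(1)[OF uV]] by blast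
            have "part_index y \<noteq> part_index u"
            proof -
              obtain i where i: "i \<in> {1..m}" "y = w i" using y(2) by (rule W_E)
              have "y' \<in> W" using y'(2) insert.prems by blast
              then obtain j where j: "j \<in> {1..m}" "y' = w j" by (rule W_E)
              show ?thesis using i j part_index_w True y' insert.hyps(2) by metis
            qed
            then show False
              using z stable_inj[OF maximal_stable_stable[OF H(1)]] that unfolding inj_on_def by blast
          qed
          then show ?thesis by (simp add: c'_def)
        next
          case False
          then have "insert y (H - {u}) \<inter> U \<noteq> {}" using y' by blast
          then show ?thesis using b(2)[of "insert y (H - {u})"] by (simp add: c'_def)
        qed
        then show ?thesis by (simp add: contraction_def)
      qed
      then have "coboundary (contraction y c') H = 0" by (simp add: coboundary_def)
      then show ?thesis using b(2)[OF H(1)] y' by (auto simp: coboundary_add)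
    qed
    moreover have "ridge_cochain \<sigma> ?b"
      using ridge_cochain_add[OF b(1) ridge_cochain_contraction[OF c' y(1)]] .
    ultimately show ?case by blast
  qed
  from this[of "W - \<sigma>"] have "\<exists>b. ridge_cochain \<sigma> b \<and>
      (\<forall>H. maximal_stable V E H \<longrightarrow> H \<inter> (W - \<sigma>) \<noteq> {} \<longrightarrow> coboundary b H = c H)"
    by (simp add: W_def)
  moreover have "H \<inter> (W - \<sigma>) = (H - \<sigma>) \<inter> W" for H by blast
  ultimately show ?thesis by simp
qed

text \<open>After elimination of the free vertices only good facets are left in the support, and on such
  a cochain the pairings are its values up to sign.\<close>

theorem coboundary_if_pairings_vanish:
  fixes c :: "'v set \<Rightarrow> 'k::field"
  assumes c: "facet_cochain \<sigma> c" and zero: "\<And>G. good_facet \<sigma> G \<Longrightarrow> cycle_pairing \<sigma> G c = 0"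
  shows "\<exists>b. ridge_cochain \<sigma> b \<and> (\<forall>H. maximal_stable V E H \<longrightarrow> coboundary b H = c H)"
proof -
  obtain b where b: "ridge_cochain \<sigma> b"
    "\<And>H. maximal_stable V E H \<Longrightarrow> (H - \<sigma>) \<inter> W \<noteq> {} \<Longrightarrow> coboundary b H = c H"
    using kill_free_vertices[OF c] by blast
  have "coboundary b H = c H" if H: "maximal_stable V E H" for H
  proof (cases "(H - \<sigma>) \<inter> W = {} \<and> \<sigma> \<subseteq> H")
    case True
    then have G: "good_facet \<sigma> H" using H by (simp add: good_facet_def)
    let ?d = "\<lambda>H. c H - coboundary b H"
    have "cycle_pairing \<sigma> H ?d = cycle_pairing \<sigma> H c - cycle_pairing \<sigma> H (coboundary b)"
      by (simp add: cycle_pairing_def algebra_simps sum_subtractf)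
    also have "\<dots> = 0"
      using zero[OF G] cycle_pairing_coboundary[OF G, of b] b(1) unfolding ridge_cochain_def by auto
    finally have "cycle_pairing \<sigma> H ?d = 0" .
    moreover have "(H' - \<sigma>) \<inter> W = {}" if "H' \<in> cross_polytope \<sigma> H" "?d H' \<noteq> 0" for H'
      using that b(2)[of H'] by (auto simp: cross_polytope_def)
    ultimately have "orientation H * ?d H = 0"
      using cycle_pairing_good[OF G, of ?d] by simp
    moreover have "(orientation H :: 'k) \<noteq> 0" by (simp add: orientation_def)
    ultimately show ?thesis by simp
  next
    case False
    then consider "(H - \<sigma>) \<inter> W \<noteq> {}" | "\<not> \<sigma> \<subseteq> H" by blast
    then show ?thesis
    proof cases
      case 1
      then show ?thesis using b(2)[OF H] by blast
    next
      case 2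
      then have "c H = 0" "coboundary b H = 0"
        using c coboundary_ridge_cochain[OF b(1), of H] unfolding facet_cochain_def by auto
      then show ?thesis by simp
    qed
  qed
  then show ?thesis using b(1) by blast
qed

end


section \<open>The top local cohomology module\<close>

locale stanley_reisner_partition =
  stanley_reisner V E field_type + simplex_partition V E F w m
  for V :: "'v::linorder set" and E and field_type :: "'k::field itself" and F w m
begin

abbreviation cochains :: "nat \<Rightarrow> (('v, 'k) mpoly, 'v set \<Rightarrow> (('v, 'k) mpoly set \<times> nat) set) module" where
  "cochains p \<equiv> cech_cochains R M variable V p"

abbreviation faces :: "nat \<Rightarrow> 'v set set" where
  "faces p \<equiv> {A. A \<subseteq> V \<and> card A = p}"

lemma cochains_simps:
  "carrier (cochains p) = (\<Pi>\<^sub>E A\<in>faces p. carrier (L A))"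
  "\<zero>\<^bsub>cochains p\<^esub> = (\<lambda>A\<in>faces p. \<zero>\<^bsub>L A\<^esub>)"
  "c \<oplus>\<^bsub>cochains p\<^esub> d = (\<lambda>A\<in>faces p. c A \<oplus>\<^bsub>L A\<^esub> d A)"
  "r \<odot>\<^bsub>cochains p\<^esub> c = (\<lambda>A\<in>faces p. r \<odot>\<^bsub>L A\<^esub> c A)"
  unfolding cech_cochains_def by (simp_all add: Let_def)

lemma cochain_entry: "c \<in> carrier (cochains p) \<Longrightarrow> A \<in> faces p \<Longrightarrow> c A \<in> carrier (L A)"
  unfolding cochains_simps by blast

lemma cochain_ext:
  assumes "c \<in> carrier (cochains p)" "d \<in> carrier (cochains p)"
    and "\<And>A a. A \<in> faces p \<Longrightarrow> coord A (c A) a = coord A (d A) a"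
  shows "c = d"
proof (rule PiE_ext)
  show "c \<in> (\<Pi>\<^sub>E A\<in>faces p. carrier (L A))" "d \<in> (\<Pi>\<^sub>E A\<in>faces p. carrier (L A))"
    using assms(1,2) unfolding cochains_simps .
  fix A assume A: "A \<in> faces p"
  show "c A = d A"
    by (rule coord_inject[of A])
      (use A assms(3)[OF A] cochain_entry[OF assms(1) A] cochain_entry[OF assms(2) A] in auto)
qed

lemma cochain_add:
  assumes "c \<in> carrier (cochains p)" "d \<in> carrier (cochains p)"
  shows "c \<oplus>\<^bsub>cochains p\<^esub> d \<in> carrier (cochains p)"
    "A \<in> faces p \<Longrightarrow> coord A ((c \<oplus>\<^bsub>cochains p\<^esub> d) A) a = coord A (c A) a + coord A (d A) a"
  using coord_add[OF _ cochain_entry[OF assms(1)] cochain_entry[OF assms(2)]]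
  unfolding cochains_simps by auto

lemma cochain_smult:
  assumes "c \<in> carrier (cochains p)"
  shows "scalar k \<odot>\<^bsub>cochains p\<^esub> c \<in> carrier (cochains p)"
    "A \<in> faces p \<Longrightarrow> coord A ((scalar k \<odot>\<^bsub>cochains p\<^esub> c) A) a = k * coord A (c A) a"
  using coord_smult[OF _ cochain_entry[OF assms]]
  unfolding cochains_simps by auto

lemma cochain_zero:
  "\<zero>\<^bsub>cochains p\<^esub> \<in> carrier (cochains p)"
  "A \<in> faces p \<Longrightarrow> coord A (\<zero>\<^bsub>cochains p\<^esub> A) a = 0"
  unfolding cochains_simps by (auto simp: zero_closed_L coord_zero)

lemma sign_eq_scalar: "(\<ominus>\<^bsub>R\<^esub> \<one>\<^bsub>R\<^esub>) [^]\<^bsub>R\<^esub> (n::nat) = scalar ((- 1) ^ n)"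
proof -
  have one: "(1 :: ('v, 'k) mpoly) \<in> polys V" by (rule polys.S_one)
  have "\<ominus>\<^bsub>R\<^esub> \<one>\<^bsub>R\<^esub> = - 1"
    using R.minus_equality[of "- 1" "1"] one polys.S_uminus[OF one] by simp
  moreover have "(- 1) ^ n = (scalar ((- 1) ^ n) :: ('v, 'k) mpoly)"
    by (induction n) (simp_all add: scalar_def mult_single[symmetric] single_uminus[symmetric] del: mult_minus1)
  ultimately show ?thesis by (simp add: pow_R)
qed

lemma coord_differential:
  assumes c: "c \<in> carrier (cochains p)" and B: "B \<in> faces (Suc p)"
  shows "cech_differential R M variable V p c B \<in> carrier (L B)"
    "coord B (cech_differential R M variable V p c B) a =
      (if stable_set V E (B \<union> keys a)
       then coboundary (\<lambda>A. if A \<in> faces p then coord A (c A) a else 0) B else 0)"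
proof -
  have BV: "B \<subseteq> V" and finB: "finite B" using B finite_sub by auto
  have sub: "B - {v} \<in> faces p" if "v \<in> B" for v using B that finB by auto
  interpret LB: abelian_monoid "L B" by (rule abelian_monoid_L[OF BV])
  define t where "t v = ((\<ominus>\<^bsub>R\<^esub> \<one>\<^bsub>R\<^esub>) [^]\<^bsub>R\<^esub> card {u\<in>B. u < v}) \<odot>\<^bsub>L B\<^esub>
      localization_map R M (variable v) (xprod B) (c (B - {v}))" for v
  have d: "cech_differential R M variable V p c B = finsum (L B) t B"
    using B unfolding cech_differential_def t_def by simp
  note lm = coord_localization_map[OF BV _ cochain_entry[OF c sub]]
  have t: "t v \<in> carrier (L B)" "coord B (t v) a =
      insertion_sign v B * (if stable_set V E (B \<union> keys a) then coord (B - {v}) (c (B - {v})) a else 0)"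
    if "v \<in> B" for v a
    unfolding t_def sign_eq_scalar insertion_sign_def
    using coord_smult[OF BV lm(1)[OF that that]] lm(2)[OF that that] by simp_all
  show "cech_differential R M variable V p c B \<in> carrier (L B)"
    unfolding d using t(1) by (intro LB.finsum_closed) auto
  have "coord B (finsum (L B) t B) a = (\<Sum>v\<in>B. coord B (t v) a)"
    by (rule additive_finsum[where \<theta> = "\<lambda>P. coord B P a"])
      (use coord_add[OF BV] coord_zero[OF BV] LB.abelian_monoid_axioms finB t(1) in auto)
  also have "\<dots> = (if stable_set V E (B \<union> keys a)
       then coboundary (\<lambda>A. if A \<in> faces p then coord A (c A) a else 0) B else 0)"
  proof (cases "stable_set V E (B \<union> keys a)")
    case True
    then show ?thesis unfolding coboundary_def using t(2) sub by (auto intro!: sum.cong)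
  next
    case False
    then have "coord B (t v) a = 0" if "v \<in> B" for v using t(2)[OF that] by simp
    then show ?thesis using False by simp
  qed
  finally show "coord B (cech_differential R M variable V p c B) a =
      (if stable_set V E (B \<union> keys a)
       then coboundary (\<lambda>A. if A \<in> faces p then coord A (c A) a else 0) B else 0)"
    unfolding d .
qed

lemma differential_closed:
  assumes "c \<in> carrier (cochains p)"
  shows "cech_differential R M variable V p c \<in> carrier (cochains (Suc p))"
  unfolding cochains_simps
proof (rule PiE_I)
  fix B assume "B \<in> faces (Suc p)"
  then show "cech_differential R M variable V p c B \<in> carrier (L B)"
    by (rule coord_differential(1)[OF assms])
next
  fix B assume "B \<notin> faces (Suc p)"
  then show "cech_differential R M variable V p c B = undefined"
    unfolding cech_differential_def by (simp only: restrict_apply if_False)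
qed

text \<open>The complex vanishes above degree \<open>m\<close>, since no set with more than \<open>m\<close> vertices is stable.\<close>

lemma top_cocycles: "cech_cocycles R M variable V m = carrier (cochains m)"
proof -
  have "cech_differential R M variable V m c = \<zero>\<^bsub>cochains (Suc m)\<^esub>" if c: "c \<in> carrier (cochains m)" for c
  proof (rule cochain_ext)
    show "cech_differential R M variable V m c \<in> carrier (cochains (Suc m))"
      by (rule differential_closed[OF c])
    show "\<zero>\<^bsub>cochains (Suc m)\<^esub> \<in> carrier (cochains (Suc m))" by (rule cochain_zero)
    fix A and a :: "'v \<Rightarrow>\<^sub>0 int" assume A: "A \<in> faces (Suc m)"
    have "\<not> stable_set V E (A \<union> keys a)"
    proof
      assume "stable_set V E (A \<union> keys a)"
      then have "stable_set V E A" by (rule stable_subset) blast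
      then show False using stable_card_le[of A] A by simp
    qed
    then show "coord A (cech_differential R M variable V m c A) a = coord A (\<zero>\<^bsub>cochains (Suc m)\<^esub> A) a"
      using coord_differential(2)[OF c A] cochain_zero(2)[OF A] by simp
  qed
  then show ?thesis unfolding cech_cocycles_def by auto
qed

definition pairing_index :: "(('v \<Rightarrow>\<^sub>0 int) \<times> 'v set) set" where
  "pairing_index = {(a, G). (\<forall>v. lookup a v \<le> 0) \<and> good_facet (keys a) G}"

definition pairing :: "('v set \<Rightarrow> (('v, 'k) mpoly set \<times> nat) set) \<Rightarrow> ('v \<Rightarrow>\<^sub>0 int) \<times> 'v set \<Rightarrow> 'k" where
  "pairing c = (\<lambda>(a, G). if (a, G) \<in> pairing_index
     then cycle_pairing (keys a) G (\<lambda>H. coord H (c H) a) else 0)"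

lemma facet_face: "maximal_stable V E H \<Longrightarrow> H \<in> faces m"
  using maximal_stable_card maximal_stable_stable by (auto simp: stable_set_def)

lemma cross_polytope_face: "H \<in> cross_polytope \<sigma> G \<Longrightarrow> H \<in> faces m"
  using facet_face by (simp add: cross_polytope_def)

lemma cycle_pairing_cong:
  "(\<And>H. H \<in> cross_polytope \<sigma> G \<Longrightarrow> c H = d H) \<Longrightarrow> cycle_pairing \<sigma> G c = cycle_pairing \<sigma> G d"
  unfolding cycle_pairing_def by (rule sum.cong) auto

lemma pairing_add:
  assumes "c \<in> carrier (cochains m)" "d \<in> carrier (cochains m)"
  shows "pairing (c \<oplus>\<^bsub>cochains m\<^esub> d) t = pairing c t + pairing d t"
proof -
  have "cycle_pairing \<sigma> G (\<lambda>H. coord H ((c \<oplus>\<^bsub>cochains m\<^esub> d) H) a) =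
      cycle_pairing \<sigma> G (\<lambda>H. coord H (c H) a) + cycle_pairing \<sigma> G (\<lambda>H. coord H (d H) a)" for \<sigma> G a
    unfolding cycle_pairing_def sum.distrib[symmetric]
  proof (rule sum.cong)
    fix H assume "H \<in> cross_polytope \<sigma> G"
    from cochain_add(2)[OF assms cross_polytope_face[OF this], of a]
    show "orientation H * (- 1) ^ card (H - G) * coord H ((c \<oplus>\<^bsub>cochains m\<^esub> d) H) a =
        orientation H * (- 1) ^ card (H - G) * coord H (c H) a +
        orientation H * (- 1) ^ card (H - G) * coord H (d H) a"
      by (simp only: distrib_left)
  qed simp
  then show ?thesis by (simp add: pairing_def split: prod.split)
qed

lemma pairing_smult:
  assumes "c \<in> carrier (cochains m)"
  shows "pairing (scalar k \<odot>\<^bsub>cochains m\<^esub> c) t = k * pairing c t"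
proof -
  have "cycle_pairing \<sigma> G (\<lambda>H. coord H ((scalar k \<odot>\<^bsub>cochains m\<^esub> c) H) a) =
      k * cycle_pairing \<sigma> G (\<lambda>H. coord H (c H) a)" for \<sigma> G a
    unfolding cycle_pairing_def sum_distrib_left
  proof (rule sum.cong)
    fix H assume "H \<in> cross_polytope \<sigma> G"
    from cochain_smult(2)[OF assms cross_polytope_face[OF this], of k a]
    show "orientation H * (- 1) ^ card (H - G) * coord H ((scalar k \<odot>\<^bsub>cochains m\<^esub> c) H) a =
        k * (orientation H * (- 1) ^ card (H - G) * coord H (c H) a)"
      by (simp only: mult_ac)
  qed simp
  then show ?thesis by (simp add: pairing_def split: prod.split)
qed

lemma coboundary_pairing_zero:
  assumes c: "c \<in> cech_coboundaries R M variable V m"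
  shows "pairing c t = 0"
proof (cases m)
  case 0
  then have c0: "c = \<zero>\<^bsub>cochains m\<^esub>" using c by (simp add: cech_coboundaries_def)
  have "cycle_pairing \<sigma> G (\<lambda>H. coord H (c H) a) = 0" for \<sigma> G a
    unfolding cycle_pairing_def c0
  proof (intro sum.neutral ballI)
    fix H assume "H \<in> cross_polytope \<sigma> G"
    from cochain_zero(2)[OF cross_polytope_face[OF this], of a]
    show "orientation H * (- 1) ^ card (H - G) * coord H (\<zero>\<^bsub>cochains m\<^esub> H) a = 0" by simp
  qed
  then show ?thesis by (simp add: pairing_def split: prod.split)
next
  case (Suc q)
  then obtain b where b: "b \<in> carrier (cochains q)" "c = cech_differential R M variable V q b"
    using c by (auto simp: cech_coboundaries_def)
  have "cycle_pairing (keys a) G (\<lambda>H. coord H (c H) a) = 0" if t: "(a, G) \<in> pairing_index" for a G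
  proof -
    have neg: "\<forall>v. lookup a v \<le> 0" and G: "good_facet (keys a) G"
      using t by (auto simp: pairing_index_def)
    let ?b = "\<lambda>A. if A \<in> faces q then coord A (b A) a else 0"
    have "cycle_pairing (keys a) G (\<lambda>H. coord H (c H) a) = cycle_pairing (keys a) G (coboundary ?b)"
    proof (rule cycle_pairing_cong)
      fix H assume H: "H \<in> cross_polytope (keys a) G"
      then have "H \<union> keys a = H" "maximal_stable V E H" by (auto simp: cross_polytope_def)
      then have "stable_set V E (H \<union> keys a)" using maximal_stable_stable by simp
      then show "coord H (c H) a = coboundary ?b H"
        using coord_differential(2)[OF b(1), of H a] cross_polytope_face[OF H] b(2) Suc by simp
    qed
    also have "\<dots> = 0"
    proof (rule cycle_pairing_coboundary[OF G])
      fix A assume "?b A \<noteq> 0"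
      then have "admissible A a"
        using coord_admissible[of A "b A" a] cochain_entry[OF b(1), of A] by (auto split: if_splits)
      then show "keys a \<subseteq> A"
        using neg by (force simp: admissible_def in_keys_iff intro: antisym)
    qed
    finally show ?thesis .
  qed
  then show ?thesis by (simp add: pairing_def split: prod.split)
qed

text \<open>In a fixed multidegree the complex is the one studied above if no exponent is positive, and
  contracting with a vertex of positive exponent shows that it has no cohomology otherwise.\<close>

lemma solve_multidegree:
  assumes c: "\<And>H. maximal_stable V E H \<Longrightarrow> c H \<noteq> 0 \<Longrightarrow> admissible H a"
    and zero: "\<And>G. (a, G) \<in> pairing_index \<Longrightarrow> cycle_pairing (keys a) G c = 0"
  shows "\<exists>b. (\<forall>A. b A \<noteq> (0::'k) \<longrightarrow> admissible A a \<and> Suc (card A) = m) \<and>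
    (\<forall>H. maximal_stable V E H \<longrightarrow> keys a \<subseteq> H \<longrightarrow> coboundary b H = c H)"
proof -
  define c' where "c' H = (if maximal_stable V E H then c H else 0)" for H
  have keys: "keys a \<subseteq> H" if "maximal_stable V E H" "admissible H a" for H
    using that unfolding maximal_stable_def admissible_def by (metis Un_upper1 Un_upper2)
  have c': "facet_cochain (keys a) c'"
    unfolding facet_cochain_def c'_def using c keys by auto
  show ?thesis
  proof (cases "\<exists>v. 0 < lookup a v")
    case True
    then obtain v where v: "0 < lookup a v" by blast
    then have vk: "v \<in> keys a" by (simp add: in_keys_iff)
    let ?b = "contraction v c'"
    have "admissible A a \<and> Suc (card A) = m" if "?b A \<noteq> 0" for A
    proof -
      have vA: "v \<notin> A" and nz: "c' (insert v A) \<noteq> 0"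
        using that by (auto simp: contraction_def split: if_splits)
      then have max: "maximal_stable V E (insert v A)" and adm: "admissible (insert v A) a"
        using c[of "insert v A"] by (auto simp: c'_def split: if_splits)
      have "stable_set V E (A \<union> keys a)"
        using adm unfolding admissible_def by (meson Un_mono order_refl stable_subset subset_insertI)
      moreover have "0 \<le> lookup a u" if "u \<notin> A" for u
        using adm that v unfolding admissible_def by (cases "u = v") auto
      moreover have "Suc (card A) = m"
        using maximal_stable_card[OF max] maximal_stable_finite[OF max] vA by simp
      ultimately show ?thesis by (simp add: admissible_def)
    qed
    moreover have "coboundary ?b H = c H" if "maximal_stable V E H" "keys a \<subseteq> H" for H
      using coboundary_contraction[of H v c'] maximal_stable_finite[OF that(1)] that vk
      by (auto simp: c'_def)
    ultimately show ?thesis by blast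
  next
    case False
    then have neg: "\<forall>v. lookup a v \<le> 0" by (simp add: not_less)
    have "cycle_pairing (keys a) G c' = 0" if "good_facet (keys a) G" for G
    proof -
      have "cycle_pairing (keys a) G c' = cycle_pairing (keys a) G c"
        by (rule cycle_pairing_cong) (simp add: c'_def cross_polytope_def)
      then show ?thesis using zero[of G] neg that by (simp add: pairing_index_def)
    qed
    from coboundary_if_pairings_vanish[OF c' this] obtain b where b: "ridge_cochain (keys a) b"
      "\<And>H. maximal_stable V E H \<Longrightarrow> coboundary b H = c' H" by blast
    have "admissible A a \<and> Suc (card A) = m" if nz: "b A \<noteq> 0" for A
    proof -
      obtain v where kA: "keys a \<subseteq> A" and v: "v \<notin> A" "maximal_stable V E (insert v A)"
        using b(1) nz unfolding ridge_cochain_def by blast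
      have "A \<union> keys a \<subseteq> insert v A" using kA by blast
      then have "stable_set V E (A \<union> keys a)" by (rule stable_subset[OF maximal_stable_stable[OF v(2)]])
      moreover have "0 \<le> lookup a u" if "u \<notin> A" for u
      proof -
        have "u \<notin> keys a" using kA that by blast
        then show ?thesis by (simp add: in_keys_iff)
      qed
      moreover have "Suc (card A) = m"
        using maximal_stable_card[OF v(2)] maximal_stable_finite[OF v(2)] v(1) by simp
      ultimately show ?thesis by (simp add: admissible_def)
    qed
    moreover have "coboundary b H = c H" if "maximal_stable V E H" for H
      using b(2)[OF that] that by (simp add: c'_def)
    ultimately show ?thesis by blast
  qed
qed

text \<open>Solutions in the single multidegrees are put together; only the finitely many multidegrees in
  which \<open>c\<close> does not vanish need one.\<close>

theorem coboundary_iff_pairing_zero: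
  assumes c: "c \<in> carrier (cochains m)"
  shows "c \<in> cech_coboundaries R M variable V m \<longleftrightarrow> pairing c = (\<lambda>_. 0)"
proof
  assume zero: "pairing c = (\<lambda>_. 0)"
  have adm: "admissible H a" if "H \<in> faces m" "coord H (c H) a \<noteq> 0" for H a
    using that coord_admissible[of H "c H" a] cochain_entry[OF c] by auto
  have facet: "maximal_stable V E H" if "H \<in> faces m" "admissible H a" for H a
    using that maximal_stableI stable_subset[of "H \<union> keys a" H] by (auto simp: admissible_def)
  have zero': "cycle_pairing (keys a) G (\<lambda>H. coord H (c H) a) = 0" if "(a, G) \<in> pairing_index" for a G
    using fun_cong[OF zero, of "(a, G)"] that by (simp add: pairing_def)
  have solve: "\<exists>b. (\<forall>A. b A \<noteq> (0::'k) \<longrightarrow> admissible A a \<and> Suc (card A) = m) \<and>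
      (\<forall>H. maximal_stable V E H \<longrightarrow> keys a \<subseteq> H \<longrightarrow> coboundary b H = coord H (c H) a)" for a
    by (rule solve_multidegree[OF adm zero']) (auto dest: facet_face)
  show "c \<in> cech_coboundaries R M variable V m"
  proof (cases m)
    case 0
    have "c = \<zero>\<^bsub>cochains m\<^esub>"
    proof (rule cochain_ext[OF c cochain_zero(1)])
      fix A a assume A: "A \<in> faces m"
      have "coord A (c A) a = 0"
      proof (rule ccontr)
        assume nz: "coord A (c A) a \<noteq> 0"
        have max: "maximal_stable V E A" using facet[OF A adm[OF A nz]] .
        have "keys a \<subseteq> A"
          using max adm[OF A nz] unfolding maximal_stable_def admissible_def by (metis Un_upper1 Un_upper2)
        moreover obtain b where b: "\<forall>B. b B \<noteq> (0::'k) \<longrightarrow> admissible B a \<and> Suc (card B) = m"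
          "\<forall>H. maximal_stable V E H \<longrightarrow> keys a \<subseteq> H \<longrightarrow> coboundary b H = coord H (c H) a"
          using solve[of a] by (elim exE conjE)
        moreover have "b = (\<lambda>_. 0)" using b(1) 0 by auto
        ultimately show False using max nz by (simp add: coboundary_def)
      qed
      then show "coord A (c A) a = coord A (\<zero>\<^bsub>cochains m\<^esub> A) a" using cochain_zero(2)[OF A] by simp
    qed
    then show ?thesis using 0 by (simp add: cech_coboundaries_def)
  next
    case (Suc q)
    \<comment> \<open>In multidegrees where \<open>c\<close> vanishes the solution is taken to be zero, so that only finitely
      many multidegrees contribute.\<close>
    have "\<forall>a. \<exists>b. (\<forall>A. b A \<noteq> (0::'k) \<longrightarrow> admissible A a \<and> card A = q) \<and>
      (\<forall>H. maximal_stable V E H \<longrightarrow> keys a \<subseteq> H \<longrightarrow> coboundary b H = coord H (c H) a) \<and>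
      ((\<forall>H. maximal_stable V E H \<longrightarrow> coord H (c H) a = 0) \<longrightarrow> b = (\<lambda>_. 0))"
    proof
      fix a
      show "\<exists>b. (\<forall>A. b A \<noteq> (0::'k) \<longrightarrow> admissible A a \<and> card A = q) \<and>
        (\<forall>H. maximal_stable V E H \<longrightarrow> keys a \<subseteq> H \<longrightarrow> coboundary b H = coord H (c H) a) \<and>
        ((\<forall>H. maximal_stable V E H \<longrightarrow> coord H (c H) a = 0) \<longrightarrow> b = (\<lambda>_. 0))"
      proof (cases "\<forall>H. maximal_stable V E H \<longrightarrow> coord H (c H) a = 0")
        case True
        then show ?thesis by (intro exI[of _ "\<lambda>_. 0"]) (simp add: coboundary_def)
      next
        case False
        obtain b where b: "\<forall>B. b B \<noteq> (0::'k) \<longrightarrow> admissible B a \<and> Suc (card B) = m"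
          "\<forall>H. maximal_stable V E H \<longrightarrow> keys a \<subseteq> H \<longrightarrow> coboundary b H = coord H (c H) a"
          using solve[of a] by (elim exE conjE)
        show ?thesis
        proof (intro exI[of _ b] conjI)
          show "\<forall>A. b A \<noteq> 0 \<longrightarrow> admissible A a \<and> card A = q" using b(1) Suc by simp
          show "(\<forall>H. maximal_stable V E H \<longrightarrow> coord H (c H) a = 0) \<longrightarrow> b = (\<lambda>_. 0)" using False by blast
        qed (rule b(2))
      qed
    qed
    then obtain \<beta> where \<beta>: "\<And>a A. \<beta> a A \<noteq> (0::'k) \<Longrightarrow> admissible A a \<and> card A = q"
      "\<And>a H. maximal_stable V E H \<Longrightarrow> keys a \<subseteq> H \<Longrightarrow> coboundary (\<beta> a) H = coord H (c H) a"
      "\<And>a. (\<forall>H. maximal_stable V E H \<longrightarrow> coord H (c H) a = 0) \<Longrightarrow> \<beta> a = (\<lambda>_. 0)"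
      by metis
    have fin: "finite {a. \<beta> a A \<noteq> 0}" for A
    proof (rule finite_subset)
      show "{a. \<beta> a A \<noteq> 0} \<subseteq> (\<Union>H\<in>{H. maximal_stable V E H}. {a. coord H (c H) a \<noteq> 0})"
        using \<beta>(3) by fastforce
      show "finite (\<Union>H\<in>{H. maximal_stable V E H}. {a. coord H (c H) a \<noteq> 0})"
        using finite_maximal_stable finite_coord_support cochain_entry[OF c facet_face] facet_face by auto
    qed
    have "\<exists>P. P \<in> carrier (L A) \<and> coord A P = (\<lambda>a. \<beta> a A)" if "A \<in> faces q" for A
    proof -
      have "A \<subseteq> V" using that by simp
      then obtain P where "P \<in> carrier (L A)" "coord A P = (\<lambda>a. \<beta> a A)"
        by (rule coord_surj[OF _ fin]) (use \<beta>(1) in blast)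
      then show ?thesis by blast
    qed
    then have "\<exists>P. \<forall>A\<in>faces q. P A \<in> carrier (L A) \<and> coord A (P A) = (\<lambda>a. \<beta> a A)"
      by (intro bchoice ballI)
    then obtain P where P: "\<And>A. A \<in> faces q \<Longrightarrow> P A \<in> carrier (L A) \<and> coord A (P A) = (\<lambda>a. \<beta> a A)"
      by blast
    define b where "b = (\<lambda>A\<in>faces q. P A)"
    have b: "b \<in> carrier (cochains q)" unfolding cochains_simps b_def using P by auto
    have "c = cech_differential R M variable V q b"
    proof (rule cochain_ext[OF c])
      show "cech_differential R M variable V q b \<in> carrier (cochains m)"
        unfolding Suc by (rule differential_closed[OF b])
      fix H a assume H: "H \<in> faces m"
      have \<beta>eq: "(\<lambda>A. if A \<in> faces q then coord A (b A) a else 0) = \<beta> a"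
      proof
        fix A
        show "(if A \<in> faces q then coord A (b A) a else 0) = \<beta> a A"
          using P[of A] \<beta>(1)[of a A] by (auto simp: b_def admissible_def stable_set_def)
      qed
      note d = coord_differential(2)[OF b, of H a, unfolded \<beta>eq]
      show "coord H (c H) a = coord H (cech_differential R M variable V q b H) a"
      proof (cases "stable_set V E (H \<union> keys a)")
        case True
        then have "stable_set V E H" by (rule stable_subset) blast
        then have max: "maximal_stable V E H" using H maximal_stableI by simp
        then have "keys a \<subseteq> H" using True unfolding maximal_stable_def by (metis Un_upper1 Un_upper2)
        then show ?thesis using d H Suc True \<beta>(2)[OF max] by simp
      next
        case False
        then have "coord H (c H) a = 0" using adm[OF H, of a] by (auto simp: admissible_def)
        then show ?thesis using d H Suc False by simp
      qed
    qed
    then show ?thesis using b Suc by (auto simp: cech_coboundaries_def)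
  qed
qed (use coboundary_pairing_zero in blast)

subsection \<open>Cohomology classes are determined by their pairings\<close>

abbreviation boundaries :: "('v set \<Rightarrow> (('v, 'k) mpoly set \<times> nat) set) set" where
  "boundaries \<equiv> cech_coboundaries R M variable V m"

lemma boundaries_subset: "boundaries \<subseteq> carrier (cochains m)"
proof (cases m)
  case 0
  then show ?thesis using cochain_zero(1)[of 0] by (simp add: cech_coboundaries_def)
next
  case (Suc q)
  have "cech_differential R M variable V q ` carrier (cochains q) \<subseteq> carrier (cochains (Suc q))"
    using differential_closed by blast
  then show ?thesis unfolding Suc by (simp add: cech_coboundaries_def)
qed

definition pairing_class :: "(('v \<Rightarrow>\<^sub>0 int) \<times> 'v set \<Rightarrow> 'k) \<Rightarrow> ('v set \<Rightarrow> (('v, 'k) mpoly set \<times> nat) set) set" where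
  "pairing_class g = {c \<in> carrier (cochains m). pairing c = g}"

lemma difference_exists:
  assumes "c \<in> carrier (cochains m)" "d \<in> carrier (cochains m)"
  obtains b where "b \<in> carrier (cochains m)" "b \<oplus>\<^bsub>cochains m\<^esub> d = c"
    "pairing b = (\<lambda>t. pairing c t - pairing d t)"
proof -
  let ?d = "scalar (- 1) \<odot>\<^bsub>cochains m\<^esub> d"
  note s = cochain_smult[OF assms(2), where k = "- 1"]
  let ?b = "c \<oplus>\<^bsub>cochains m\<^esub> ?d"
  note b = cochain_add[OF assms(1) s(1)]
  have "?b \<oplus>\<^bsub>cochains m\<^esub> d = c"
    by (rule cochain_ext[OF cochain_add(1)[OF b(1) assms(2)] assms(1)])
      (simp add: cochain_add(2)[OF b(1) assms(2)] b(2) s(2))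
  moreover have "pairing ?b = (\<lambda>t. pairing c t - pairing d t)"
    using pairing_add[OF assms(1) s(1)] pairing_smult[OF assms(2), where k = "- 1"] by (simp add: fun_eq_iff)
  ultimately show thesis using that b(1) by blast
qed

lemma coset_eq_pairing_class:
  assumes c: "c \<in> carrier (cochains m)"
  shows "boundaries +>\<^bsub>cochains m\<^esub> c = pairing_class (pairing c)"
proof
  show "boundaries +>\<^bsub>cochains m\<^esub> c \<subseteq> pairing_class (pairing c)"
    unfolding a_r_coset_def' pairing_class_def
    using boundaries_subset c cochain_add(1) pairing_add[OF _ c] coboundary_pairing_zero
    by (auto simp: fun_eq_iff)
  show "pairing_class (pairing c) \<subseteq> boundaries +>\<^bsub>cochains m\<^esub> c"
  proof
    fix d assume "d \<in> pairing_class (pairing c)"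
    then have d: "d \<in> carrier (cochains m)" "pairing d = pairing c" by (auto simp: pairing_class_def)
    obtain b where b: "b \<in> carrier (cochains m)" "b \<oplus>\<^bsub>cochains m\<^esub> c = d"
      "pairing b = (\<lambda>t. pairing d t - pairing c t)" using difference_exists[OF d(1) c] .
    have "b \<in> boundaries" using coboundary_iff_pairing_zero[OF b(1)] b(3) d(2) by simp
    then show "d \<in> boundaries +>\<^bsub>cochains m\<^esub> c" unfolding a_r_coset_def' using b(2) by auto
  qed
qed

lemma boundaries_eq_pairing_class: "boundaries = pairing_class (\<lambda>_. 0)"
  unfolding pairing_class_def using coboundary_iff_pairing_zero boundaries_subset by blast

abbreviation cohomology where
  "cohomology \<equiv> local_cohomology R M variable V m"

lemma cohomology_simps:
  "\<zero>\<^bsub>cohomology\<^esub> = boundaries"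
  "P \<oplus>\<^bsub>cohomology\<^esub> P' = (\<Union>c\<in>P. \<Union>d\<in>P'. {c \<oplus>\<^bsub>cochains m\<^esub> d})"
  "r \<odot>\<^bsub>cohomology\<^esub> P = (\<Union>c\<in>P. boundaries +>\<^bsub>cochains m\<^esub> (r \<odot>\<^bsub>cochains m\<^esub> c))"
  unfolding local_cohomology_def quotient_module_def
  by (simp_all add: set_add_def' a_r_coset_def')

lemma class_add:
  assumes c: "c \<in> carrier (cochains m)" and d: "d \<in> carrier (cochains m)"
  shows "pairing_class (pairing c) \<oplus>\<^bsub>cohomology\<^esub> pairing_class (pairing d) =
    pairing_class (\<lambda>t. pairing c t + pairing d t)"
proof
  show "pairing_class (pairing c) \<oplus>\<^bsub>cohomology\<^esub> pairing_class (pairing d) \<subseteq>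
      pairing_class (\<lambda>t. pairing c t + pairing d t)"
    unfolding cohomology_simps pairing_class_def using cochain_add(1) pairing_add by (auto simp: fun_eq_iff)
  show "pairing_class (\<lambda>t. pairing c t + pairing d t) \<subseteq>
      pairing_class (pairing c) \<oplus>\<^bsub>cohomology\<^esub> pairing_class (pairing d)"
  proof
    fix e assume e: "e \<in> pairing_class (\<lambda>t. pairing c t + pairing d t)"
    then obtain b where b: "b \<in> carrier (cochains m)" "b \<oplus>\<^bsub>cochains m\<^esub> d = e"
      "pairing b = (\<lambda>t. pairing e t - pairing d t)"
      using difference_exists[of e d] d by (auto simp: pairing_class_def)
    then have "pairing b = pairing c" using e by (simp add: pairing_class_def)
    then have "b \<in> pairing_class (pairing c)" using b(1) by (simp add: pairing_class_def)
    moreover have "d \<in> pairing_class (pairing d)" using d by (simp add: pairing_class_def)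
    ultimately show "e \<in> pairing_class (pairing c) \<oplus>\<^bsub>cohomology\<^esub> pairing_class (pairing d)"
      unfolding cohomology_simps using b(2) by blast
  qed
qed

lemma class_smult:
  assumes c: "c \<in> carrier (cochains m)"
  shows "scalar k \<odot>\<^bsub>cohomology\<^esub> pairing_class (pairing c) = pairing_class (\<lambda>t. k * pairing c t)"
proof -
  have "boundaries +>\<^bsub>cochains m\<^esub> (scalar k \<odot>\<^bsub>cochains m\<^esub> d) = pairing_class (\<lambda>t. k * pairing c t)"
    if "d \<in> pairing_class (pairing c)" for d
  proof -
    have d: "d \<in> carrier (cochains m)" "pairing d = pairing c" using that by (auto simp: pairing_class_def)
    have "pairing (scalar k \<odot>\<^bsub>cochains m\<^esub> d) = (\<lambda>t. k * pairing c t)"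
      by (rule ext) (simp only: pairing_smult[OF d(1)] d(2))
    then show ?thesis using coset_eq_pairing_class[OF cochain_smult(1)[OF d(1)], of k] by simp
  qed
  moreover have "c \<in> pairing_class (pairing c)" using c by (simp add: pairing_class_def)
  ultimately show ?thesis unfolding cohomology_simps by blast
qed

end


section \<open>Dimensions of the graded components\<close>

theorem vectorspace_by_coordinates:
  fixes D :: "('k::field, 'd, 'e) module_scheme" and \<theta> :: "'d \<Rightarrow> 't \<Rightarrow> 'k"
  assumes T: "finite T"
    and inj: "inj_on \<theta> (carrier D)" and range: "\<theta> ` carrier D = {g. \<forall>t. t \<notin> T \<longrightarrow> g t = 0}"
    and zero: "\<zero>\<^bsub>D\<^esub> \<in> carrier D" "\<And>t. \<theta> \<zero>\<^bsub>D\<^esub> t = 0"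
    and add: "\<And>x y. x \<in> carrier D \<Longrightarrow> y \<in> carrier D \<Longrightarrow> x \<oplus>\<^bsub>D\<^esub> y \<in> carrier D"
      "\<And>x y t. x \<in> carrier D \<Longrightarrow> y \<in> carrier D \<Longrightarrow> \<theta> (x \<oplus>\<^bsub>D\<^esub> y) t = \<theta> x t + \<theta> y t"
    and smult: "\<And>c x. x \<in> carrier D \<Longrightarrow> c \<odot>\<^bsub>D\<^esub> x \<in> carrier D"
      "\<And>c x t. x \<in> carrier D \<Longrightarrow> \<theta> (c \<odot>\<^bsub>D\<^esub> x) t = c * \<theta> x t"
  shows "vectorspace class_ring D" "vectorspace.fin_dim class_ring D"
    "vectorspace.dim class_ring D = card T"
proof -
  have eqI: "x = y" if "x \<in> carrier D" "y \<in> carrier D" "\<And>t. \<theta> x t = \<theta> y t" for x y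
    using inj that by (auto simp: inj_on_def)
  note lin = zero add smult
  have neg: "\<exists>y\<in>carrier D. x \<oplus>\<^bsub>D\<^esub> y = \<zero>\<^bsub>D\<^esub>" if x: "x \<in> carrier D" for x
    by (rule bexI[of _ "(- 1) \<odot>\<^bsub>D\<^esub> x"]) (auto intro!: eqI simp: lin x)
  show vs: "vectorspace class_ring D"
    by (rule vs_criteria[OF class_field])
      (use neg in \<open>auto intro!: eqI simp: lin algebra_simps\<close>)
  interpret vectorspace class_ring D by (rule vs)
  have ex: "\<exists>x\<in>carrier D. \<theta> x = g" if "\<And>t. t \<notin> T \<Longrightarrow> g t = 0" for g
  proof -
    have "g \<in> \<theta> ` carrier D" unfolding range using that by blast
    then show ?thesis by blast
  qed
  then have "\<exists>x. x \<in> carrier D \<and> \<theta> x = (\<lambda>s. of_bool (s = t))" if "t \<in> T" for t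
  proof -
    have "s \<notin> T \<Longrightarrow> (of_bool (s = t) :: 'k) = 0" for s using that by auto
    then show ?thesis using ex[of "\<lambda>s. of_bool (s = t)"] by blast
  qed
  then have "\<exists>e. \<forall>t\<in>T. e t \<in> carrier D \<and> \<theta> (e t) = (\<lambda>s. of_bool (s = t))"
    by (intro bchoice ballI)
  then obtain e where e: "\<And>t. t \<in> T \<Longrightarrow> e t \<in> carrier D \<and> \<theta> (e t) = (\<lambda>s. of_bool (s = t))" by blast
  have e_inj: "inj_on e T"
  proof (rule inj_onI)
    fix s t assume st: "s \<in> T" "t \<in> T" "e s = e t"
    then have "\<theta> (e s) s = \<theta> (e t) s" by simp
    then show "s = t" using e[OF st(1)] e[OF st(2)] by (auto split: if_splits)
  qed
  have comb: "\<theta> (lincomb a (e ` T)) t = (if t \<in> T then a (e t) else 0)" for a t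
  proof -
    have am: "abelian_monoid D" using M.abelian_monoid_axioms .
    have "\<theta> (lincomb a (e ` T)) t = (\<Sum>v\<in>e ` T. \<theta> (a v \<odot>\<^bsub>D\<^esub> v) t)"
      unfolding lincomb_def
      by (rule additive_finsum[where \<theta> = "\<lambda>x. \<theta> x t", OF am]) (use lin e T in auto)
    also have "\<dots> = (\<Sum>s\<in>T. if s = t then a (e t) else 0)"
      unfolding sum.reindex[OF e_inj] by (intro sum.cong) (use e smult in auto)
    finally show ?thesis using T by simp
  qed
  have sub: "e ` T \<subseteq> carrier D" and fin: "finite (e ` T)" using e T by auto
  have basis: "basis (e ` T)"
    unfolding basis_criterion[OF fin sub]
  proof (intro allI impI)
    fix v assume v: "v \<in> carrier D"
    have vT: "\<theta> v t = 0" if "t \<notin> T" for t using range v that by blast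
    define a where "a = (\<lambda>x\<in>e ` T. \<theta> v (the_inv_into T e x))"
    have ae: "a (e t) = \<theta> v t" if "t \<in> T" for t
      using that by (simp add: a_def the_inv_into_f_f[OF e_inj])
    show "\<exists>!a. a \<in> e ` T \<rightarrow>\<^sub>E carrier class_ring \<and> lincomb a (e ` T) = v"
    proof (rule ex1I[of _ a])
      have "lincomb a (e ` T) = v"
        by (rule eqI[OF _ v]) (use sub fin in \<open>auto intro!: lincomb_closed simp: comb ae vT\<close>)
      then show "a \<in> e ` T \<rightarrow>\<^sub>E carrier class_ring \<and> lincomb a (e ` T) = v"
        by (simp add: a_def)
      fix b assume b: "b \<in> e ` T \<rightarrow>\<^sub>E carrier class_ring \<and> lincomb b (e ` T) = v"
      show "b = a"
      proof
        fix x
        show "b x = a x"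
        proof (cases "x \<in> e ` T")
          case True
          then show ?thesis using comb[of b] b ae by auto
        next
          case False
          then show ?thesis using b by (auto simp: a_def)
        qed
      qed
    qed
  qed
  then show "fin_dim" unfolding fin_dim_def basis_def using fin sub by blast
  show "dim = card T" using dim_basis[OF fin basis] card_image[OF e_inj] by simp
qed

context stanley_reisner_partition
begin

definition degree_index :: "int \<Rightarrow> (('v \<Rightarrow>\<^sub>0 int) \<times> 'v set) set" where
  "degree_index l = {(a, G) \<in> pairing_index. total_degree a = l}"

lemma pairing_outside: "t \<notin> pairing_index \<Longrightarrow> pairing c t = 0"
  by (auto simp: pairing_def split: prod.split)

lemma pairing_degree:
  assumes c: "c \<in> carrier (cochains m)" and deg: "\<And>A. A \<in> faces m \<Longrightarrow> c A \<in> component_L A l"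
    and t: "t \<notin> degree_index l"
  shows "pairing c t = 0"
proof (cases "t \<in> pairing_index")
  case True
  obtain a G where ag: "t = (a, G)" by (cases t)
  then have ne: "total_degree a \<noteq> l" using t True by (auto simp: degree_index_def)
  have "coord H (c H) a = 0" if "H \<in> cross_polytope (keys a) G" for H
    using coord_degree[of H "c H" l a] deg[OF cross_polytope_face[OF that]]
      cross_polytope_face[OF that] ne by auto
  then show ?thesis unfolding ag pairing_def cycle_pairing_def by (simp add: sum.neutral)
qed (rule pairing_outside)

lemma pairing_surj:
  assumes fin: "finite (degree_index l)" and g: "\<And>t. t \<notin> degree_index l \<Longrightarrow> g t = 0"
  obtains c where "c \<in> carrier (cochains m)" "\<And>A. A \<in> faces m \<Longrightarrow> c A \<in> component_L A l" "pairing c = g"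
proof -
  define h where "h H a = (if (a, H) \<in> degree_index l then orientation H * g (a, H) else 0)" for H a
  have hD: "(a, H) \<in> degree_index l" if "h H a \<noteq> 0" for H a
    using that by (auto simp: h_def split: if_splits)
  have "\<exists>P. P \<in> carrier (L A) \<and> coord A P = h A \<and> P \<in> component_L A l" if A: "A \<in> faces m" for A
  proof -
    have AV: "A \<subseteq> V" using A by simp
    have "{a. h A a \<noteq> 0} \<subseteq> fst ` degree_index l" using hD by force
    then have finh: "finite {a. h A a \<noteq> 0}" using fin by (meson finite_imageI finite_subset)
    have adm: "admissible A a" if "h A a \<noteq> 0" for a
    proof -
      have max: "maximal_stable V E A" "keys a \<subseteq> A"
        using hD[OF that] by (auto simp: degree_index_def pairing_index_def good_facet_def)
      then have "A \<union> keys a = A" by blast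
      moreover have "lookup a v = 0" if "v \<notin> A" for v using max(2) that by (auto simp: in_keys_iff)
      ultimately show ?thesis using maximal_stable_stable[OF max(1)] by (simp add: admissible_def)
    qed
    have "total_degree a = l" if "h A a \<noteq> 0" for a using hD[OF that] by (simp add: degree_index_def)
    then show ?thesis using coord_surj[OF AV finh adm] by metis
  qed
  then have "\<exists>P. \<forall>A\<in>faces m. P A \<in> carrier (L A) \<and> coord A (P A) = h A \<and> P A \<in> component_L A l"
    by (intro bchoice ballI)
  then obtain P where P: "\<And>A. A \<in> faces m \<Longrightarrow> P A \<in> carrier (L A) \<and> coord A (P A) = h A \<and> P A \<in> component_L A l"
    by blast
  define c where "c = (\<lambda>A\<in>faces m. P A)"
  have cP: "c A = P A" if "A \<in> faces m" for A using that by (simp only: c_def restrict_apply if_True)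
  have c: "c \<in> carrier (cochains m)" unfolding cochains_simps c_def using P by auto
  have "pairing c t = g t" for t
  proof (cases "t \<in> pairing_index")
    case True
    obtain a G where ag: "t = (a, G)" by (cases t)
    have G: "good_facet (keys a) G" using True by (simp add: ag pairing_index_def)
    have "pairing c t = cycle_pairing (keys a) G (\<lambda>H. h H a)"
      unfolding ag pairing_def using True cP P cross_polytope_face
      by (auto simp: ag intro!: cycle_pairing_cong)
    also have "\<dots> = orientation G * h G a"
      by (rule cycle_pairing_good[OF G])
        (use hD in \<open>auto simp: degree_index_def pairing_index_def good_facet_def\<close>)
    also have "\<dots> = g t"
    proof -
      have "(orientation G * orientation G :: 'k) = 1" by (rule orientation_square)
      then show ?thesis using g[of t] by (simp add: h_def ag mult.assoc[symmetric])
    qed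
    finally show ?thesis .
  next
    case False
    then show ?thesis using pairing_outside g by (simp add: degree_index_def split_beta)
  qed
  then show thesis using that[OF c] cP P by (simp add: fun_eq_iff)
qed

lemma edge_local_cohomology_simps:
  defines "D \<equiv> edge_local_cohomology V E m"
  shows "carrier (D l) = {pairing_class (pairing c) | c. c \<in> carrier (cochains m) \<and>
      (\<forall>A\<in>faces m. c A \<in> component_L A l)}"
    "\<zero>\<^bsub>D l\<^esub> = boundaries" "add (D l) = add cohomology"
    "k \<odot>\<^bsub>D l\<^esub> P = scalar k \<odot>\<^bsub>cohomology\<^esub> P"
proof -
  show "carrier (D l) = {pairing_class (pairing c) | c. c \<in> carrier (cochains m) \<and>
      (\<forall>A\<in>faces m. c A \<in> component_L A l)}"
  proof -
    have "carrier (D l) = {boundaries +>\<^bsub>cochains m\<^esub> c | c. c \<in> carrier (cochains m) \<and>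
        (\<forall>A\<in>faces m. c A \<in> component_L A l)}"
      unfolding D_def edge_local_cohomology_def local_cohomology_component_def top_cocycles
      by (simp add: Let_def Ball_def)
    also have "\<dots> = {pairing_class (pairing c) | c. c \<in> carrier (cochains m) \<and>
        (\<forall>A\<in>faces m. c A \<in> component_L A l)}"
      using coset_eq_pairing_class by (intro Collect_cong iff_exI) (metis (no_types, lifting))
    finally show ?thesis .
  qed
qed (simp_all add: D_def edge_local_cohomology_def Let_def cohomology_simps)

theorem local_cohomology_dim:
  assumes fin: "finite (degree_index l)"
  defines "D \<equiv> edge_local_cohomology V E m l ::
    ('k, ('v set \<Rightarrow> (('v, 'k) mpoly set \<times> nat) set) set) module"
  shows "vectorspace class_ring D" "vectorspace.fin_dim class_ring D"
    "vectorspace.dim class_ring D = card (degree_index l)"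
proof -
  define \<theta> where "\<theta> P = pairing (SOME c. c \<in> P)" for P
  have \<theta>: "\<theta> (pairing_class (pairing c)) = pairing c" if "c \<in> carrier (cochains m)" for c
  proof -
    have "c \<in> pairing_class (pairing c)" using that by (simp add: pairing_class_def)
    then have "(SOME d. d \<in> pairing_class (pairing c)) \<in> pairing_class (pairing c)"
      by (rule someI[of "\<lambda>d. d \<in> pairing_class (pairing c)"])
    then show ?thesis by (simp add: \<theta>_def pairing_class_def)
  qed
  note S = edge_local_cohomology_simps[where l = l, folded D_def]
  have carr: "carrier D = pairing_class ` {g. \<forall>t. t \<notin> degree_index l \<longrightarrow> g t = 0}"
  proof
    show "carrier D \<subseteq> pairing_class ` {g. \<forall>t. t \<notin> degree_index l \<longrightarrow> g t = 0}"
      unfolding S using pairing_degree by blast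
    show "pairing_class ` {g. \<forall>t. t \<notin> degree_index l \<longrightarrow> g t = 0} \<subseteq> carrier D"
    proof
      fix P assume "P \<in> pairing_class ` {g. \<forall>t. t \<notin> degree_index l \<longrightarrow> g t = 0}"
      then obtain g where g: "P = pairing_class g" "\<And>t. t \<notin> degree_index l \<Longrightarrow> g t = 0" by blast
      show "P \<in> carrier D"
      proof (rule pairing_surj[OF fin g(2)])
        fix c assume "c \<in> carrier (cochains m)" "\<And>A. A \<in> faces m \<Longrightarrow> c A \<in> component_L A l" "pairing c = g"
        then show "P \<in> carrier D" unfolding S g(1) by blast
      qed
    qed
  qed
  have \<theta>g: "\<theta> (pairing_class g) = g" "\<exists>c\<in>carrier (cochains m). pairing c = g"
    if g0: "\<forall>t. t \<notin> degree_index l \<longrightarrow> g t = 0" for g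
  proof -
    obtain c where "c \<in> carrier (cochains m)" "pairing c = g"
      by (rule pairing_surj[OF fin, of g]) (use g0 in blast)
    then show "\<theta> (pairing_class g) = g" "\<exists>c\<in>carrier (cochains m). pairing c = g" using \<theta> by blast+
  qed
  have add: "pairing_class g \<oplus>\<^bsub>D\<^esub> pairing_class g' = pairing_class (\<lambda>t. g t + g' t)"
    if g: "\<forall>t. t \<notin> degree_index l \<longrightarrow> g t = 0" and g': "\<forall>t. t \<notin> degree_index l \<longrightarrow> g' t = 0" for g g'
    unfolding S using \<theta>g(2)[OF g] \<theta>g(2)[OF g'] class_add by blast
  have smult: "k \<odot>\<^bsub>D\<^esub> pairing_class g = pairing_class (\<lambda>t. k * g t)"
    if g: "\<forall>t. t \<notin> degree_index l \<longrightarrow> g t = 0" for g k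
    unfolding S using \<theta>g(2)[OF g] class_smult by blast
  have zero: "\<zero>\<^bsub>D\<^esub> = pairing_class (\<lambda>_. 0)" unfolding S by (rule boundaries_eq_pairing_class)
  have inj: "inj_on \<theta> (carrier D)"
    unfolding carr by (rule inj_onI) (use \<theta>g(1) in auto)
  have range: "\<theta> ` carrier D = {g. \<forall>t. t \<notin> degree_index l \<longrightarrow> g t = 0}"
    unfolding carr image_image using \<theta>g(1) by (auto simp: image_iff)
  have E: "\<exists>g. x = pairing_class g \<and> (\<forall>t. t \<notin> degree_index l \<longrightarrow> g t = 0)" if "x \<in> carrier D" for x
    using that unfolding carr by blast
  have I: "pairing_class g \<in> carrier D" if "\<forall>t. t \<notin> degree_index l \<longrightarrow> g t = 0" for g
    using that unfolding carr by blast
  have z: "\<zero>\<^bsub>D\<^esub> \<in> carrier D" "\<theta> \<zero>\<^bsub>D\<^esub> t = 0" for t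
    unfolding zero using I \<theta>g(1)[of "\<lambda>_. 0"] by auto
  have a: "x \<oplus>\<^bsub>D\<^esub> y \<in> carrier D" "\<theta> (x \<oplus>\<^bsub>D\<^esub> y) t = \<theta> x t + \<theta> y t"
    if "x \<in> carrier D" "y \<in> carrier D" for x y t
    using E[OF that(1)] E[OF that(2)] by (auto simp: add \<theta>g(1) intro!: I)
  have s: "k \<odot>\<^bsub>D\<^esub> x \<in> carrier D" "\<theta> (k \<odot>\<^bsub>D\<^esub> x) t = k * \<theta> x t"
    if "x \<in> carrier D" for x k t
    using E[OF that] by (auto simp: smult \<theta>g(1) intro!: I)
  show "vectorspace class_ring D" "vectorspace.fin_dim class_ring D"
    "vectorspace.dim class_ring D = card (degree_index l)"
    using vectorspace_by_coordinates[OF fin inj range z a s] by blast+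
qed

end

section \<open>The generating function\<close>

definition restricted_compositions :: "'v set \<Rightarrow> 'v set \<Rightarrow> nat \<Rightarrow> ('v \<Rightarrow> nat) set" where
  "restricted_compositions P G n =
     {b. (\<forall>v. v \<notin> G \<longrightarrow> b v = 0) \<and> (\<forall>v\<in>P. b v \<noteq> 0) \<and> (\<Sum>v\<in>G. b v) = n}"

definition geometric_tail :: "rat fps" where
  "geometric_tail = Abs_fps (\<lambda>n. if n = 0 then 0 else 1)"

lemma finite_restricted_compositions:
  assumes "finite G"
  shows "finite (restricted_compositions P G n)"
proof (rule finite_subset)
  show "restricted_compositions P G n \<subseteq>
      {b. \<forall>v. (v \<in> G \<longrightarrow> b v \<in> {..n}) \<and> (v \<notin> G \<longrightarrow> b v = 0)}"
    using assms by (auto simp: restricted_compositions_def intro: member_le_sum)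
  show "finite {b. \<forall>v. (v \<in> G \<longrightarrow> b v \<in> {..n}) \<and> (v \<notin> G \<longrightarrow> b v = (0::nat))}"
    using assms by (intro finite_set_of_finite_funs) auto
qed

text \<open>A part that has to be positive contributes the factor \<open>y = X / (1 - X)\<close>, any other part the
  factor \<open>1 + y\<close>.\<close>

lemma card_restricted_compositions:
  assumes "finite G"
  shows "P \<subseteq> G \<Longrightarrow> of_nat (card (restricted_compositions P G n)) =
    fps_nth (geometric_tail ^ card P * (1 + geometric_tail) ^ card (G - P)) n"
  using assms
proof (induction G arbitrary: P n rule: finite_induct)
  case empty
  then have "restricted_compositions P {} n = (if n = 0 then {\<lambda>_. 0} else {})"
    by (auto simp: restricted_compositions_def)
  then show ?case using empty by simp
next
  case (insert v G)
  let ?k0 = "if v \<in> P then 1 else 0 :: nat"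
  let ?S = "\<lambda>k. (\<lambda>b. b(v := k)) ` restricted_compositions (P - {v}) G (n - k)"
  have split: "restricted_compositions P (insert v G) n = (\<Union>k\<in>{?k0..n}. ?S k)"
  proof
    show "restricted_compositions P (insert v G) n \<subseteq> (\<Union>k\<in>{?k0..n}. ?S k)"
    proof
      fix b assume b: "b \<in> restricted_compositions P (insert v G) n"
      have "(\<Sum>u\<in>G. (b(v := 0)) u) = (\<Sum>u\<in>G. b u)" using insert.hyps by (intro sum.cong) auto
      then have "b(v := 0) \<in> restricted_compositions (P - {v}) G (n - b v)" "b v \<in> {?k0..n}"
        using b insert.hyps by (auto simp: restricted_compositions_def)
      moreover have "b = (b(v := 0))(v := b v)" by simp
      ultimately show "b \<in> (\<Union>k\<in>{?k0..n}. ?S k)" by (intro UN_I[of "b v"] image_eqI[of b _ "b(v := 0)"])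
    qed
    show "(\<Union>k\<in>{?k0..n}. ?S k) \<subseteq> restricted_compositions P (insert v G) n"
    proof
      fix b' assume "b' \<in> (\<Union>k\<in>{?k0..n}. ?S k)"
      then obtain k b where kb: "k \<in> {?k0..n}" "b \<in> restricted_compositions (P - {v}) G (n - k)" "b' = b(v := k)"
        by blast
      have "(\<Sum>u\<in>G. (b(v := k)) u) = (\<Sum>u\<in>G. b u)" using insert.hyps by (intro sum.cong) auto
      then show "b' \<in> restricted_compositions P (insert v G) n"
        using kb insert.hyps by (auto simp: restricted_compositions_def split: if_splits)
    qed
  qed
  have card_S: "card (?S k) = card (restricted_compositions (P - {v}) G (n - k))" for k
  proof (rule card_image, rule inj_onI)
    fix b b' assume b: "b \<in> restricted_compositions (P - {v}) G (n - k)"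
      "b' \<in> restricted_compositions (P - {v}) G (n - k)" "b(v := k) = b'(v := k)"
    have "b v = b' v" using b(1,2) insert.hyps by (simp add: restricted_compositions_def)
    then show "b = b'" using b(3) by (metis fun_upd_idem_iff fun_upd_upd)
  qed
  have finS: "finite (?S k)" for k using finite_restricted_compositions[OF insert.hyps(1)] by blast
  have disj: "?S i \<inter> ?S j = {}" if "i \<noteq> j" for i j
    using that by (auto dest!: fun_cong[of _ _ v])
  have "card (restricted_compositions P (insert v G) n) = (\<Sum>k\<in>{?k0..n}. card (?S k))"
    unfolding split using finS disj by (intro card_UN_disjoint) auto
  also have "\<dots> = (\<Sum>k\<in>{?k0..n}. card (restricted_compositions (P - {v}) G (n - k)))"
    unfolding card_S ..
  finally have "of_nat (card (restricted_compositions P (insert v G) n)) =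
      (\<Sum>k\<in>{?k0..n}. of_nat (card (restricted_compositions (P - {v}) G (n - k))) :: rat)" by simp
  also have "\<dots> = (\<Sum>k\<in>{?k0..n}. fps_nth (geometric_tail ^ card (P - {v}) * (1 + geometric_tail) ^ card (G - (P - {v}))) (n - k))"
    using insert.prems by (intro sum.cong refl insert.IH) auto
  also have "\<dots> = (\<Sum>k=0..n. fps_nth (if v \<in> P then geometric_tail else 1 + geometric_tail) k *
      fps_nth (geometric_tail ^ card (P - {v}) * (1 + geometric_tail) ^ card (G - (P - {v}))) (n - k))"
    by (rule sum.mono_neutral_cong_left) (auto simp: geometric_tail_def)
  also have "\<dots> = fps_nth ((if v \<in> P then geometric_tail else 1 + geometric_tail) *
      (geometric_tail ^ card (P - {v}) * (1 + geometric_tail) ^ card (G - (P - {v})))) n"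
    by (rule fps_mult_nth[symmetric])
  also have "(if v \<in> P then geometric_tail else 1 + geometric_tail) *
      (geometric_tail ^ card (P - {v}) * (1 + geometric_tail) ^ card (G - (P - {v}))) =
      geometric_tail ^ card P * (1 + geometric_tail) ^ card (insert v G - P)"
  proof (cases "v \<in> P")
    case True
    have "finite P" using insert.prems insert.hyps by (meson finite_insert finite_subset)
    then have "card P = Suc (card (P - {v}))" using True by (metis card_Suc_Diff1)
    then have "geometric_tail ^ card P = geometric_tail * geometric_tail ^ card (P - {v})" by (metis power_Suc)
    moreover have "G - (P - {v}) = insert v G - P" using True insert.hyps by auto
    ultimately show ?thesis using True by (simp only: if_True mult.assoc)
  next
    case False
    then have "insert v G - P = insert v (G - P)" "P - {v} = P" by auto
    then show ?thesis using False insert.hyps by simp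
  qed
  finally show ?case .
qed

lemma geometric_tail_fls: "fps_to_fls geometric_tail = fls_X / (1 - fls_X)"
proof -
  have "geometric_tail * (1 - fps_X) = fps_X"
  proof (rule fps_ext)
    fix n
    show "fps_nth (geometric_tail * (1 - fps_X)) n = fps_nth fps_X n"
      by (cases n) (auto simp: geometric_tail_def right_diff_distrib)
  qed
  then have "fps_to_fls (geometric_tail * (1 - fps_X)) = fls_X" by simp
  then have "fps_to_fls geometric_tail * (1 - fls_X) = fls_X" by (simp add: fls_times_fps_to_fls)
  moreover have "fls_nth (1 - fls_X :: rat fls) 0 = 1" by simp
  then have "(1 - fls_X :: rat fls) \<noteq> 0" by (metis fls_zero_nth zero_neq_one)
  ultimately show ?thesis by (simp add: field_simps)
qed

lemma binomial_expansion:
  fixes y :: "'a::field"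
  assumes "p \<le> m" "p \<le> N"
  shows "(\<Sum>i=0..N. of_nat (p choose i) * y powi (int m - int i)) = y ^ (m - p) * (1 + y) ^ p"
proof -
  have "(\<Sum>i=0..N. of_nat (p choose i) * y powi (int m - int i)) =
      (\<Sum>i\<le>p. of_nat (p choose i) * y powi (int m - int i))"
    using assms(2) by (intro sum.mono_neutral_right) (auto simp: binomial_eq_0)
  also have "\<dots> = (\<Sum>i\<le>p. y ^ (m - p) * (of_nat (p choose i) * 1 ^ i * y ^ (p - i)))"
  proof (rule sum.cong)
    fix i assume i: "i \<in> {..p}"
    then have "int m - int i = int ((m - p) + (p - i))" using assms(1) by simp
    then have "y powi (int m - int i) = y ^ (m - p) * y ^ (p - i)"
      by (simp only: power_int_of_nat power_add)
    then show "of_nat (p choose i) * y powi (int m - int i) =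
        y ^ (m - p) * (of_nat (p choose i) * 1 ^ i * y ^ (p - i))" by simp
  qed simp
  also have "\<dots> = y ^ (m - p) * (1 + y) ^ p"
    unfolding binomial_ring by (simp add: sum_distrib_left)
  finally show ?thesis .
qed

context finite_simple_graph
begin

lemma vertex_cover_iff: "vertex_cover V E C \<longleftrightarrow> C \<subseteq> V \<and> stable_set V E (V - C)"
proof
  assume C: "vertex_cover V E C"
  have "{x, y} \<notin> E" if "x \<in> V - C" "y \<in> V - C" for x y
  proof
    assume e: "{x, y} \<in> E"
    have "\<forall>e\<in>E. e \<inter> C \<noteq> {}" using C by (simp add: vertex_cover_def)
    from bspec[OF this e] have "{x, y} \<inter> C \<noteq> {}" .
    then show False using that by blast
  qed
  then show "C \<subseteq> V \<and> stable_set V E (V - C)" using C by (auto simp: vertex_cover_def stable_set_def)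
next
  assume C: "C \<subseteq> V \<and> stable_set V E (V - C)"
  have "e \<inter> C \<noteq> {}" if e: "e \<in> E" for e
  proof
    assume "e \<inter> C = {}"
    moreover obtain x y where "e = {x, y}" "x \<in> V" "y \<in> V" using edge_cases[OF e] by metis
    ultimately show False using C e by (auto simp: stable_set_def)
  qed
  then show "vertex_cover V E C" using C unfolding vertex_cover_def by blast
qed

lemma Min_covers_complement:
  "C \<in> Min_covers V E \<Longrightarrow> maximal_stable V E (V - C)"
  "maximal_stable V E G \<Longrightarrow> V - G \<in> Min_covers V E"
proof -
  assume "C \<in> Min_covers V E"
  then have C: "vertex_cover V E C" "\<And>D. vertex_cover V E D \<Longrightarrow> D \<subseteq> C \<Longrightarrow> D = C"
    by (auto simp: Min_covers_def)
  show "maximal_stable V E (V - C)"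
    unfolding maximal_stable_def
  proof (intro conjI allI impI)
    show "stable_set V E (V - C)" using C(1) vertex_cover_iff by blast
    fix Y assume Y: "stable_set V E Y \<and> V - C \<subseteq> Y"
    then have "Y \<subseteq> V" by (simp add: stable_set_def)
    then have "V - (V - Y) = Y" by blast
    then have "vertex_cover V E (V - Y)" using Y by (simp add: vertex_cover_iff)
    moreover have "V - Y \<subseteq> C" using Y by blast
    ultimately have "V - Y = C" by (rule C(2))
    then show "Y = V - C" using \<open>Y \<subseteq> V\<close> by blast
  qed
next
  assume G: "maximal_stable V E G"
  have GV: "G \<subseteq> V" "V - (V - G) = G" and st: "stable_set V E G"
    using G unfolding maximal_stable_def stable_set_def by blast+
  have "vertex_cover V E (V - G)" using st GV by (simp add: vertex_cover_iff)
  moreover have "D = V - G" if D: "vertex_cover V E D" "D \<subseteq> V - G" for D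
  proof -
    have "stable_set V E (V - D)" "D \<subseteq> V" using D(1) vertex_cover_iff by blast+
    moreover have "G \<subseteq> V - D" using D(2) GV by blast
    ultimately have "V - D = G" using G unfolding maximal_stable_def by blast
    then show ?thesis using \<open>D \<subseteq> V\<close> by blast
  qed
  ultimately show "V - G \<in> Min_covers V E" by (simp add: Min_covers_def)
qed

lemma sum_Min_covers:
  "(\<Sum>C\<in>Min_covers V E. h (V - C)) = (\<Sum>G\<in>{G. maximal_stable V E G}. h G)"
proof (rule sum.reindex_bij_witness[of _ "\<lambda>G. V - G" "\<lambda>C. V - C"])
  show "V - (V - C) = C" if "C \<in> Min_covers V E" for C
    using that by (auto simp: Min_covers_def vertex_cover_def)
  show "V - (V - G) = G" if "G \<in> {G. maximal_stable V E G}" for G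
    using that by (auto simp: maximal_stable_def stable_set_def)
qed (auto intro: Min_covers_complement)

end

context stanley_reisner_partition
begin

lemma card_maximal_stable_W:
  assumes "maximal_stable V E G"
  shows "card (G \<inter> W) = m - card (G - W)" "card (G - W) \<le> m"
proof -
  have "card (G \<inter> W) + card (G - W) = m"
    using maximal_stable_card[OF assms] maximal_stable_finite[OF assms]
    by (metis Int_Diff_Un Int_Diff_disjoint card_Un_disjoint finite_Diff finite_Int)
  then show "card (G \<inter> W) = m - card (G - W)" "card (G - W) \<le> m" by auto
qed

definition facet_degrees :: "'v set \<Rightarrow> int \<Rightarrow> ('v \<Rightarrow>\<^sub>0 int) set" where
  "facet_degrees G l = {a. (\<forall>v. lookup a v \<le> 0) \<and> keys a \<subseteq> G \<and> (G - keys a) \<inter> W = {} \<and> total_degree a = l}"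

lemma facet_degrees_bij:
  assumes G: "maximal_stable V E G"
  shows "bij_betw (\<lambda>a v. nat (- lookup a v)) (facet_degrees G (- int n)) (restricted_compositions (G \<inter> W) G n)"
proof (rule bij_betw_byWitness[where f' = "\<lambda>b. - int_exponent (Abs_poly_mapping b)"])
  have GV: "G \<subseteq> V" using maximal_stable_stable[OF G] by (simp add: stable_set_def)
  have fin: "finite G" by (rule maximal_stable_finite[OF G])
  have lookup_Abs: "lookup (Abs_poly_mapping b) = b" if "\<forall>v. v \<notin> G \<longrightarrow> b v = 0" for b :: "'v \<Rightarrow> nat"
    by (rule lookup_Abs_poly_mapping, rule finite_subset[OF _ fin]) (use that in auto)
  have total: "total_degree a = (\<Sum>v\<in>G. lookup a v)" if "keys a \<subseteq> G" for a
    unfolding total_degree_def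
    by (rule sum.mono_neutral_right[OF finite_vertices GV]) (use that in \<open>auto simp: in_keys_iff\<close>)
  let ?f = "\<lambda>a v. nat (- lookup a v)" and ?g = "\<lambda>b. - int_exponent (Abs_poly_mapping b)"
  have f0: "\<forall>v. v \<notin> G \<longrightarrow> ?f a v = 0" if "a \<in> facet_degrees G (- int n)" for a
    using that by (auto simp: facet_degrees_def in_keys_iff subset_iff)
  show "\<forall>a\<in>facet_degrees G (- int n). ?g (?f a) = a"
  proof
    fix a assume a: "a \<in> facet_degrees G (- int n)"
    show "?g (?f a) = a"
    proof (rule poly_mapping_eqI)
      fix v
      have "lookup a v \<le> 0" using a by (simp add: facet_degrees_def)
      then show "lookup (?g (?f a)) v = lookup a v"
        by (simp add: lookup_int_exponent lookup_Abs[OF f0[OF a]])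
    qed
  qed
  show "\<forall>b\<in>restricted_compositions (G \<inter> W) G n. ?f (?g b) = b"
    by (auto simp: lookup_int_exponent lookup_Abs restricted_compositions_def)
  show "?f ` facet_degrees G (- int n) \<subseteq> restricted_compositions (G \<inter> W) G n"
  proof
    fix b assume "b \<in> ?f ` facet_degrees G (- int n)"
    then obtain a where a: "a \<in> facet_degrees G (- int n)" "b = ?f a" by blast
    have neg: "lookup a v \<le> 0" for v using a(1) by (simp add: facet_degrees_def)
    have "int (\<Sum>v\<in>G. ?f a v) = - (\<Sum>v\<in>G. lookup a v)"
      using neg by (simp add: sum_negf[symmetric])
    moreover have "(\<Sum>v\<in>G. lookup a v) = - int n" using a(1) total[of a] by (simp add: facet_degrees_def)
    ultimately have "(\<Sum>v\<in>G. ?f a v) = n" by linarith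
    moreover have "?f a v \<noteq> 0" if "v \<in> G \<inter> W" for v
    proof -
      have "v \<in> keys a" using a(1) that by (auto simp: facet_degrees_def)
      then show ?thesis using neg[of v] by (simp add: in_keys_iff)
    qed
    ultimately show "b \<in> restricted_compositions (G \<inter> W) G n"
      unfolding a(2) restricted_compositions_def using f0[OF a(1)] by (intro CollectI conjI ballI)
  qed
  show "?g ` restricted_compositions (G \<inter> W) G n \<subseteq> facet_degrees G (- int n)"
  proof
    fix a assume "a \<in> ?g ` restricted_compositions (G \<inter> W) G n"
    then obtain b where b: "b \<in> restricted_compositions (G \<inter> W) G n" "a = ?g b" by blast
    have b0: "\<forall>v. v \<notin> G \<longrightarrow> b v = 0" using b(1) by (simp add: restricted_compositions_def)
    have la: "lookup a v = - int (b v)" for v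
      unfolding b(2) by (simp add: lookup_int_exponent lookup_Abs[OF b0])
    have ka: "keys a = {v. b v \<noteq> 0}" by (auto simp: in_keys_iff la)
    have kG: "keys a \<subseteq> G" unfolding ka using b0 by auto
    have "total_degree a = - int (\<Sum>v\<in>G. b v)" unfolding total[OF kG] by (simp add: la sum_negf)
    then show "a \<in> facet_degrees G (- int n)"
      unfolding facet_degrees_def using kG b(1)
      by (auto simp: la ka restricted_compositions_def)
  qed
qed

lemma degree_index_eq:
  "degree_index l = (\<lambda>(G, a). (a, G)) ` (SIGMA G:{G. maximal_stable V E G}. facet_degrees G l)"
  by (auto simp: degree_index_def pairing_index_def good_facet_def facet_degrees_def image_iff)

lemma finite_facet_degrees:
  assumes "maximal_stable V E G"
  shows "finite (facet_degrees G (- int n))"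
  using facet_degrees_bij[OF assms] finite_restricted_compositions[OF maximal_stable_finite[OF assms]]
    bij_betw_finite by blast

lemma facet_degrees_positive: "0 < l \<Longrightarrow> facet_degrees G l = {}"
proof -
  have "total_degree a \<le> 0" if "\<forall>v. lookup a v \<le> 0" for a
    unfolding total_degree_def using that by (intro sum_nonpos) blast
  then show "0 < l \<Longrightarrow> facet_degrees G l = {}" unfolding facet_degrees_def by force
qed

lemma finite_degree_index: "finite (degree_index l)"
proof (cases "0 < l")
  case True
  then show ?thesis by (simp add: degree_index_eq facet_degrees_positive)
next
  case False
  then have "l = - int (nat (- l))" by simp
  then show ?thesis unfolding degree_index_eq
    using finite_facet_degrees[of _ "nat (- l)"] finite_maximal_stable by (intro finite_imageI finite_SigmaI) auto
qed

theorem card_degree_index: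
  "of_nat (card (degree_index l)) = fls_nth
    (\<Sum>G\<in>{G. maximal_stable V E G}. fps_to_fls
      (geometric_tail ^ (m - card (G - W)) * (1 + geometric_tail) ^ card (G - W))) (- l)"
proof -
  have fls_sum: "fls_nth (sum g A) k = (\<Sum>G\<in>A. fls_nth (g G) k)" for g :: "'v set \<Rightarrow> rat fls" and A k
    by (induction A rule: infinite_finite_induct) auto
  show ?thesis
  proof (cases "0 < l")
    case True
    then show ?thesis by (simp add: degree_index_eq facet_degrees_positive fls_sum)
  next
    case False
    define n where "n = nat (- l)"
    have l: "l = - int n" using False by (simp add: n_def)
    have "card (degree_index l) = card (SIGMA G:{G. maximal_stable V E G}. facet_degrees G l)"
      unfolding degree_index_eq by (rule card_image) (auto simp: inj_on_def)
    also have "\<dots> = (\<Sum>G\<in>{G. maximal_stable V E G}. card (facet_degrees G l))"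
      unfolding l using finite_maximal_stable finite_facet_degrees by (intro card_SigmaI) auto
    finally have "(of_nat (card (degree_index l)) :: rat) =
        (\<Sum>G\<in>{G. maximal_stable V E G}. of_nat (card (facet_degrees G l)))" by simp
    also have "\<dots> = (\<Sum>G\<in>{G. maximal_stable V E G}. fls_nth (fps_to_fls
      (geometric_tail ^ (m - card (G - W)) * (1 + geometric_tail) ^ card (G - W))) (- l))"
    proof (rule sum.cong)
      fix G assume "G \<in> {G. maximal_stable V E G}"
      then have G: "maximal_stable V E G" by simp
      have "card (facet_degrees G l) = card (restricted_compositions (G \<inter> W) G n)"
        unfolding l by (rule bij_betw_same_card[OF facet_degrees_bij[OF G]])
      then show "(of_nat (card (facet_degrees G l)) :: rat) = fls_nth (fps_to_fls
          (geometric_tail ^ (m - card (G - W)) * (1 + geometric_tail) ^ card (G - W))) (- l)"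
        using card_restricted_compositions[OF maximal_stable_finite[OF G], of "G \<inter> W" n]
          card_maximal_stable_W[OF G] by (simp add: l Diff_Int)
    qed simp
    finally show ?thesis unfolding fls_sum .
  qed
qed

text \<open>Over all supports, a maximal stable set \<open>G\<close> contributes \<open>y^card (G \<inter> W) * (1 + y)^card (G - W)\<close>
  with \<open>y = X / (1 - X)\<close>.\<close>

theorem Hilbert_series_top_local_cohomology:
  "has_Hilbert_series
    (edge_local_cohomology V E m ::
       int \<Rightarrow> ('k, ('v set \<Rightarrow> (('v, 'k) mpoly set \<times> nat) set) set) module)
    (\<Sum>i = 0..card V. \<Sum>C\<in>Min_covers V E.
       of_nat (card ((V - W) - C) choose i) * (fls_X / (1 - fls_X)) powi (int m - int i))"
proof -
  have "(\<Sum>i = 0..card V. \<Sum>C\<in>Min_covers V E.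
       of_nat (card ((V - W) - C) choose i) * (fls_X / (1 - fls_X)) powi (int m - int i)) =
     (\<Sum>C\<in>Min_covers V E. \<Sum>i = 0..card V.
       of_nat (card ((V - C) - W) choose i) * (fls_X / (1 - fls_X) :: rat fls) powi (int m - int i))"
    proof (subst sum.swap, intro sum.cong refl)
    fix C i
    have "(V - W) - C = (V - C) - W" by blast
    then show "of_nat (card ((V - W) - C) choose i) * (fls_X / (1 - fls_X) :: rat fls) powi (int m - int i) =
        of_nat (card ((V - C) - W) choose i) * (fls_X / (1 - fls_X)) powi (int m - int i)" by simp
  qed
  also have "\<dots> = (\<Sum>G\<in>{G. maximal_stable V E G}. \<Sum>i = 0..card V.
       of_nat (card (G - W) choose i) * (fls_X / (1 - fls_X)) powi (int m - int i))"
    by (rule sum_Min_covers)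
  also have "\<dots> = (\<Sum>G\<in>{G. maximal_stable V E G}. fps_to_fls
      (geometric_tail ^ (m - card (G - W)) * (1 + geometric_tail) ^ card (G - W)))"
  proof (rule sum.cong)
    fix G assume "G \<in> {G. maximal_stable V E G}"
    then have G: "maximal_stable V E G" by simp
    then have "G - W \<subseteq> V" by (auto simp: maximal_stable_def stable_set_def)
    then have le: "card (G - W) \<le> m" "card (G - W) \<le> card V"
      using card_maximal_stable_W[OF G] card_mono[OF finite_vertices] by auto
    show "(\<Sum>i = 0..card V. of_nat (card (G - W) choose i) * (fls_X / (1 - fls_X)) powi (int m - int i)) =
        fps_to_fls (geometric_tail ^ (m - card (G - W)) * (1 + geometric_tail) ^ card (G - W))"
      unfolding binomial_expansion[OF le] geometric_tail_fls[symmetric]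
      by (simp add: fls_times_fps_to_fls fps_to_fls_power)
  qed simp
  finally show ?thesis
    unfolding has_Hilbert_series_def
    using local_cohomology_dim[OF finite_degree_index] card_degree_index by simp
qed

end

theorem corollary4p5:
  fixes V :: "'v::linorder set" and E :: "'v set set"
    and F :: "nat \<Rightarrow> 'v set" and w :: "nat \<Rightarrow> 'v" and m :: nat
  assumes "simple_graph V E"
    and "chordal V E"
    and "Cohen_Macaulay_graph TYPE('k::field) V E"
    and "bij_betw F {1..m} {C. maximal_clique V E C \<and> (\<exists>v\<in>C. free_vertex V E v)}"
    and "\<forall>i\<in>{1..m}. w i \<in> F i \<and> free_vertex V E (w i)"
  shows "has_Hilbert_series
    (edge_local_cohomology V E m ::
       int \<Rightarrow> ('k, ('v set \<Rightarrow> (('v, 'k) mpoly set \<times> nat) set) set) module)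
    (\<Sum>i = 0..card V. \<Sum>C\<in>Min_covers V E.
       of_nat (card ((V - w ` {1..m}) - C) choose i) *
         (fls_X / (1 - fls_X)) powi (int m - int i))"
proof -
  interpret chordal_graph V E by unfold_locales fact+
  interpret stanley_reisner V E "TYPE('k)" by unfold_locales
  note wc = Cohen_Macaulay_imp_well_covered[OF assms(3)]
  have image: "F ` {1..m} = {C. simplex V E C}" and inj: "inj_on F {1..m}"
    using assms(4) by (simp_all add: bij_betw_def simplex_def)
  have F: "simplex V E C \<longleftrightarrow> (\<exists>i\<in>{1..m}. F i = C)" for C
  proof -
    have "simplex V E C \<longleftrightarrow> C \<in> F ` {1..m}" unfolding image by simp
    then show ?thesis by blast
  qed
  interpret stanley_reisner_partition V E "TYPE('k)" F w m
  proof unfold_locales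
    fix i assume i: "i \<in> {1..m}"
    then have Fi: "maximal_clique V E (F i)" using F[of "F i"] by (auto simp: simplex_def)
    then show "clique V E (F i)" by (simp add: maximal_clique_def)
    show "w i \<in> F i" using assms(5) i by blast
    show "u \<in> F i" if "{w i, u} \<in> E" for u
      using free_vertex_neighbour[OF _ Fi _ that] assms(5) i by blast
    show "i = j" if "j \<in> {1..m}" "v \<in> F i" "v \<in> F j" for j v
    proof -
      have "simplex V E (F i)" "simplex V E (F j)" using F i that(1) by blast+
      then have "F i = F j" using simplices_disjoint[OF wc] that(2,3) by blast
      then show ?thesis using inj_onD[OF inj _ i that(1)] by blast
    qed
  next
    fix v assume "v \<in> V"
    then obtain C where "simplex V E C" "v \<in> C" using simplices_cover[OF wc] by blast
    then show "\<exists>i\<in>{1..m}. v \<in> F i" using F by blast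
  qed
  show ?thesis using Hilbert_series_top_local_cohomology unfolding W_def .
qed

end
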